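(* Let $E=\{x_n\}\subseteq\mathbb{R}^d$ be a separated sequence, and let $\Lambda\subseteq\widehat{\mathbb{R}}^d$ be a compact S-set of strict multiplicity which is convex and symmetric about $0$. If balayage is possible for $(E,\Lambda)$, then there exist $A,B>0$ such that for all $f\in PW_\Lambda\setminus\{0\}$, $F=\widehat f$, $$A^{1/2}\frac{\int_\Lambda|F(\gamma)+F(2\gamma)+F(3\gamma)|^2\,d\gamma}{\left(\int_\Lambda|F(\gamma)|^2\,d\gamma\right)^{1/2}}\le\Big(\sum_{x\in E}|f(x)|^2\Big)^{1/2}+\frac12\Big(\sum_{x\in E}|f(\tfrac12x)|^2\Big)^{1/2}+\frac13\Big(\sum_{x\in E}|f(\tfrac13x)|^2\Big)^{1/2}\le B^{1/2}\Big(\int_\Lambda|F(\gamma)|^2\,d\gamma\Big)^{1/2}.$$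
   Context: Fourier transform $\widehat f(\gamma)=\int f(x)e^{-2\pi i x\cdot\gamma}dx$; $\widehat{\mathbb{R}}^d$ is $\mathbb{R}^d$ as frequency domain; $F$ is regarded as a function on $\widehat{\mathbb{R}}^d$ vanishing off $\Lambda$. $PW_\Lambda=\{f\in L^2(\mathbb{R}^d):\operatorname{supp}\widehat f\subseteq\Lambda\}$. $M_b(X)$: bounded complex Radon measures supported in closed $X$. $\mathcal{C}(\Lambda)=\{f\in C_b(\mathbb{R}^d):\operatorname{supp}\widehat f\subseteq\Lambda\}$. Balayage possible for $(E,\Lambda)$: every $\mu\in M_b(\mathbb{R}^d)$ has $\nu\in M_b(E)$ with $\widehat\mu=\widehat\nu$ on $\Lambda$. S-set: for all $f\in\mathcal{C}(\Lambda)$, $\mu\in M_b(\mathbb{R}^d)$ with $\widehat\mu=0$ on $\Lambda$, $\int f\,d\mu=0$. Strict multiplicity: some $\mu\in M_b(\Lambda)\setminus\{0\}$ with $|\mu^\vee(x)|\to0$ as $\|x\|\to\infty$. Separated: $\inf\{\|x-y\|:x\ne y\in E\}>0$. *)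

theory Defs
  imports "HOL-Analysis.Analysis"
begin

definition fourier :: "('a::euclidean_space \<Rightarrow> complex) \<Rightarrow> 'a \<Rightarrow> complex" where
  "fourier f \<gamma> = (\<integral>x. f x * exp (- 2 * pi * \<i> * complex_of_real (x \<bullet> \<gamma>)) \<partial>lborel)"

definition inv_fourier :: "('a::euclidean_space \<Rightarrow> complex) \<Rightarrow> 'a \<Rightarrow> complex" where
  "inv_fourier F x = (\<integral>\<gamma>. F \<gamma> * exp (2 * pi * \<i> * complex_of_real (x \<bullet> \<gamma>)) \<partial>lborel)"

text \<open>Bounded complex Radon measures on R^d are represented as \<open>h \<cdot> M\<close> with
  \<open>M\<close> a finite Borel measure and \<open>h \<in> L^1(M)\<close> (every complex measure has such a
  representation, e.g. polar decomposition with M = |mu|).  The measure lies in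
  \<open>M_b(X)\<close> if M is concentrated on X.\<close>
definition cmeasure_in :: "'a::euclidean_space measure \<Rightarrow> ('a \<Rightarrow> complex) \<Rightarrow> 'a set \<Rightarrow> bool" where
  "cmeasure_in M h X \<longleftrightarrow> finite_measure M \<and> sets M = sets borel \<and> integrable M h
     \<and> emeasure M (UNIV - X) = 0"

definition cmeasure_zero :: "'a::euclidean_space measure \<Rightarrow> ('a \<Rightarrow> complex) \<Rightarrow> bool" where
  "cmeasure_zero M h \<longleftrightarrow> (AE x in M. h x = 0)"

definition fourier_meas :: "'a::euclidean_space measure \<Rightarrow> ('a \<Rightarrow> complex) \<Rightarrow> 'a \<Rightarrow> complex" where
  "fourier_meas M h \<gamma> = (\<integral>x. h x * exp (- 2 * pi * \<i> * complex_of_real (x \<bullet> \<gamma>)) \<partial>M)"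

definition inv_fourier_meas :: "'a::euclidean_space measure \<Rightarrow> ('a \<Rightarrow> complex) \<Rightarrow> 'a \<Rightarrow> complex" where
  "inv_fourier_meas M h x = (\<integral>\<gamma>. h \<gamma> * exp (2 * pi * \<i> * complex_of_real (x \<bullet> \<gamma>)) \<partial>M)"

text \<open>C-infinity: all partial derivatives of all orders exist (everywhere) and are
  continuous; expressed as: f belongs to a family of continuous functions closed
  under taking partial derivatives in the coordinate directions.\<close>
definition smooth_fun :: "('a::euclidean_space \<Rightarrow> complex) \<Rightarrow> bool" where
  "smooth_fun f \<longleftrightarrow> (\<exists>S. f \<in> S \<and> (\<forall>g\<in>S. continuous_on UNIV g \<and>
      (\<forall>b\<in>Basis. \<exists>g'\<in>S. \<forall>x. ((\<lambda>t::real. g (x + t *\<^sub>R b)) has_vector_derivative g' x) (at 0))))"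

definition tsupport :: "('a::euclidean_space \<Rightarrow> complex) \<Rightarrow> 'a set" where
  "tsupport \<phi> = closure {x. \<phi> x \<noteq> 0}"

definition test_fun :: "('a::euclidean_space \<Rightarrow> complex) \<Rightarrow> bool" where
  "test_fun \<phi> \<longleftrightarrow> smooth_fun \<phi> \<and> compact (tsupport \<phi>)"

text \<open>\<open>\<C>(\<Lambda>)\<close>: bounded continuous f whose distributional Fourier transform is
  supported in \<Lambda>, i.e. \<open><hat f, \<phi>> = <f, hat \<phi>> = 0\<close> for every test function \<phi>
  whose support is disjoint from \<Lambda>.\<close>
definition Cspec :: "'a::euclidean_space set \<Rightarrow> ('a \<Rightarrow> complex) set" where
  "Cspec \<Lambda> = {f. continuous_on UNIV f \<and> bounded (range f) \<and>
      (\<forall>\<phi>. test_fun \<phi> \<and> tsupport \<phi> \<inter> \<Lambda> = {} \<longrightarrow>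
            (\<integral>x. f x * fourier \<phi> x \<partial>lborel) = 0)}"

definition S_set :: "'a::euclidean_space set \<Rightarrow> bool" where
  "S_set \<Lambda> \<longleftrightarrow> (\<forall>f\<in>Cspec \<Lambda>. \<forall>M h. cmeasure_in M h UNIV \<and> (\<forall>\<gamma>\<in>\<Lambda>. fourier_meas M h \<gamma> = 0)
      \<longrightarrow> (\<integral>x. f x * h x \<partial>M) = 0)"

definition strict_multiplicity :: "'a::euclidean_space set \<Rightarrow> bool" where
  "strict_multiplicity \<Lambda> \<longleftrightarrow> (\<exists>M h. cmeasure_in M h \<Lambda> \<and> \<not> cmeasure_zero M h \<and>
      ((\<lambda>x. inv_fourier_meas M h x) \<longlongrightarrow> 0) (at_infinity :: 'a filter))"

definition balayage :: "'a::euclidean_space set \<Rightarrow> 'a set \<Rightarrow> bool" where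
  "balayage E \<Lambda> \<longleftrightarrow> (\<forall>M h. cmeasure_in M h UNIV \<longrightarrow>
      (\<exists>N g. cmeasure_in N g E \<and> (\<forall>\<gamma>\<in>\<Lambda>. fourier_meas M h \<gamma> = fourier_meas N g \<gamma>)))"

definition separated :: "'a::euclidean_space set \<Rightarrow> bool" where
  "separated E \<longleftrightarrow> (\<exists>\<delta>>0. \<forall>x\<in>E. \<forall>y\<in>E. x \<noteq> y \<longrightarrow> \<delta> \<le> dist x y)"

text \<open>L^2(\<Lambda>) representatives: square integrable, vanishing off \<Lambda>.  Elements of
  PW_\<Lambda> are exactly the (continuous representatives of) inv_fourier F for such F,
  and then hat f = F.\<close>
definition L2_on :: "'a::euclidean_space set \<Rightarrow> ('a \<Rightarrow> complex) set" where
  "L2_on \<Lambda> = {F. F \<in> borel_measurable lborel \<and> integrable lborel (\<lambda>\<gamma>. (cmod (F \<gamma>))\<^sup>2)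
      \<and> (\<forall>\<gamma>. \<gamma> \<notin> \<Lambda> \<longrightarrow> F \<gamma> = 0)}"

end

theory Submission
  imports Defs "HOL-Probability.Probability"
begin

text \<open>Everything reduces to \<open>E\<close> giving a Fourier frame for \<open>PW \<Lambda>\<close>: the three sample sums are then
  bounded by the norm of \<open>F\<close>, while the first alone dominates it, and the norm of
  \<open>F + F(2 \<cdot>) + F(3 \<cdot>)\<close> is at most a multiple of that of \<open>F\<close>.  The upper frame bound
  only needs separation, by duality and a Gaussian majorant of the indicator of \<open>\<Lambda>\<close>.

  For the lower bound, uniform boundedness turns balayage into
  \<open>sup |f| \<le> K sup_E |f|\<close> for \<open>f\<close> with spectrum in \<open>\<Lambda>\<close>.  If \<open>x\<close> nearly maximises
  \<open>|f|\<close> damped by the slowly varying weight \<open>(1 + \<epsilon> |x - t|)^(-d)\<close>, then \<open>f\<close> grows slowly away from \<open>x\<close>.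
  Such an \<open>f\<close> cannot be uniformly small, compared with \<open>|f x|\<close>, at the points of \<open>E\<close> in a fixed ball
  around \<open>x\<close>: otherwise the average of \<open>f((1 - s) \<cdot>) \<theta>(s \<cdot>)\<close> over finitely many widely separated
  scales \<open>s\<close>, whose spectrum stays in the convex set \<open>\<Lambda>\<close>, would violate the sup-norm inequality.
  Hence \<open>|f t|\<close> is bounded by \<open>|f|\<close> at a point of \<open>E\<close> times a square-integrable weight, and
  integrating the squares in \<open>t\<close> gives the bound.\<close>

section \<open>Exponentials and square-integrable band-limited functions\<close>

text \<open>The sampling inequality is available only for spectrum inside \<open>\<Lambda>\<close>
  itself. Localising \<open>f\<close> by a decaying factor widens the spectrum, so it has to be
  contracted first: convexity and a ball about 0 in \<open>\<Lambda>\<close> give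
  \<open>(1 - s) \<Lambda> + s B \<subseteq> \<Lambda>\<close>. The price is that \<open>f\<close>
  is then read at \<open>(1 - s) x\<close>, not at the sample point \<open>x\<close>. Bernstein's
  inequality repairs this only while \<open>s |x|\<close> is small, and the damping helps only once
  \<open>s |x|\<close> is large; the range in between is the real obstacle. The exponents are tied
  together: a weight of order \<open>d = DIM('a)\<close> has an integrable square, and a kernel of
  order \<open>2 d\<close> beats growth of order \<open>d\<close> and leaves decay of order
  \<open>d\<close>. Only the half \<open>\<integral>|F|^2 \<le> \<integral>|f|^2\<close> of
  Plancherel's theorem is used, both for Bernstein's inequality and at the end; the integrability of
  \<open>|f|^2\<close> always comes from an explicit majorant. The constants of the local step may
  depend neither on \<open>F\<close> nor on \<open>E\<close>, since both are translated when a
  near-maximum is moved to the origin. A ball about 0 exists only if \<open>\<Lambda>\<close> has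
  interior points; otherwise \<open>\<Lambda>\<close> is a null set and every \<open>f\<close>
  vanishes.\<close>

definition wave :: "'a::euclidean_space \<Rightarrow> 'a \<Rightarrow> complex" where
  "wave x \<gamma> = cis (2 * pi * (x \<bullet> \<gamma>))"

lemma norm_wave [simp]: "cmod (wave x \<gamma>) = 1"
  by (simp add: wave_def)

lemma wave_zero [simp]: "wave 0 \<gamma> = 1" "wave x 0 = 1"
  by (simp_all add: wave_def)

lemma wave_add_left: "wave (x + y) \<gamma> = wave x \<gamma> * wave y \<gamma>"
  by (simp add: wave_def cis_mult inner_add_left algebra_simps)

lemma wave_add_right: "wave x (\<gamma> + \<gamma>') = wave x \<gamma> * wave x \<gamma>'"
  by (simp add: wave_def cis_mult inner_add_right algebra_simps)

lemma wave_scale: "wave (r *\<^sub>R x) \<gamma> = wave x (r *\<^sub>R \<gamma>)"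
  by (simp add: wave_def)

lemma wave_commute: "wave x \<gamma> = wave \<gamma> x"
  by (simp add: wave_def inner_commute)

lemma cnj_wave: "cnj (wave x \<gamma>) = wave x (- \<gamma>)"
  by (simp add: wave_def cis_cnj)

lemma wave_minus_left: "wave (- x) \<gamma> = wave x (- \<gamma>)"
  by (simp add: wave_def)

text \<open>The chord has length \<open>2 |sin (t/2)|\<close>, which is at most the arc.\<close>

lemma norm_cis_minus_one_le: "cmod (cis t - 1) \<le> \<bar>t\<bar>"
proof -
  have "(cmod (cis t - 1))\<^sup>2 = (cos t - 1)\<^sup>2 + (sin t)\<^sup>2"
    by (simp add: cmod_power2)
  also have "\<dots> = 2 - 2 * cos t"
    using sin_cos_squared_add[of t] by (simp add: power2_eq_square algebra_simps)
  also have "\<dots> = (2 * sin (t/2))\<^sup>2"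
    using cos_double_sin[of "t/2"] by (simp add: power2_eq_square)
  also have "\<dots> \<le> t\<^sup>2"
    using abs_sin_x_le_abs_x[of "t/2"] by (intro abs_le_square_iff[THEN iffD1]) auto
  finally show ?thesis
    by (metis abs_le_square_iff abs_norm_cancel)
qed

lemma norm_wave_minus_one_le: "cmod (wave x \<gamma> - 1) \<le> 2 * pi * norm x * norm \<gamma>"
proof -
  have "cmod (wave x \<gamma> - 1) \<le> 2 * pi * \<bar>x \<bullet> \<gamma>\<bar>"
    unfolding wave_def using norm_cis_minus_one_le[of "2 * pi * (x \<bullet> \<gamma>)"] by (simp add: abs_mult)
  also have "\<dots> \<le> 2 * pi * (norm x * norm \<gamma>)"
    by (intro mult_left_mono Cauchy_Schwarz_ineq2) auto
  finally show ?thesis by (simp add: mult_ac)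
qed

lemma continuous_on_wave [continuous_intros]:
  "continuous_on S f \<Longrightarrow> continuous_on S g \<Longrightarrow> continuous_on S (\<lambda>z. wave (f z) (g z))"
  unfolding wave_def cis_conv_exp by (intro continuous_intros)

lemma wave_measurable [measurable (raw)]:
  assumes [measurable]: "f \<in> borel_measurable M" "g \<in> borel_measurable M"
  shows "(\<lambda>z. wave (f z) (g z)) \<in> borel_measurable M"
proof -
  have "(\<lambda>p. wave (fst p) (snd p)) \<in> borel_measurable (borel \<Otimes>\<^sub>M borel)"
    by (subst borel_prod) (intro borel_measurable_continuous_onI continuous_intros)
  from measurable_compose[OF _ this, of "\<lambda>z. (f z, g z)"] show ?thesis by simp
qed

lemma inv_fourier_wave: "inv_fourier F x = (\<integral>\<gamma>. F \<gamma> * wave x \<gamma> \<partial>lborel)"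
  by (simp add: inv_fourier_def wave_def cis_conv_exp mult_ac)

lemma fourier_meas_wave: "fourier_meas M h \<gamma> = (\<integral>x. h x * wave x (- \<gamma>) \<partial>M)"
  by (simp add: fourier_meas_def wave_def cis_conv_exp mult_ac)

lemma integrable_mult_wave [simp, intro]:
  assumes "integrable M F" "g \<in> borel_measurable M" "k \<in> borel_measurable M"
  shows "integrable M (\<lambda>\<gamma>. F \<gamma> * wave (g \<gamma>) (k \<gamma>))"
  by (rule Bochner_Integration.integrable_bound[OF assms(1)])
     (use assms in \<open>auto simp: norm_mult\<close>)

lemma norm_inv_fourier_le: "integrable lborel F \<Longrightarrow> cmod (inv_fourier F x) \<le> (\<integral>\<gamma>. cmod (F \<gamma>) \<partial>lborel)"
  unfolding inv_fourier_wave
  by (rule order_trans[OF integral_norm_bound]) (simp add: norm_mult)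

lemma inv_fourier_measurable [measurable]:
  assumes [measurable]: "F \<in> borel_measurable lborel"
  shows "inv_fourier F \<in> borel_measurable borel"
proof -
  have [measurable]: "F \<in> borel_measurable borel" using assms by simp
  have "(\<lambda>x. \<integral>\<gamma>. F \<gamma> * wave x \<gamma> \<partial>lborel) \<in> borel_measurable borel"
    by measurable
  then show ?thesis by (simp add: inv_fourier_wave[abs_def])
qed

section \<open>Square-integrable functions with bounded support\<close>

lemma L2_onD:
  assumes "F \<in> L2_on S"
  shows "F \<in> borel_measurable borel" "integrable lborel (\<lambda>\<gamma>. (cmod (F \<gamma>))\<^sup>2)" "\<gamma> \<notin> S \<Longrightarrow> F \<gamma> = 0"
  using assms by (auto simp: L2_on_def)

lemma L2_on_mono: "F \<in> L2_on S \<Longrightarrow> S \<subseteq> T \<Longrightarrow> F \<in> L2_on T"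
  by (auto simp: L2_on_def)

lemma integrable_bounded_support:
  fixes F :: "'a::euclidean_space \<Rightarrow> complex"
  assumes [measurable]: "F \<in> borel_measurable borel" and "\<And>\<gamma>. cmod (F \<gamma>) \<le> B"
    and "\<And>\<gamma>. norm \<gamma> > \<rho> \<Longrightarrow> F \<gamma> = 0"
  shows "integrable lborel F" and "integrable lborel (\<lambda>\<gamma>. (cmod (F \<gamma>))\<^sup>2)"
proof -
  have fin: "integrable lborel (\<lambda>\<gamma>. c * indicator (cball (0::'a) \<rho>) \<gamma>)" for c :: real
    using emeasure_lborel_cball_finite[of "0::'a" \<rho>] by (intro integrable_mult_right integrable_real_indicator) auto
  have "B \<ge> 0" using assms(2)[of 0] norm_ge_zero order_trans by blast
  show "integrable lborel F"
    by (rule Bochner_Integration.integrable_bound[OF fin[of B]])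
       (use assms \<open>B \<ge> 0\<close> in \<open>auto simp: indicator_def not_le\<close>)
  show "integrable lborel (\<lambda>\<gamma>. (cmod (F \<gamma>))\<^sup>2)"
    by (rule Bochner_Integration.integrable_bound[OF fin[of "B\<^sup>2"]])
       (use assms \<open>B \<ge> 0\<close> in \<open>auto simp: indicator_def not_le power_mono\<close>)
qed

text \<open>On the bounded support, \<open>t \<le> 1 + t^2\<close> replaces the Cauchy-Schwarz
  inequality.\<close>

lemma L2_on_integrable:
  fixes S :: "'a::euclidean_space set"
  assumes F: "F \<in> L2_on S" and "bounded S"
  shows "integrable lborel F"
proof -
  obtain \<rho> where \<rho>: "S \<subseteq> cball 0 \<rho>" using \<open>bounded S\<close> bounded_subset_ballD[of S 0] ball_subset_cball by blast
  have [measurable]: "F \<in> borel_measurable borel" using F by (rule L2_onD)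
  have "integrable lborel (\<lambda>\<gamma>. indicator (cball (0::'a) \<rho>) \<gamma> + (cmod (F \<gamma>))\<^sup>2)"
    using emeasure_lborel_cball_finite[of "0::'a" \<rho>]
    by (intro Bochner_Integration.integrable_add integrable_real_indicator L2_onD(2)[OF F]) auto
  then show ?thesis
  proof (rule Bochner_Integration.integrable_bound)
    have "cmod (F \<gamma>) \<le> indicator (cball (0::'a) \<rho>) \<gamma> + (cmod (F \<gamma>))\<^sup>2" for \<gamma>
    proof (cases "\<gamma> \<in> S")
      case True
      have "t \<le> 1 + t\<^sup>2" for t :: real
      proof -
        have "0 \<le> (t - 1/2)\<^sup>2" by simp
        then show ?thesis by (simp add: power2_eq_square algebra_simps)
      qed
      then show ?thesis using True \<rho> by auto
    qed (use L2_onD(3)[OF F] in auto)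
    then show "AE \<gamma> in lborel. norm (F \<gamma>) \<le> norm (indicator (cball (0::'a) \<rho>) \<gamma> + (cmod (F \<gamma>))\<^sup>2)"
      by (intro AE_I2) (metis abs_ge_self order_trans real_norm_def)
  qed simp
qed

lemma L2_on_scale: "F \<in> L2_on S \<Longrightarrow> (\<lambda>\<gamma>. c * F \<gamma>) \<in> L2_on S"
  by (auto simp: L2_on_def norm_mult power_mult_distrib)

lemma L2_on_add:
  assumes "F \<in> L2_on S" "G \<in> L2_on S"
  shows "(\<lambda>\<gamma>. F \<gamma> + G \<gamma>) \<in> L2_on S"
proof -
  have [measurable]: "F \<in> borel_measurable borel" "G \<in> borel_measurable borel"
    using assms by (auto dest: L2_onD)
  have "integrable lborel (\<lambda>\<gamma>. 2 * ((cmod (F \<gamma>))\<^sup>2 + (cmod (G \<gamma>))\<^sup>2))"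
    using assms by (intro integrable_mult_right Bochner_Integration.integrable_add L2_onD(2))
  then have "integrable lborel (\<lambda>\<gamma>. (cmod (F \<gamma> + G \<gamma>))\<^sup>2)"
  proof (rule Bochner_Integration.integrable_bound)
    have "(cmod (F \<gamma> + G \<gamma>))\<^sup>2 \<le> 2 * ((cmod (F \<gamma>))\<^sup>2 + (cmod (G \<gamma>))\<^sup>2)" for \<gamma>
    proof -
      have "(cmod (F \<gamma> + G \<gamma>))\<^sup>2 \<le> (cmod (F \<gamma>) + cmod (G \<gamma>))\<^sup>2"
        by (intro power_mono norm_triangle_ineq) auto
      also have "\<dots> \<le> 2 * ((cmod (F \<gamma>))\<^sup>2 + (cmod (G \<gamma>))\<^sup>2)"
        using zero_le_power2[of "cmod (F \<gamma>) - cmod (G \<gamma>)"] by (simp add: power2_eq_square algebra_simps)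
      finally show ?thesis .
    qed
    then show "AE \<gamma> in lborel. norm ((cmod (F \<gamma> + G \<gamma>))\<^sup>2) \<le> norm (2 * ((cmod (F \<gamma>))\<^sup>2 + (cmod (G \<gamma>))\<^sup>2))"
      by (intro AE_I2) (simp add: power2_eq_square)
  qed simp
  then show ?thesis using assms by (auto simp: L2_on_def)
qed

lemma L2_on_zero: "(\<lambda>_. 0) \<in> L2_on S"
  by (simp add: L2_on_def)

lemma L2_on_sum: "(\<And>k. k \<in> I \<Longrightarrow> F k \<in> L2_on S) \<Longrightarrow> (\<lambda>\<gamma>. \<Sum>k\<in>I. F k \<gamma>) \<in> L2_on S"
  by (induction I rule: infinite_finite_induct) (auto intro: L2_on_add L2_on_zero)

lemma inv_fourier_scale: "inv_fourier (\<lambda>\<gamma>. c * F \<gamma>) x = c * inv_fourier F x"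
  by (simp add: inv_fourier_wave mult.assoc)

lemma inv_fourier_sum:
  "(\<And>k. k \<in> I \<Longrightarrow> integrable lborel (F k)) \<Longrightarrow>
     inv_fourier (\<lambda>\<gamma>. \<Sum>k\<in>I. F k \<gamma>) x = (\<Sum>k\<in>I. inv_fourier (F k) x)"
  by (simp add: inv_fourier_wave sum_distrib_right Bochner_Integration.integral_sum)

lemma L2_on_modulate: "F \<in> L2_on S \<Longrightarrow> (\<lambda>\<gamma>. F \<gamma> * wave y \<gamma>) \<in> L2_on S"
  by (auto simp: L2_on_def norm_mult)

lemma inv_fourier_modulate: "inv_fourier (\<lambda>\<gamma>. F \<gamma> * wave y \<gamma>) x = inv_fourier F (y + x)"
  by (simp add: inv_fourier_wave wave_add_left mult_ac)

section \<open>Translations and dilations\<close>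

lemma lborel_integral_scale:
  fixes h :: "'a::euclidean_space \<Rightarrow> 'b::{banach, second_countable_topology}"
  assumes [measurable]: "h \<in> borel_measurable borel" and "r > 0"
  shows "(\<integral>x. h x \<partial>lborel) = r ^ DIM('a) *\<^sub>R (\<integral>x. h (t + r *\<^sub>R x) \<partial>lborel)"
    and "integrable lborel h \<longleftrightarrow> integrable lborel (\<lambda>x. h (t + r *\<^sub>R x))"
proof -
  have eq: "lborel = density (distr lborel borel (\<lambda>x. t + r *\<^sub>R x)) (\<lambda>_. ennreal (r ^ DIM('a)))"
    using lborel_affine[of r t] \<open>r > 0\<close> by simp
  show "(\<integral>x. h x \<partial>lborel) = r ^ DIM('a) *\<^sub>R (\<integral>x. h (t + r *\<^sub>R x) \<partial>lborel)"
    by (subst eq) (use \<open>r > 0\<close> in \<open>simp add: integral_density integral_distr\<close>)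
  show "integrable lborel h \<longleftrightarrow> integrable lborel (\<lambda>x. h (t + r *\<^sub>R x))"
  proof -
    have "integrable lborel (\<lambda>x. r ^ DIM('a) *\<^sub>R g x) \<longleftrightarrow> integrable lborel g" for g :: "'a \<Rightarrow> 'b"
    proof
      assume "integrable lborel (\<lambda>x. r ^ DIM('a) *\<^sub>R g x)"
      from this have "integrable lborel (\<lambda>x. (1 / r ^ DIM('a)) *\<^sub>R (r ^ DIM('a) *\<^sub>R g x))"
        by (rule integrable_scaleR_right)
      moreover have "(\<lambda>x. (1 / r ^ DIM('a)) *\<^sub>R (r ^ DIM('a) *\<^sub>R g x)) = g"
        using \<open>r > 0\<close> by auto
      ultimately show "integrable lborel g" by simp
    qed simp
    with \<open>r > 0\<close> show ?thesis
      by (subst eq) (simp add: integrable_density integrable_distr_eq)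
  qed
qed

lemma inv_fourier_dilate:
  fixes F :: "'a::euclidean_space \<Rightarrow> complex"
  assumes "F \<in> borel_measurable borel" "r > 0"
  shows "inv_fourier (\<lambda>\<gamma>. F (\<gamma> /\<^sub>R r) / r ^ DIM('a)) x = inv_fourier F (r *\<^sub>R x)"
proof -
  have [measurable]: "F \<in> borel_measurable borel" by fact
  have "inv_fourier (\<lambda>\<gamma>. F (\<gamma> /\<^sub>R r) / r ^ DIM('a)) x
      = r ^ DIM('a) *\<^sub>R (\<integral>\<gamma>. F ((0 + r *\<^sub>R \<gamma>) /\<^sub>R r) / r ^ DIM('a) * wave x (0 + r *\<^sub>R \<gamma>) \<partial>lborel)"
    unfolding inv_fourier_wave by (subst lborel_integral_scale[OF _ \<open>r > 0\<close>, of _ 0]) auto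
  also have "\<dots> = inv_fourier F (r *\<^sub>R x)"
    using \<open>r > 0\<close> by (simp add: inv_fourier_wave wave_scale scaleR_conv_of_real)
  finally show ?thesis .
qed

lemma L2_on_dilate:
  fixes F :: "'a::euclidean_space \<Rightarrow> complex"
  assumes F: "F \<in> L2_on S" and "r > 0"
  shows "(\<lambda>\<gamma>. F (\<gamma> /\<^sub>R r) / r ^ DIM('a)) \<in> L2_on ((*\<^sub>R) r ` S)"
proof -
  have [measurable]: "F \<in> borel_measurable borel" using F by (rule L2_onD)
  have "integrable lborel (\<lambda>\<gamma>. (cmod (F (\<gamma> /\<^sub>R r)))\<^sup>2)"
    using lborel_integral_scale(2)[of "\<lambda>\<gamma>. (cmod (F \<gamma>))\<^sup>2" "1/r" 0] L2_onD(2)[OF F] \<open>r > 0\<close>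
    by (simp add: divide_inverse)
  then have "integrable lborel (\<lambda>\<gamma>. (cmod (F (\<gamma> /\<^sub>R r) / r ^ DIM('a)))\<^sup>2)"
    by (simp add: norm_divide power_divide)
  moreover have "F (\<gamma> /\<^sub>R r) = 0" if "\<gamma> \<notin> (*\<^sub>R) r ` S" for \<gamma>
  proof (rule L2_onD(3)[OF F])
    have "\<gamma> = r *\<^sub>R (\<gamma> /\<^sub>R r)" using \<open>r > 0\<close> by simp
    with that show "\<gamma> /\<^sub>R r \<notin> S" by (metis imageI)
  qed
  ultimately show ?thesis by (simp add: L2_on_def)
qed

section \<open>Products and a rapidly decaying band-limited kernel\<close>

lemma Fubini_iterated:
  fixes f :: "'a \<Rightarrow> 'b \<Rightarrow> complex"
  assumes M: "sigma_finite_measure M" "sigma_finite_measure N"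
    and "case_prod f \<in> borel_measurable (M \<Otimes>\<^sub>M N)"
    and "\<And>x. integrable N (f x)"
    and "integrable M (\<lambda>x. \<integral>y. cmod (f x y) \<partial>N)"
  shows "(\<integral>y. (\<integral>x. f x y \<partial>M) \<partial>N) = (\<integral>x. (\<integral>y. f x y \<partial>N) \<partial>M)"
proof -
  interpret P: pair_sigma_finite M N using M by (simp add: pair_sigma_finite_def)
  have "integrable (M \<Otimes>\<^sub>M N) (case_prod f)"
    by (rule P.Fubini_integrable) (use assms in auto)
  then show ?thesis by (rule P.Fubini_integral)
qed

text \<open>This is the convolution theorem: \<open>H\<close> is the convolution of \<open>F\<close>
  and \<open>T\<close>, and its support lies in the sum of the two supports. As \<open>T\<close> is
  bounded, \<open>H\<close> is bounded too, and with bounded support that makes it square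
  integrable.\<close>

lemma inv_fourier_mult:
  fixes F T :: "'a::euclidean_space \<Rightarrow> complex"
  assumes F: "F \<in> L2_on S" and S: "bounded S"
    and T [measurable]: "T \<in> borel_measurable borel" and B: "\<And>\<gamma>. cmod (T \<gamma>) \<le> B"
    and supp: "\<And>\<gamma>. norm \<gamma> > \<rho> \<Longrightarrow> T \<gamma> = 0"
  shows "\<exists>H\<in>L2_on {u + v |u v. u \<in> S \<and> norm v \<le> \<rho>}. \<forall>x. inv_fourier H x = inv_fourier F x * inv_fourier T x"
proof
  have [measurable]: "F \<in> borel_measurable borel" using F by (rule L2_onD)
  have Fi: "integrable lborel F" using F S by (rule L2_on_integrable)
  have Ti: "integrable lborel T" by (rule integrable_bounded_support[OF T B supp])
  have Ti': "integrable lborel (\<lambda>\<gamma>. T (\<gamma> - \<gamma>'))" for \<gamma>'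
    using lborel_integral_scale(2)[of T 1 "-\<gamma>'"] Ti by (simp add: add.commute)
  define H where "H \<gamma> = (\<integral>\<gamma>'. F \<gamma>' * T (\<gamma> - \<gamma>') \<partial>lborel)" for \<gamma>
  have [measurable]: "H \<in> borel_measurable borel"
    unfolding H_def by measurable
  obtain a where a: "S \<subseteq> cball 0 a" using S bounded_subset_ballD[of S 0] ball_subset_cball by blast
  \<comment> \<open>\<open>L2_on\<close> asks for vanishing at every point off the set, not almost
    everywhere. If \<open>H \<gamma> \<noteq> 0\<close>, the integrand cannot vanish identically, so
    some decomposition of \<open>\<gamma>\<close> exists.\<close>
  have Hsupp: "\<gamma> \<in> {u + v |u v. u \<in> S \<and> norm v \<le> \<rho>}" if "H \<gamma> \<noteq> 0" for \<gamma>
  proof -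
    have "\<exists>\<gamma>'. F \<gamma>' * T (\<gamma> - \<gamma>') \<noteq> 0"
    proof (rule ccontr)
      assume "\<nexists>\<gamma>'. F \<gamma>' * T (\<gamma> - \<gamma>') \<noteq> 0"
      then have "(\<lambda>\<gamma>'. F \<gamma>' * T (\<gamma> - \<gamma>')) = (\<lambda>_. 0)" by blast
      then have "H \<gamma> = 0" by (simp add: H_def)
      with that show False by simp
    qed
    then obtain \<gamma>' where g: "F \<gamma>' \<noteq> 0" "T (\<gamma> - \<gamma>') \<noteq> 0" by auto
    have "\<gamma>' \<in> S" "norm (\<gamma> - \<gamma>') \<le> \<rho>" using g L2_onD(3)[OF F] supp not_le by blast+
    moreover have "\<gamma> = \<gamma>' + (\<gamma> - \<gamma>')" by simp
    ultimately show ?thesis by blast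
  qed
  have Hb: "cmod (H \<gamma>) \<le> (\<integral>\<gamma>'. cmod (F \<gamma>') * B \<partial>lborel)" for \<gamma>
    unfolding H_def
  proof (rule order_trans[OF integral_norm_bound], rule integral_mono')
    show "integrable lborel (\<lambda>\<gamma>'. cmod (F \<gamma>') * B)" using Fi by simp
  qed (use B in \<open>auto simp: norm_mult intro!: mult_left_mono\<close>, smt (verit) norm_ge_zero zero_le_mult_iff)
  have H0: "H \<gamma> = 0" if "norm \<gamma> > a + \<rho>" for \<gamma>
  proof (rule ccontr)
    assume "H \<gamma> \<noteq> 0"
    from Hsupp[OF this] obtain u v where "\<gamma> = u + v" "u \<in> S" "norm v \<le> \<rho>" by auto
    then show False using a that norm_triangle_ineq[of u v] by (fastforce simp: subset_iff)
  qed
  have "integrable lborel (\<lambda>\<gamma>. (cmod (H \<gamma>))\<^sup>2)"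
    by (rule integrable_bounded_support(2)[OF _ Hb H0]) auto
  then show "H \<in> L2_on {u + v |u v. u \<in> S \<and> norm v \<le> \<rho>}"
    using Hsupp by (auto simp: L2_on_def)
  show "\<forall>x. inv_fourier H x = inv_fourier F x * inv_fourier T x"
  proof
    fix x :: 'a
    have "inv_fourier H x = (\<integral>\<gamma>. (\<integral>\<gamma>'. F \<gamma>' * T (\<gamma> - \<gamma>') * wave x \<gamma> \<partial>lborel) \<partial>lborel)"
      by (simp add: inv_fourier_wave H_def)
    also have "\<dots> = (\<integral>\<gamma>'. (\<integral>\<gamma>. F \<gamma>' * T (\<gamma> - \<gamma>') * wave x \<gamma> \<partial>lborel) \<partial>lborel)"
    proof (rule Fubini_iterated[OF sigma_finite_lborel sigma_finite_lborel])
      have "(\<integral>\<gamma>. cmod (F \<gamma>' * T (\<gamma> - \<gamma>') * wave x \<gamma>) \<partial>lborel) = cmod (F \<gamma>') * (\<integral>\<gamma>. cmod (T \<gamma>) \<partial>lborel)" for \<gamma>'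
        using lborel_integral_scale(1)[of "\<lambda>\<gamma>. cmod (T \<gamma>)" 1 "-\<gamma>'"] by (simp add: norm_mult add.commute)
      then show "integrable lborel (\<lambda>\<gamma>'. \<integral>\<gamma>. cmod (F \<gamma>' * T (\<gamma> - \<gamma>') * wave x \<gamma>) \<partial>lborel)"
        using Fi by simp
      show "integrable lborel (\<lambda>\<gamma>. F \<gamma>' * T (\<gamma> - \<gamma>') * wave x \<gamma>)" for \<gamma>'
        using Ti' by (intro integrable_mult_wave integrable_mult_right) auto
    qed measurable
    also have "\<dots> = (\<integral>\<gamma>'. F \<gamma>' * wave x \<gamma>' * inv_fourier T x \<partial>lborel)"
    proof (rule Bochner_Integration.integral_cong[OF refl])
      fix \<gamma>'
      have "(\<integral>\<gamma>. F \<gamma>' * T (\<gamma> - \<gamma>') * wave x \<gamma> \<partial>lborel)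
          = (\<integral>\<gamma>. F \<gamma>' * T ((\<gamma>' + 1 *\<^sub>R \<gamma>) - \<gamma>') * wave x (\<gamma>' + 1 *\<^sub>R \<gamma>) \<partial>lborel)"
        by (subst lborel_integral_scale(1)[of _ 1 \<gamma>']) auto
      also have "\<dots> = (\<integral>\<gamma>. (F \<gamma>' * wave x \<gamma>') * (T \<gamma> * wave x \<gamma>) \<partial>lborel)"
        by (simp add: wave_add_right mult_ac)
      also have "\<dots> = F \<gamma>' * wave x \<gamma>' * inv_fourier T x"
        by (simp add: inv_fourier_wave)
      finally show "(\<integral>\<gamma>. F \<gamma>' * T (\<gamma> - \<gamma>') * wave x \<gamma> \<partial>lborel) = F \<gamma>' * wave x \<gamma>' * inv_fourier T x" .
    qed
    also have "\<dots> = inv_fourier F x * inv_fourier T x"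
      by (simp add: inv_fourier_wave)
    finally show "inv_fourier H x = inv_fourier F x * inv_fourier T x" .
  qed
qed

lemma inv_fourier_mult_power:
  fixes F T :: "'a::euclidean_space \<Rightarrow> complex"
  assumes F: "F \<in> L2_on S" and S: "bounded S"
    and T: "T \<in> borel_measurable borel" "\<And>\<gamma>. cmod (T \<gamma>) \<le> B" "\<And>\<gamma>. norm \<gamma> > \<rho> \<Longrightarrow> T \<gamma> = 0"
    and "\<rho> \<ge> 0"
  shows "\<exists>H\<in>L2_on {u + v |u v. u \<in> S \<and> norm v \<le> real j * \<rho>}. 
           \<forall>x. inv_fourier H x = inv_fourier F x * inv_fourier T x ^ j"
proof (induction j)
  case 0
  have "S = {u + v |u v. u \<in> S \<and> norm v \<le> real 0 * \<rho>}" by auto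
  with F show ?case by auto
next
  case (Suc j)
  define S' where "S' = {u + v |u v. u \<in> S \<and> norm v \<le> real j * \<rho>}"
  obtain H where H: "H \<in> L2_on S'" "\<And>x. inv_fourier H x = inv_fourier F x * inv_fourier T x ^ j"
    using Suc unfolding S'_def by auto
  obtain a where a: "S \<subseteq> cball 0 a" using S bounded_subset_ballD[of S 0] ball_subset_cball by blast
  have "S' \<subseteq> cball 0 (a + real j * \<rho>)"
    using a norm_triangle_le by (fastforce simp: S'_def intro: norm_triangle_le add_mono)
  then have "bounded S'" using bounded_cball bounded_subset by blast
  from inv_fourier_mult[OF H(1) this T] obtain H' where
    H': "H' \<in> L2_on {u + v |u v. u \<in> S' \<and> norm v \<le> \<rho>}" "\<And>x. inv_fourier H' x = inv_fourier H x * inv_fourier T x"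
    by auto
  have "{u + v |u v. u \<in> S' \<and> norm v \<le> \<rho>} \<subseteq> {u + v |u v. u \<in> S \<and> norm v \<le> real (Suc j) * \<rho>}"
  proof safe
    fix u v :: 'a assume "u \<in> S'" "norm v \<le> \<rho>"
    then obtain u' v' where "u = u' + v'" "u' \<in> S" "norm v' \<le> real j * \<rho>" by (auto simp: S'_def)
    then show "\<exists>ua va. u + v = ua + va \<and> ua \<in> S \<and> norm va \<le> real (Suc j) * \<rho>"
      using \<open>norm v \<le> \<rho>\<close> norm_triangle_ineq[of v' v]
      by (intro exI[of _ u'] exI[of _ "v' + v"]) (auto simp: algebra_simps)
  qed
  with H' H show ?case by (intro bexI[of _ H']) (auto simp: mult_ac intro: L2_on_mono)
qed

section \<open>The tent function and a kernel with prescribed decay\<close>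

definition tent :: "'a::euclidean_space \<Rightarrow> real" where
  "tent \<gamma> = max 0 (1 - norm \<gamma>)"

lemma tent_lipschitz: "\<bar>tent \<gamma> - tent \<gamma>'\<bar> \<le> norm (\<gamma> - \<gamma>')"
  unfolding tent_def using norm_triangle_ineq3[of \<gamma> \<gamma>'] by (auto simp: max_def abs_if split: if_splits)

lemma tent_bounds: "0 \<le> tent \<gamma>" "tent \<gamma> \<le> 1" "norm \<gamma> > 1 \<Longrightarrow> tent \<gamma> = 0"
  by (auto simp: tent_def)

lemma tent_measurable [measurable]: "tent \<in> borel_measurable borel"
  unfolding tent_def by measurable

lemma integrable_tent: "integrable lborel (\<lambda>\<gamma>::'a::euclidean_space. complex_of_real (tent \<gamma>))"
  by (rule integrable_bounded_support(1)[of _ 1 1]) (auto simp: tent_bounds)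

text \<open>Positivity allows the transform of the tent to be normalised to the value 1 at the
  origin.\<close>

lemma integral_tent_pos: "integral\<^sup>L lborel (tent :: 'a::euclidean_space \<Rightarrow> real) > 0"
proof -
  have "(\<integral>\<gamma>. 1/2 * indicator (cball (0::'a) (1/2)) \<gamma> \<partial>lborel) \<le> integral\<^sup>L lborel (tent :: 'a \<Rightarrow> real)"
  proof (rule integral_mono)
    show "integrable lborel (\<lambda>\<gamma>::'a. 1/2 * indicator (cball 0 (1/2)) \<gamma> :: real)"
      using emeasure_lborel_cball_finite[of "0::'a" "1/2"]
      by (intro integrable_mult_right integrable_real_indicator) auto
    show "integrable lborel (tent :: 'a \<Rightarrow> real)"
      using integrable_tent[where 'a='a] by (simp add: complex_of_real_integrable_eq)
    show "1/2 * indicator (cball 0 (1/2)) \<gamma> \<le> tent \<gamma>" for \<gamma> :: 'a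
      by (auto simp: tent_def indicator_def)
  qed
  moreover have "(\<integral>\<gamma>. 1/2 * indicator (cball (0::'a) (1/2)) \<gamma> \<partial>lborel) = 1/2 * measure lborel (cball (0::'a) (1/2))"
    by simp
  moreover have "measure lborel (cball (0::'a) (1/2)) > 0"
    by (rule content_cball_pos) auto
  ultimately show ?thesis by linarith
qed

text \<open>A translation by \<open>v\<close> with \<open>x \<bullet> v = 1/2\<close> flips the sign of the wave, so the Lipschitz
  constant of the tent controls the transform.\<close>

lemma inv_fourier_tent_decay:
  fixes x :: "'a::euclidean_space"
  assumes "norm x \<ge> 1"
  shows "cmod (inv_fourier (\<lambda>\<gamma>. complex_of_real (tent \<gamma>)) x) \<le> measure lborel (cball (0::'a) 2) / norm x"
proof -
  let ?T = "\<lambda>\<gamma>::'a. complex_of_real (tent \<gamma>)"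
  define v where "v = (1 / (2 * (norm x)\<^sup>2)) *\<^sub>R x"
  have "norm x > 0" using assms by linarith
  then have xv: "x \<bullet> v = 1/2" by (simp add: v_def power2_norm_eq_inner)
  have nv: "norm v = 1 / (2 * norm x)" using \<open>norm x > 0\<close> by (simp add: v_def power2_eq_square)
  then have nv1: "norm v \<le> 1" using assms by (simp add: divide_le_eq)
  have wv: "wave x v = -1" unfolding wave_def xv by simp
  have int: "integrable lborel (\<lambda>\<gamma>. ?T (\<gamma> - v))"
    using lborel_integral_scale(2)[of ?T 1 "-v"] integrable_tent[where 'a='a] by (simp add: add.commute)
  have "inv_fourier ?T x = (\<integral>\<gamma>. ?T (\<gamma> - v) * wave x (\<gamma> - v) \<partial>lborel)"
    unfolding inv_fourier_wave by (subst lborel_integral_scale(1)[of _ 1 "-v"]) (auto simp: add.commute)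
  also have "\<dots> = (\<integral>\<gamma>. - (?T (\<gamma> - v) * wave x \<gamma>) \<partial>lborel)"
  proof -
    have "wave x (\<gamma> - v) = - wave x \<gamma>" for \<gamma>
      using wave_add_right[of x "\<gamma> - v" v] wv by simp
    then show ?thesis by simp
  qed
  finally have "2 * inv_fourier ?T x = (\<integral>\<gamma>. ?T \<gamma> * wave x \<gamma> \<partial>lborel) - (\<integral>\<gamma>. ?T (\<gamma> - v) * wave x \<gamma> \<partial>lborel)"
    by (simp add: inv_fourier_wave)
  also have "\<dots> = (\<integral>\<gamma>. ?T \<gamma> * wave x \<gamma> - ?T (\<gamma> - v) * wave x \<gamma> \<partial>lborel)"
    by (rule Bochner_Integration.integral_diff[symmetric])
       (use integrable_tent int in \<open>auto intro!: integrable_mult_wave\<close>)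
  \<comment> \<open>Since \<open>norm v \<le> 1\<close>, the ball of radius 2 contains the supports
    of the tent and of its translate.\<close>
  also have "cmod \<dots> \<le> (\<integral>\<gamma>. norm v * indicator (cball (0::'a) 2) \<gamma> \<partial>lborel)"
  proof (rule order_trans[OF integral_norm_bound], rule integral_mono')
    show "integrable lborel (\<lambda>\<gamma>. norm v * indicator (cball (0::'a) 2) \<gamma>)"
      using emeasure_lborel_cball_finite[of "0::'a" 2]
      by (intro integrable_mult_right integrable_real_indicator) auto
    show "cmod (?T \<gamma> * wave x \<gamma> - ?T (\<gamma> - v) * wave x \<gamma>) \<le> norm v * indicator (cball (0::'a) 2) \<gamma>" for \<gamma>
    proof (cases "norm \<gamma> \<le> 2")
      case True
      have "cmod (?T \<gamma> * wave x \<gamma> - ?T (\<gamma> - v) * wave x \<gamma>) = cmod (complex_of_real (tent \<gamma> - tent (\<gamma> - v)))"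
        by (simp only: left_diff_distrib[symmetric] norm_mult norm_wave mult_1_right of_real_diff)
      also have "\<dots> = \<bar>tent \<gamma> - tent (\<gamma> - v)\<bar>" by (simp only: norm_of_real)
      also have "\<dots> \<le> norm v" using tent_lipschitz[of \<gamma> "\<gamma> - v"] by simp
      finally show ?thesis using True by simp
    next
      case False
      then have "norm (\<gamma> - v) > 1" using nv1 norm_triangle_ineq[of "\<gamma> - v" v] by simp
      then show ?thesis using False by (simp add: tent_bounds)
    qed
  qed auto
  finally have "2 * cmod (inv_fourier ?T x) \<le> (measure lborel (cball (0::'a) 2) / norm x) / 2"
    using nv by (simp add: norm_mult)
  moreover have "measure lborel (cball (0::'a) 2) / norm x \<ge> 0" by simp
  moreover have "a \<le> b" if "2 * a \<le> b / 2" "0 \<le> b" for a b :: real using that by linarith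
  ultimately show ?thesis by blast
qed

text \<open>\<open>\<theta>\<close> is the \<open>q\<close>-th power of the normalised transform of
  a tent. The Lipschitz tent gives only decay of order 1, and the power raises this to order
  \<open>q\<close>. The band limitation of \<open>\<theta>\<close> is expressed through its effect:
  multiplication by \<open>\<theta> (s x)\<close> enlarges the spectrum by at most
  \<open>s * \<rho>0\<close>.\<close>

lemma kernel_exists:
  fixes \<rho>0 :: real and q :: nat
  assumes "\<rho>0 > 0" "q \<ge> 1"
  obtains \<theta> :: "'a::euclidean_space \<Rightarrow> complex" and C where
    "C > 0" "\<theta> 0 = 1" "\<And>x. cmod (\<theta> x) \<le> 1"
    "\<And>x. cmod (\<theta> x - 1) \<le> C * norm x" "\<And>x. cmod (\<theta> x) * (1 + norm x) ^ q \<le> C"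
    "\<And>s F S. s > 0 \<Longrightarrow> F \<in> L2_on S \<Longrightarrow> bounded S \<Longrightarrow>
       \<exists>H\<in>L2_on {u + v |u v. u \<in> S \<and> norm v \<le> s * \<rho>0}. \<forall>x. inv_fourier H x = inv_fourier F x * \<theta> (s *\<^sub>R x)"
proof -
  let ?T = "\<lambda>\<gamma>::'a. complex_of_real (tent \<gamma>)"
  define c where "c = integral\<^sup>L lborel (tent :: 'a \<Rightarrow> real)"
  have c: "c > 0" unfolding c_def by (rule integral_tent_pos)
  have Ti: "integrable lborel (\<lambda>\<gamma>::'a. tent \<gamma>)"
    using integrable_tent[where 'a='a] by (simp add: complex_of_real_integrable_eq)
  \<comment> \<open>Each of the \<open>q\<close> factors may use one \<open>q\<close>-th of the
    permitted radius.\<close>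
  define \<rho> where "\<rho> = \<rho>0 / q"
  have \<rho>: "\<rho> > 0" using assms by (simp add: \<rho>_def)
  define \<phi> where "\<phi> x = inv_fourier ?T (\<rho> *\<^sub>R x) / c" for x
  define V where "V = measure lborel (cball (0::'a) 2)"
  have V: "V \<ge> 0" by (simp add: V_def)
  \<comment> \<open>\<open>2 * c\<close> serves the points with \<open>norm (\<rho> x) < 1\<close>,
    \<open>2 * V\<close> the others; \<open>1 + 1/\<rho>\<close> compares \<open>1 + norm x\<close>
    with \<open>1 + \<rho> * norm x\<close>.\<close>
  define C0 where "C0 = (1 + 1/\<rho>) * ((2 * c + 2 * V) / c)"
  have C0: "C0 > 0" using c V \<rho> by (simp add: C0_def add_pos_nonneg)
  have T0: "inv_fourier ?T 0 = c" by (simp add: inv_fourier_wave c_def)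
  have Tle: "cmod (inv_fourier ?T x) \<le> c" for x
    using norm_inv_fourier_le[OF integrable_tent, of x] by (simp add: c_def tent_bounds)
  have \<phi>0: "\<phi> 0 = 1" using c T0 by (simp add: \<phi>_def)
  have \<phi>1: "cmod (\<phi> x) \<le> 1" for x using Tle c by (simp add: \<phi>_def norm_divide divide_le_eq)
  have \<phi>lip: "cmod (\<phi> x - 1) \<le> 2 * pi * \<rho> * norm x" for x
  proof -
    have "inv_fourier ?T (\<rho> *\<^sub>R x) - c = (\<integral>\<gamma>. ?T \<gamma> * wave (\<rho> *\<^sub>R x) \<gamma> - ?T \<gamma> \<partial>lborel)"
      unfolding c_def inv_fourier_wave
      by (subst Bochner_Integration.integral_diff) (auto intro!: integrable_tent)
    also have "cmod \<dots> \<le> (\<integral>\<gamma>. cmod (?T \<gamma> * wave (\<rho> *\<^sub>R x) \<gamma> - ?T \<gamma>) \<partial>lborel)"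
      by (rule integral_norm_bound)
    also have "\<dots> \<le> (\<integral>\<gamma>. 2 * pi * \<rho> * norm x * tent (\<gamma>::'a) \<partial>lborel)"
    proof (rule integral_mono')
      show "integrable lborel (\<lambda>\<gamma>. 2 * pi * \<rho> * norm x * tent (\<gamma>::'a))" using Ti by simp
      fix \<gamma> :: 'a
      have "cmod (?T \<gamma> * wave (\<rho> *\<^sub>R x) \<gamma> - ?T \<gamma>) = tent \<gamma> * cmod (wave (\<rho> *\<^sub>R x) \<gamma> - 1)"
        using norm_mult[of "?T \<gamma>" "wave (\<rho> *\<^sub>R x) \<gamma> - 1"] by (simp add: right_diff_distrib tent_bounds)
      also have "\<dots> \<le> tent \<gamma> * (2 * pi * \<rho> * norm x)"
      proof (cases "norm \<gamma> \<le> 1")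
        case True
        have "cmod (wave (\<rho> *\<^sub>R x) \<gamma> - 1) \<le> 2 * pi * norm (\<rho> *\<^sub>R x) * norm \<gamma>"
          by (rule norm_wave_minus_one_le)
        also have "\<dots> \<le> 2 * pi * norm (\<rho> *\<^sub>R x) * 1"
          using True by (intro mult_left_mono) auto
        finally have "cmod (wave (\<rho> *\<^sub>R x) \<gamma> - 1) \<le> 2 * pi * \<rho> * norm x" using \<rho> by simp
        then show ?thesis by (intro mult_left_mono tent_bounds)
      qed (simp add: tent_bounds)
      finally show "cmod (?T \<gamma> * wave (\<rho> *\<^sub>R x) \<gamma> - ?T \<gamma>) \<le> 2 * pi * \<rho> * norm x * tent \<gamma>" by (simp add: mult_ac)
      show "0 \<le> 2 * pi * \<rho> * norm x * tent \<gamma>" using \<rho> by (simp add: tent_bounds)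
    qed
    also have "\<dots> = 2 * pi * \<rho> * norm x * c" by (simp add: c_def)
    finally have "cmod (inv_fourier ?T (\<rho> *\<^sub>R x) - c) \<le> 2 * pi * \<rho> * norm x * c" .
    moreover have "\<phi> x - 1 = (inv_fourier ?T (\<rho> *\<^sub>R x) - c) / c" using c by (simp add: \<phi>_def diff_divide_distrib)
    ultimately show ?thesis using c by (simp add: norm_divide divide_le_eq)
  qed
  have \<phi>dec: "cmod (\<phi> x) * (1 + norm x) \<le> C0" for x
  proof -
    let ?y = "\<rho> *\<^sub>R x"
    have "cmod (inv_fourier ?T ?y) * (1 + norm ?y) \<le> 2 * c + 2 * V"
    proof (cases "norm ?y \<ge> 1")
      case True
      have "cmod (inv_fourier ?T ?y) * (1 + norm ?y) \<le> V / norm ?y * (2 * norm ?y)"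
        unfolding V_def using True by (intro mult_mono inv_fourier_tent_decay) auto
      also have "\<dots> = 2 * V" using True by auto
      finally show ?thesis using c by simp
    next
      case False
      have "cmod (inv_fourier ?T ?y) * (1 + norm ?y) \<le> c * 2"
        using False c by (intro mult_mono Tle) auto
      then show ?thesis using V by simp
    qed
    then have "cmod (\<phi> x) * (1 + norm ?y) \<le> (2 * c + 2 * V) / c"
      using c by (simp add: \<phi>_def norm_divide divide_simps)
    moreover have "1 + norm x \<le> (1 + 1/\<rho>) * (1 + norm ?y)"
      using \<rho> by (simp add: field_simps)
    ultimately have "cmod (\<phi> x) * (1 + norm x) \<le> (1 + 1/\<rho>) * (cmod (\<phi> x) * (1 + norm ?y))"
      using mult_left_mono[of "1 + norm x" "(1 + 1/\<rho>) * (1 + norm ?y)" "cmod (\<phi> x)"] by (simp add: mult_ac)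
    also have "\<dots> \<le> C0" unfolding C0_def
      using \<rho> \<open>cmod (\<phi> x) * (1 + norm ?y) \<le> (2 * c + 2 * V) / c\<close> by (intro mult_left_mono) auto
    finally show ?thesis .
  qed
  define \<theta> where "\<theta> x = \<phi> x ^ q" for x
  define C where "C = C0 ^ q + 2 * pi * \<rho> * q"
  show ?thesis
  proof (rule that[of C \<theta>])
    show "C > 0" using C0 \<rho> by (simp add: C_def add_pos_nonneg)
    show "\<theta> 0 = 1" by (simp add: \<theta>_def \<phi>0)
    show "cmod (\<theta> x) \<le> 1" for x by (simp add: \<theta>_def norm_power \<phi>1 power_le_one)
    show "cmod (\<theta> x - 1) \<le> C * norm x" for x
    proof -
      have "cmod (\<phi> x ^ q - 1 ^ q) \<le> q * cmod (\<phi> x - 1)"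
        by (rule norm_power_diff) (auto simp: \<phi>1)
      also have "\<dots> \<le> q * (2 * pi * \<rho> * norm x)" by (intro mult_left_mono \<phi>lip) auto
      also have "\<dots> \<le> C * norm x" using C0 by (simp add: C_def algebra_simps)
      finally show ?thesis by (simp add: \<theta>_def)
    qed
    show "cmod (\<theta> x) * (1 + norm x) ^ q \<le> C" for x
    proof -
      have "cmod (\<theta> x) * (1 + norm x) ^ q = (cmod (\<phi> x) * (1 + norm x)) ^ q"
        by (simp add: \<theta>_def norm_power power_mult_distrib)
      also have "\<dots> \<le> C0 ^ q" by (intro power_mono \<phi>dec) auto
      also have "\<dots> \<le> C" using \<rho> by (simp add: C_def)
      finally show ?thesis .
    qed
    fix s :: real and F :: "'a \<Rightarrow> complex" and S
    assume s: "s > 0" and F: "F \<in> L2_on S" "bounded S"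
    define r where "r = s * \<rho>"
    have r: "r > 0" using s \<rho> by (simp add: r_def)
    \<comment> \<open>This dilated, normalised tent of radius \<open>r = s * \<rho>\<close> has
      transform \<open>\<phi> (s x)\<close>.\<close>
    define T where "T \<gamma> = (1 / c) * (?T (\<gamma> /\<^sub>R r) / r ^ DIM('a))" for \<gamma> :: 'a
    have "inv_fourier T x = \<phi> (s *\<^sub>R x)" for x
      unfolding T_def inv_fourier_scale
      by (subst inv_fourier_dilate[OF _ r]) (auto simp: \<phi>_def r_def mult_ac)
    moreover have "\<exists>H\<in>L2_on {u + v |u v. u \<in> S \<and> norm v \<le> real q * r}. 
           \<forall>x. inv_fourier H x = inv_fourier F x * inv_fourier T x ^ q"
    proof (rule inv_fourier_mult_power[OF F])
      show "T \<in> borel_measurable borel" unfolding T_def by measurable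
      show "cmod (T \<gamma>) \<le> 1 / c * (1 / r ^ DIM('a))" for \<gamma>
        using c r tent_bounds[of "\<gamma> /\<^sub>R r"] 
        by (simp add: T_def norm_mult norm_divide norm_power divide_right_mono)
      show "T \<gamma> = 0" if "norm \<gamma> > r" for \<gamma>
        using that r tent_bounds(3)[of "\<gamma> /\<^sub>R r"] by (simp add: T_def field_simps)
      show "r \<ge> 0" using r by simp
    qed
    moreover have "real q * r = s * \<rho>0" using assms by (simp add: r_def \<rho>_def)
    ultimately show "\<exists>H\<in>L2_on {u + v |u v. u \<in> S \<and> norm v \<le> s * \<rho>0}. \<forall>x. inv_fourier H x = inv_fourier F x * \<theta> (s *\<^sub>R x)"
      by (simp add: \<theta>_def)
  qed
qed

section \<open>Product integrands and integrable weights\<close>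

lemma integrable_prod_Basis:
  fixes f :: "'a::euclidean_space \<Rightarrow> real \<Rightarrow> 'b::{real_normed_field,banach,second_countable_topology}"
  assumes int: "\<And>b. b \<in> Basis \<Longrightarrow> integrable lborel (f b)"
  shows "integrable lborel (\<lambda>x. \<Prod>b\<in>Basis. f b (x \<bullet> b))"
    and "(\<integral>x. (\<Prod>b\<in>Basis. f b (x \<bullet> b)) \<partial>lborel) = (\<Prod>b\<in>Basis. \<integral>t. f b t \<partial>lborel)"
proof -
  interpret P: product_sigma_finite "\<lambda>_::'a. lborel :: real measure" ..
  have [measurable]: "f b \<in> borel_measurable borel" if "b \<in> Basis" for b using int[OF that] by auto
  have meas: "(\<lambda>x. \<Prod>b\<in>Basis. f b (x \<bullet> b)) \<in> borel_measurable borel" 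
    by measurable
  have coord: "(\<Prod>b\<in>Basis. f b ((\<Sum>b\<in>Basis. x b *\<^sub>R b) \<bullet> b)) = (\<Prod>b\<in>Basis. f b (x b))" for x :: "'a \<Rightarrow> real"
    by (intro prod.cong) auto
  have D: "lborel = distr (\<Pi>\<^sub>M b\<in>Basis. lborel) borel (\<lambda>f. \<Sum>b\<in>Basis. f b *\<^sub>R b :: 'a)"
    unfolding lborel_def[where 'a='a] lborel_eq_real ..
  show "integrable lborel (\<lambda>x. \<Prod>b\<in>Basis. f b (x \<bullet> b))"
    using P.product_integrable_prod[of Basis f] int
    by (subst D, subst integrable_distr_eq) (use meas in \<open>auto simp: coord\<close>)
  show "(\<integral>x. (\<Prod>b\<in>Basis. f b (x \<bullet> b)) \<partial>lborel) = (\<Prod>b\<in>Basis. \<integral>t. f b t \<partial>lborel)"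
    using P.product_integral_prod[of Basis f] int
    by (subst D, subst integral_distr) (use meas in \<open>auto simp: coord\<close>)
qed

text \<open>Comparison with the derivative of \<open>arctan\<close>, whose limits at both ends are
  finite.\<close>

lemma integrable_inverse_square: "integrable lborel (\<lambda>t::real. 1 / (1 + \<bar>t\<bar>)\<^sup>2)"
proof -
  have "set_integrable lborel (einterval (-\<infinity>) \<infinity>) (\<lambda>t::real. inverse (1 + t\<^sup>2))"
  proof (rule interval_integral_FTC_nonneg)
    show "((arctan \<circ> real_of_ereal) \<longlongrightarrow> - pi / 2) (at_right (- \<infinity>))"
      unfolding at_right_MInf by (simp add: filterlim_filtermap comp_def tendsto_arctan_at_bot)
    show "((arctan \<circ> real_of_ereal) \<longlongrightarrow> pi / 2) (at_left \<infinity>)"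
      unfolding at_left_PInf by (simp add: filterlim_filtermap comp_def tendsto_arctan_at_top)
  qed (auto intro!: derivative_eq_intros continuous_intros simp: add_nonneg_eq_0_iff)
  then have int: "integrable lborel (\<lambda>t::real. inverse (1 + t\<^sup>2))"
    by (simp add: set_integrable_def einterval_iff)
  show ?thesis
  proof (rule Bochner_Integration.integrable_bound[OF int])
    have bd: "norm (1 / (1 + \<bar>t\<bar>)\<^sup>2) \<le> norm (inverse (1 + t\<^sup>2))" for t :: real
    proof -
      have "1 + t\<^sup>2 \<le> (1 + \<bar>t\<bar>)\<^sup>2" by (simp add: power2_sum)
      moreover have "0 < 1 + t\<^sup>2" by (simp add: add_pos_nonneg)
      ultimately have "1 / (1 + \<bar>t\<bar>)\<^sup>2 \<le> inverse (1 + t\<^sup>2)" by (simp add: inverse_eq_divide frac_le)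
      moreover have "0 \<le> 1 / (1 + \<bar>t\<bar>)\<^sup>2" by simp
      ultimately show ?thesis unfolding real_norm_def by linarith
    qed
    show "AE t::real in lborel. norm (1 / (1 + \<bar>t\<bar>)\<^sup>2) \<le> norm (inverse (1 + t\<^sup>2))"
      by (rule AE_I2, rule bd)
  qed simp
qed

text \<open>The exponent \<open>2 * DIM('a)\<close> gives every coordinate its own factor
  \<open>(1 + norm x)^(-2)\<close>, which is at most \<open>(1 + |x_b|)^(-2)\<close>; the bound is
  thus a product of integrable functions of one variable.\<close>

lemma integrable_inverse_power_norm:
  assumes "\<epsilon> > 0"
  shows "integrable lborel (\<lambda>x::'a::euclidean_space. 1 / (1 + \<epsilon> * norm x) ^ (2 * DIM('a)))"
proof -
  have one: "integrable lborel (\<lambda>x::'a. 1 / (1 + norm x) ^ (2 * DIM('a)))"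
  proof (rule Bochner_Integration.integrable_bound[OF integrable_prod_Basis(1)])
    show "integrable lborel (\<lambda>t::real. 1 / (1 + \<bar>t\<bar>)\<^sup>2)" by (rule integrable_inverse_square)
    have "1 / (1 + norm x) ^ (2 * DIM('a)) \<le> (\<Prod>b\<in>Basis. 1 / (1 + \<bar>x \<bullet> b\<bar>)\<^sup>2)" for x :: 'a
    proof -
      have "1 / (1 + norm x) ^ (2 * DIM('a)) = (\<Prod>b\<in>(Basis::'a set). 1 / (1 + norm x)\<^sup>2)"
        by (simp add: power_mult power_one_over)
      also have "\<dots> \<le> (\<Prod>b\<in>Basis. 1 / (1 + \<bar>x \<bullet> b\<bar>)\<^sup>2)"
        by (intro prod_mono conjI divide_left_mono power_mono mult_pos_pos zero_less_power)
           (auto simp: Basis_le_norm add_pos_nonneg)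
      finally show ?thesis .
    qed
    then show "AE x in lborel. norm (1 / (1 + norm x) ^ (2 * DIM('a))) \<le> norm (\<Prod>b\<in>(Basis::'a set). 1 / (1 + \<bar>x \<bullet> b\<bar>)\<^sup>2)"
      by (intro AE_I2) (simp add: prod_nonneg)
  qed simp
  show ?thesis
    using lborel_integral_scale(2)[of "\<lambda>x::'a. 1 / (1 + norm x) ^ (2 * DIM('a))" \<epsilon> 0] one assms by simp
qed

section \<open>The Gaussian and the Plancherel inequality\<close>

text \<open>The factor \<open>pi\<close> makes this the Gaussian of integral 1 that is its own
  Fourier transform.\<close>

definition gauss :: "'a::euclidean_space \<Rightarrow> real" where
  "gauss v = exp (- pi * (norm v)\<^sup>2)"

lemma gauss_bounds: "0 < gauss v" "gauss v \<le> 1" "0 \<le> gauss v"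
  by (simp_all add: gauss_def)

lemma gauss_measurable [measurable]: "gauss \<in> borel_measurable borel"
  unfolding gauss_def by measurable

lemma gauss_minus: "gauss (- v) = gauss v"
  by (simp add: gauss_def)

lemma gauss_prod: "gauss (v::'a::euclidean_space) = (\<Prod>b\<in>Basis. exp (- pi * (v \<bullet> b)\<^sup>2))"
proof -
  have "(norm v)\<^sup>2 = (\<Sum>b\<in>Basis. (v \<bullet> b)\<^sup>2)"
    unfolding power2_norm_eq_inner by (subst euclidean_inner) (simp only: power2_eq_square)
  then show ?thesis by (simp only: gauss_def sum_distrib_left exp_sum finite_Basis)
qed

text \<open>The characteristic function of the standard normal distribution, rescaled by
  \<open>sqrt (2 * pi)\<close>.\<close>

lemma gauss_fourier_real:
  "integrable lborel (\<lambda>t::real. complex_of_real (exp (- pi * t\<^sup>2)) * cis (2 * pi * (t * u)))"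
  "(\<integral>t. complex_of_real (exp (- pi * t\<^sup>2)) * cis (2 * pi * (t * u)) \<partial>lborel) = exp (- pi * u\<^sup>2)"
proof -
  define a where "a = sqrt (2 * pi)"
  have a: "a > 0" "a * a = 2 * pi" by (simp_all add: a_def)
  define f where "f x = complex_of_real (std_normal_density x) * cis (a * u * x)" for x
  define g where "g t = complex_of_real (exp (- pi * t\<^sup>2)) * cis (2 * pi * (t * u))" for t
  have [measurable]: "f \<in> borel_measurable borel" "g \<in> borel_measurable borel"
    unfolding f_def g_def cis_conv_exp by measurable
  have fg: "f (0 + a *\<^sub>R t) = complex_of_real (1 / a) * g t" for t
  proof -
    have "(a * t)\<^sup>2 / 2 = pi * t\<^sup>2" using a by (simp add: power2_eq_square)
    then have "std_normal_density (a * t) = 1 / a * exp (- pi * t\<^sup>2)"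
      by (simp add: std_normal_density_def a_def[symmetric])
    moreover have "a * u * (a * t) = 2 * pi * (t * u)" using a by (simp add: mult_ac)
    ultimately show ?thesis unfolding f_def g_def real_scaleR_def add_0 by (simp only: of_real_mult mult.assoc)
  qed
  have dens: "integrable lborel std_normal_density" by simp
  have f: "integrable lborel f"
    by (rule Bochner_Integration.integrable_bound[OF dens]) (auto simp: f_def norm_mult)
  then have "integrable lborel (\<lambda>t. complex_of_real (1 / a) * g t)"
    using lborel_integral_scale(2)[of f a 0] a by (simp only: fg) simp
  from integrable_mult_right[OF this, of "complex_of_real a"] have "integrable lborel g"
    using a by (simp add: mult.assoc[symmetric])
  then show "integrable lborel (\<lambda>t::real. complex_of_real (exp (- pi * t\<^sup>2)) * cis (2 * pi * (t * u)))"
    by (simp only: g_def[abs_def])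
  have "complex_of_real (exp (- (a * u)\<^sup>2 / 2)) = char std_normal_distribution (a * u)"
    by (simp add: char_std_normal_distribution)
  also have "\<dots> = (\<integral>x. std_normal_density x *\<^sub>R iexp (a * u * x) \<partial>lborel)"
    unfolding char_def by (rule integral_density) auto
  also have "\<dots> = (\<integral>x. f x \<partial>lborel)"
    by (simp only: f_def scaleR_conv_of_real cis_conv_exp)
  also have "\<dots> = (\<integral>t. g t \<partial>lborel)"
  proof -
    have "(\<integral>x. f x \<partial>lborel) = a ^ DIM(real) *\<^sub>R (\<integral>t. f (0 + a *\<^sub>R t) \<partial>lborel)"
      using a by (intro lborel_integral_scale(1)) auto
    also have "\<dots> = complex_of_real a * (complex_of_real (1 / a) * (\<integral>t. g t \<partial>lborel))"
      unfolding fg integral_mult_right_zero DIM_real power_one_right by (simp only: scaleR_conv_of_real)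
    also have "\<dots> = (\<integral>t. g t \<partial>lborel)"
    proof -
      have "complex_of_real a * complex_of_real (1 / a) = 1" using a(1) by (simp flip: of_real_mult)
      then show ?thesis by (simp only: mult.assoc[symmetric] mult_1_left)
    qed
    finally show ?thesis .
  qed
  finally have "(\<integral>t. g t \<partial>lborel) = complex_of_real (exp (- (a * u)\<^sup>2 / 2))" by simp
  moreover have "(a * u)\<^sup>2 / 2 = pi * u\<^sup>2"
    unfolding power_mult_distrib power2_eq_square[of a] a(2) by simp
  ultimately show "(\<integral>t. complex_of_real (exp (- pi * t\<^sup>2)) * cis (2 * pi * (t * u)) \<partial>lborel) = exp (- pi * u\<^sup>2)"
    by (simp add: g_def)
qed

lemma gauss_fourier:
  fixes v :: "'a::euclidean_space"
  shows "(\<integral>x. complex_of_real (gauss x) * wave x v \<partial>lborel) = gauss v"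
    and "integrable lborel (\<lambda>x. complex_of_real (gauss x) * wave x v)"
proof -
  have eq: "complex_of_real (gauss x) * wave x v
     = (\<Prod>b\<in>Basis. complex_of_real (exp (- pi * (x \<bullet> b)\<^sup>2)) * cis (2 * pi * ((x \<bullet> b) * (v \<bullet> b))))" for x
  proof -
    have "wave x v = (\<Prod>b\<in>Basis. cis (2 * pi * ((x \<bullet> b) * (v \<bullet> b))))"
      unfolding wave_def cis_conv_exp
      by (subst euclidean_inner) (simp add: sum_distrib_left sum_distrib_right exp_sum)
    then show ?thesis by (simp add: gauss_prod prod.distrib)
  qed
  show "(\<integral>x. complex_of_real (gauss x) * wave x v \<partial>lborel) = gauss v"
    unfolding eq
    by (subst integrable_prod_Basis(2), rule gauss_fourier_real(1))
       (simp only: gauss_fourier_real(2) gauss_prod of_real_prod)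
  show "integrable lborel (\<lambda>x. complex_of_real (gauss x) * wave x v)"
    unfolding eq by (intro integrable_prod_Basis(1) gauss_fourier_real)
qed

lemma gauss_integral: "integrable lborel (gauss :: 'a::euclidean_space \<Rightarrow> real)"
  "integral\<^sup>L lborel (gauss :: 'a::euclidean_space \<Rightarrow> real) = 1"
proof -
  have "integrable lborel (\<lambda>x::'a. complex_of_real (gauss x))" using gauss_fourier(2)[of "0::'a"] by simp
  then show "integrable lborel (gauss :: 'a \<Rightarrow> real)" by (simp only: complex_of_real_integrable_eq)
  have "complex_of_real (integral\<^sup>L lborel (gauss :: 'a \<Rightarrow> real)) = gauss (0::'a)"
    using gauss_fourier(1)[of "0::'a"] by simp
  then show "integral\<^sup>L lborel (gauss :: 'a \<Rightarrow> real) = 1" by (simp add: gauss_def)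
qed

text \<open>The multiplication formula, by Fubini. A general measure \<open>M\<close> is allowed
  because it is applied to \<open>lborel\<close> with a damping factor as well as to the measures
  occurring in balayage.\<close>

lemma integral_inv_fourier_mult:
  fixes F h :: "'a::euclidean_space \<Rightarrow> complex"
  assumes M: "sigma_finite_measure M" "sets M = sets borel"
    and h: "integrable M h" and F: "integrable lborel F"
  shows "(\<integral>x. inv_fourier F x * h x \<partial>M) = (\<integral>\<gamma>. F \<gamma> * (\<integral>x. h x * wave x \<gamma> \<partial>M) \<partial>lborel)"
proof -
  have [measurable]: "F \<in> borel_measurable borel" "h \<in> borel_measurable M" using F h by auto
  have [measurable]: "(\<lambda>x. x) \<in> borel_measurable M" by (rule measurable_ident_sets[OF M(2)])
  have "(\<integral>x. inv_fourier F x * h x \<partial>M) = (\<integral>x. (\<integral>\<gamma>. F \<gamma> * wave x \<gamma> * h x \<partial>lborel) \<partial>M)"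
    by (simp add: inv_fourier_wave)
  also have "\<dots> = (\<integral>\<gamma>. (\<integral>x. F \<gamma> * wave x \<gamma> * h x \<partial>M) \<partial>lborel)"
  proof (rule Fubini_iterated[OF M(1) sigma_finite_lborel, symmetric])
    show "integrable lborel (\<lambda>\<gamma>. F \<gamma> * wave x \<gamma> * h x)" for x
      using F by (intro integrable_mult_left integrable_mult_wave) auto
    have "(\<integral>\<gamma>. cmod (F \<gamma> * wave x \<gamma> * h x) \<partial>lborel) = (\<integral>\<gamma>. cmod (F \<gamma>) \<partial>lborel) * cmod (h x)" for x
      by (simp add: norm_mult)
    then show "integrable M (\<lambda>x. \<integral>\<gamma>. cmod (F \<gamma> * wave x \<gamma> * h x) \<partial>lborel)" using h by simp
  qed measurable
  also have "\<dots> = (\<integral>\<gamma>. F \<gamma> * (\<integral>x. h x * wave x \<gamma> \<partial>M) \<partial>lborel)"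
  proof -
    have "F \<gamma> * wave x \<gamma> * h x = F \<gamma> * (h x * wave x \<gamma>)" for x \<gamma> by simp
    then show ?thesis by (simp only: integral_mult_right_zero)
  qed
  finally show ?thesis .
qed

text \<open>A Lebesgue measurable function is an almost everywhere limit of continuous ones.
  Truncating those in value and in space makes dominated convergence applicable and keeps them
  continuous.\<close>

lemma L2_approx_bounded:
  fixes G :: "'a::euclidean_space \<Rightarrow> complex"
  assumes [measurable]: "G \<in> borel_measurable borel" and GB: "\<And>x. cmod (G x) \<le> B"
    and G0: "\<And>x. norm x > \<rho> \<Longrightarrow> G x = 0" and e: "e > 0"
  shows "\<exists>C. continuous_on UNIV C \<and> (\<forall>x. norm x > \<rho> + 1 \<longrightarrow> C x = 0) \<and> (\<forall>x. cmod (C x) \<le> B) \<and>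
    (\<integral>x. (cmod (G x - C x))\<^sup>2 \<partial>lborel) < e"
proof -
  have B: "B \<ge> 0" using GB[of 0] norm_ge_zero order_trans by blast
  have "G \<in> borel_measurable lebesgue" by (rule measurable_completion) simp
  then have "G measurable_on UNIV" by (rule lebesgue_measurable_imp_measurable_on) simp
  then obtain N g where N: "negligible N" and g: "\<And>n. continuous_on UNIV (g n)"
    and lim: "\<And>x. x \<notin> N \<Longrightarrow> (\<lambda>n. g n x) \<longlonglongrightarrow> G x"
    by (auto simp: measurable_on_def)
  \<comment> \<open>The nearest-point map onto the disc of radius \<open>B\<close> is continuous and
    fixes the values of \<open>G\<close>.\<close>
  define p where "p = closest_point (cball (0::complex) B)"
  have p: "continuous_on UNIV p" "\<And>z. cmod (p z) \<le> B" "\<And>z. cmod z \<le> B \<Longrightarrow> p z = z"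
    using B closest_point_in_set[of "cball (0::complex) B"] unfolding p_def
    by (auto intro!: continuous_on_closest_point closest_point_self)
  \<comment> \<open>A continuous cutoff between the radii \<open>\<rho>\<close> and
    \<open>\<rho> + 1\<close>; this is the source of the enlarged radius in the conclusion.\<close>
  define \<kappa> :: "'a \<Rightarrow> real" where "\<kappa> x = max 0 (min 1 (\<rho> + 1 - norm x))" for x
  have \<kappa>: "continuous_on UNIV \<kappa>" "0 \<le> \<kappa> x" "\<kappa> x \<le> 1" "norm x \<le> \<rho> \<Longrightarrow> \<kappa> x = 1" "norm x > \<rho> + 1 \<Longrightarrow> \<kappa> x = 0" for x
    unfolding \<kappa>_def by (auto intro!: continuous_intros)
  define C where "C n x = \<kappa> x *\<^sub>R p (g n x)" for n x
  have Cc: "continuous_on UNIV (C n)" for n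
    unfolding C_def by (intro continuous_on_scaleR \<kappa>(1) continuous_on_compose2[OF p(1) g]) auto
  have [measurable]: "C n \<in> borel_measurable borel" for n
    by (rule borel_measurable_continuous_onI[OF Cc])
  have C0: "C n x = 0" if "norm x > \<rho> + 1" for n x using \<kappa>(5)[OF that] by (simp add: C_def)
  have CB: "cmod (C n x) \<le> B" for n x
    using mult_mono[OF \<kappa>(3)[of x] p(2)[of "g n x"]] \<kappa>(2)[of x] by (simp add: C_def)
  have "(\<lambda>n. \<integral>x. (cmod (G x - C n x))\<^sup>2 \<partial>lborel) \<longlonglongrightarrow> (\<integral>x. 0 \<partial>(lborel :: 'a measure))"
  proof (rule integral_dominated_convergence[where w = "\<lambda>x. (2 * B)\<^sup>2 * indicator (cball 0 (\<rho> + 1)) x"])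
    show "integrable lborel (\<lambda>x. (2 * B)\<^sup>2 * indicator (cball (0::'a) (\<rho> + 1)) x :: real)"
      using emeasure_lborel_cball_finite[of "0::'a" "\<rho> + 1"]
      by (intro integrable_mult_right integrable_real_indicator) auto
    have "(\<lambda>n. (cmod (G x - C n x))\<^sup>2) \<longlonglongrightarrow> 0" if "x \<notin> N" for x
    proof -
      have "(\<lambda>n. p (g n x)) \<longlonglongrightarrow> p (G x)"
        by (rule continuous_on_tendsto_compose[OF p(1) lim[OF that]]) auto
      then have "(\<lambda>n. C n x) \<longlonglongrightarrow> \<kappa> x *\<^sub>R G x" using p(3) GB by (simp add: C_def tendsto_intros)
      moreover have "\<kappa> x *\<^sub>R G x = G x" using \<kappa>(4)[of x] G0[of x] by (cases "norm x \<le> \<rho>") auto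
      ultimately have "(\<lambda>n. (cmod (G x - C n x))\<^sup>2) \<longlonglongrightarrow> (cmod (G x - G x))\<^sup>2"
        by (intro tendsto_intros) simp
      then show ?thesis by simp
    qed
    moreover have "AE x in lborel. x \<notin> N"
    proof -
      have "N \<in> null_sets lebesgue" using N by (simp add: negligible_iff_null_sets)
      then have "AE x in lebesgue. x \<notin> N" by (rule AE_not_in)
      then show ?thesis by (simp add: AE_completion_iff)
    qed
    ultimately show "AE x in lborel. (\<lambda>n. (cmod (G x - C n x))\<^sup>2) \<longlonglongrightarrow> 0" by (auto elim: eventually_mono)
    show "AE x in lborel. norm ((cmod (G x - C n x))\<^sup>2) \<le> (2 * B)\<^sup>2 * indicator (cball 0 (\<rho> + 1)) x" for n
    proof (rule AE_I2)
      fix x :: 'a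
      show "norm ((cmod (G x - C n x))\<^sup>2) \<le> (2 * B)\<^sup>2 * indicator (cball 0 (\<rho> + 1)) x"
      proof (cases "norm x \<le> \<rho> + 1")
        case True
        have "cmod (G x - C n x) \<le> 2 * B"
          using norm_triangle_ineq4[of "G x" "C n x"] GB[of x] CB[of n x] by linarith
        then have "(cmod (G x - C n x))\<^sup>2 \<le> (2 * B)\<^sup>2" by (intro power_mono) auto
        then show ?thesis using True by simp
      qed (simp add: G0 C0)
    qed
  qed auto
  then have "\<forall>\<^sub>F n in sequentially. (\<integral>x. (cmod (G x - C n x))\<^sup>2 \<partial>lborel) < e"
    by (rule order_tendstoD(2)) (use e in simp)
  then obtain n where "(\<integral>x. (cmod (G x - C n x))\<^sup>2 \<partial>lborel) < e"
    by (auto simp: eventually_sequentially)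
  then show ?thesis using Cc C0 CB by blast
qed

text \<open>Large values are cut off to reach the bounded case. Both errors are kept below
  \<open>e / 4\<close> because \<open>(a + b)^2 \<le> 2 a^2 + 2 b^2\<close>.\<close>

lemma L2_approx:
  fixes F :: "'a::euclidean_space \<Rightarrow> complex"
  assumes F: "F \<in> L2_on S" and S: "S \<subseteq> cball 0 \<rho>" and e: "e > 0"
  shows "\<exists>C B. continuous_on UNIV C \<and> (\<forall>x. norm x > \<rho> + 1 \<longrightarrow> C x = 0) \<and> (\<forall>x. cmod (C x) \<le> B) \<and>
    (\<integral>x. (cmod (F x - C x))\<^sup>2 \<partial>lborel) < e"
proof -
  note F' = L2_onD[OF F]
  have [measurable]: "F \<in> borel_measurable borel" by (rule F')
  have F0: "F x = 0" if "norm x > \<rho>" for x using F'(3) S that by (force simp: subset_iff)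
  define G where "G n x = (if cmod (F x) \<le> real n then F x else 0)" for n :: nat and x
  have [measurable]: "G n \<in> borel_measurable borel" for n unfolding G_def by measurable
  have Gint: "integrable lborel (\<lambda>x. (cmod (F x - G n x))\<^sup>2)" for n
    by (rule Bochner_Integration.integrable_bound[OF F'(2)]) (auto simp: G_def)
  have "(\<lambda>n. \<integral>x. (cmod (F x - G n x))\<^sup>2 \<partial>lborel) \<longlonglongrightarrow> (\<integral>x. 0 \<partial>(lborel :: 'a measure))"
  proof (rule integral_dominated_convergence[OF _ _ F'(2)])
    have "(\<lambda>n. (cmod (F x - G n x))\<^sup>2) \<longlonglongrightarrow> 0" for x
    proof (rule tendsto_eventually)
      obtain m :: nat where "cmod (F x) \<le> real m" using real_arch_simple by blast
      then show "\<forall>\<^sub>F n in sequentially. (cmod (F x - G n x))\<^sup>2 = 0"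
        unfolding eventually_sequentially G_def by (intro exI[of _ m]) auto
    qed
    then show "AE x in lborel. (\<lambda>n. (cmod (F x - G n x))\<^sup>2) \<longlonglongrightarrow> 0" by simp
  qed (auto simp: G_def)
  then have "\<forall>\<^sub>F n in sequentially. (\<integral>x. (cmod (F x - G n x))\<^sup>2 \<partial>lborel) < e / 4"
    by (rule order_tendstoD(2)) (use e in simp)
  then obtain n where n: "(\<integral>x. (cmod (F x - G n x))\<^sup>2 \<partial>lborel) < e / 4"
    by (auto simp: eventually_sequentially)
  have GB: "cmod (G n x) \<le> real n" and G0: "norm x > \<rho> \<Longrightarrow> G n x = 0" for x
    by (auto simp: G_def F0)
  obtain C where C: "continuous_on UNIV C" "\<And>x. norm x > \<rho> + 1 \<Longrightarrow> C x = 0" "\<And>x. cmod (C x) \<le> real n"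
    "(\<integral>x. (cmod (G n x - C x))\<^sup>2 \<partial>lborel) < e / 4"
    using L2_approx_bounded[OF _ GB G0, where e = "e/4"] e by force
  have [measurable]: "C \<in> borel_measurable borel" by (rule borel_measurable_continuous_onI[OF C(1)])
  have GCb: "cmod (G n x - C x) \<le> 2 * real n" for x
    using norm_triangle_ineq4[of "G n x" "C x"] C(3)[of x] by (auto simp: G_def)
  have GC: "integrable lborel (\<lambda>x. (cmod (G n x - C x))\<^sup>2)"
    by (rule integrable_bounded_support(2)[OF _ GCb, where \<rho> = "\<rho> + 1"]) (auto simp: G_def F0 C(2))
  have "(\<integral>x. (cmod (F x - C x))\<^sup>2 \<partial>lborel) \<le> (\<integral>x. 2 * (cmod (F x - G n x))\<^sup>2 + 2 * (cmod (G n x - C x))\<^sup>2 \<partial>lborel)"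
  proof (rule integral_mono')
    show "integrable lborel (\<lambda>x. 2 * (cmod (F x - G n x))\<^sup>2 + 2 * (cmod (G n x - C x))\<^sup>2)"
      using Gint GC by (intro Bochner_Integration.integrable_add integrable_mult_right)
    fix x
    have "cmod (F x - C x) \<le> cmod (F x - G n x) + cmod (G n x - C x)"
      using norm_triangle_ineq[of "F x - G n x" "G n x - C x"] by simp
    then have "(cmod (F x - C x))\<^sup>2 \<le> (cmod (F x - G n x) + cmod (G n x - C x))\<^sup>2"
      by (intro power_mono) auto
    also have "\<dots> \<le> 2 * (cmod (F x - G n x))\<^sup>2 + 2 * (cmod (G n x - C x))\<^sup>2"
      using zero_le_power2[of "cmod (F x - G n x) - cmod (G n x - C x)"] by (simp add: power2_eq_square algebra_simps)
    finally show "(cmod (F x - C x))\<^sup>2 \<le> 2 * (cmod (F x - G n x))\<^sup>2 + 2 * (cmod (G n x - C x))\<^sup>2" .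
  qed simp
  also have "\<dots> < e" using n C(4) Gint GC by (simp add: Bochner_Integration.integral_add)
  finally show ?thesis using C by blast
qed

section \<open>Gaussian mollification and damping\<close>

lemma borel_measurable_cnj [measurable (raw)]:
  "f \<in> borel_measurable M \<Longrightarrow> (\<lambda>x. cnj (f x)) \<in> borel_measurable M"
  by (rule borel_measurable_continuous_on[of cnj]) (intro continuous_intros)

text \<open>Convolution with a Gaussian of width \<open>s\<close>, written after substitution so
  that \<open>s\<close> occurs only in the argument of \<open>C\<close>; the limit
  \<open>s \<rightarrow> 0\<close> is then plain dominated convergence.\<close>

definition mollify :: "real \<Rightarrow> ('a::euclidean_space \<Rightarrow> complex) \<Rightarrow> 'a \<Rightarrow> complex" where
  "mollify s C \<gamma> = (\<integral>v. C (\<gamma> + s *\<^sub>R v) * gauss v \<partial>lborel)"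

context
  fixes C :: "'a::euclidean_space \<Rightarrow> complex" and B R :: real
  assumes C_cont: "continuous_on UNIV C" and C_supp: "\<And>x. norm x > R \<Longrightarrow> C x = 0"
    and C_bound: "\<And>x. cmod (C x) \<le> B"
begin

lemma compactly_supported_measurable: "C \<in> borel_measurable borel"
  by (rule borel_measurable_continuous_onI[OF C_cont])

declare compactly_supported_measurable [measurable]

lemma compactly_supported_integrable: "integrable lborel C" "integrable lborel (\<lambda>x. (cmod (C x))\<^sup>2)"
  using integrable_bounded_support[OF compactly_supported_measurable C_bound C_supp] by blast+

lemma mollify_integrable: "integrable lborel (\<lambda>v. C (\<gamma> + s *\<^sub>R v) * gauss v)"
proof (rule Bochner_Integration.integrable_bound)
  show "integrable lborel (\<lambda>v::'a. B * gauss v)"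
    using gauss_integral(1)[where 'a='a] by (rule integrable_mult_right)
  show "AE v in lborel. norm (C (\<gamma> + s *\<^sub>R v) * complex_of_real (gauss v)) \<le> norm (B * gauss v)"
    using C_bound by (intro AE_I2) (auto simp: norm_mult gauss_bounds abs_mult intro!: mult_mono order_trans[OF _ abs_ge_self])
qed measurable

lemma mollify_measurable: "mollify s C \<in> borel_measurable borel"
  unfolding mollify_def[abs_def] by measurable

declare mollify_measurable [measurable]

lemma mollify_bound: "cmod (mollify s C \<gamma>) \<le> B"
proof -
  have "cmod (mollify s C \<gamma>) \<le> (\<integral>v. cmod (C (\<gamma> + s *\<^sub>R v) * gauss v) \<partial>lborel)"
    unfolding mollify_def by (rule integral_norm_bound)
  also have "\<dots> \<le> (\<integral>v. B * gauss v \<partial>(lborel :: 'a measure))"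
  proof (rule integral_mono)
    show "integrable lborel (\<lambda>v::'a. B * gauss v)"
      using gauss_integral(1)[where 'a='a] by (rule integrable_mult_right)
    show "cmod (C (\<gamma> + s *\<^sub>R v) * complex_of_real (gauss v)) \<le> B * gauss v" for v
      using C_bound by (auto simp: norm_mult gauss_bounds intro!: mult_right_mono)
  qed (use mollify_integrable in auto)
  also have "\<dots> = B" by (simp add: gauss_integral)
  finally show ?thesis .
qed

lemma mollify_tendsto: "(\<lambda>n. mollify (1 / Suc n) C \<gamma>) \<longlonglongrightarrow> C \<gamma>"
proof -
  have "(\<lambda>n. mollify (1 / Suc n) C \<gamma>) \<longlonglongrightarrow> (\<integral>v. C \<gamma> * gauss v \<partial>(lborel :: 'a measure))"
    unfolding mollify_def
  proof (rule integral_dominated_convergence[where w = "\<lambda>v. B * gauss v"])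
    show "integrable lborel (\<lambda>v::'a. B * gauss v)"
      using gauss_integral(1)[where 'a='a] by (rule integrable_mult_right)
    have "(\<lambda>n. C (\<gamma> + (1 / real (Suc n)) *\<^sub>R v) * gauss v) \<longlonglongrightarrow> C \<gamma> * gauss v" for v
    proof -
      have "(\<lambda>n. \<gamma> + (1 / real (Suc n)) *\<^sub>R v) \<longlonglongrightarrow> \<gamma> + 0 *\<^sub>R v"
        by (intro tendsto_intros LIMSEQ_Suc lim_1_over_n)
      then have "(\<lambda>n. C (\<gamma> + (1 / real (Suc n)) *\<^sub>R v)) \<longlonglongrightarrow> C \<gamma>"
        using continuous_on_tendsto_compose[OF C_cont] by simp
      then show ?thesis by (intro tendsto_intros)
    qed
    then show "AE v in lborel. (\<lambda>n. C (\<gamma> + (1 / real (Suc n)) *\<^sub>R v) * gauss v) \<longlonglongrightarrow> C \<gamma> * gauss v"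
      by simp
    show "AE v in lborel. norm (C (\<gamma> + (1 / real (Suc n)) *\<^sub>R v) * complex_of_real (gauss v)) \<le> B * gauss v" for n
      using C_bound by (intro AE_I2) (auto simp: norm_mult gauss_bounds intro!: mult_right_mono)
  qed measurable
  also have "(\<integral>v. C \<gamma> * gauss v \<partial>(lborel :: 'a measure)) = C \<gamma>"
    by (simp add: gauss_integral)
  finally show ?thesis .
qed

lemma integral_mollify_tendsto:
  assumes G: "integrable lborel G"
  shows "(\<lambda>n. \<integral>\<gamma>. G \<gamma> * cnj (mollify (1 / Suc n) C \<gamma>) \<partial>lborel) \<longlonglongrightarrow> (\<integral>\<gamma>. G \<gamma> * cnj (C \<gamma>) \<partial>lborel)"
proof (rule integral_dominated_convergence[where w = "\<lambda>\<gamma>. cmod (G \<gamma>) * B"])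
  have [measurable]: "G \<in> borel_measurable borel" using G by auto
  show "(\<lambda>\<gamma>. G \<gamma> * cnj (C \<gamma>)) \<in> borel_measurable lborel" by measurable
  show "(\<lambda>\<gamma>. G \<gamma> * cnj (mollify (1 / Suc n) C \<gamma>)) \<in> borel_measurable lborel" for n by measurable
  show "integrable lborel (\<lambda>\<gamma>. cmod (G \<gamma>) * B)" using G by simp
  show "AE \<gamma> in lborel. (\<lambda>n. G \<gamma> * cnj (mollify (1 / Suc n) C \<gamma>)) \<longlonglongrightarrow> G \<gamma> * cnj (C \<gamma>)"
    by (intro AE_I2 tendsto_intros mollify_tendsto)
  show "AE \<gamma> in lborel. norm (G \<gamma> * cnj (mollify (1 / Suc n) C \<gamma>)) \<le> cmod (G \<gamma>) * B" for n
    by (intro AE_I2) (auto simp: norm_mult intro!: mult_left_mono mollify_bound)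
qed

lemma integrable_gauss_damped:
  assumes "s > 0"
  shows "integrable lborel (\<lambda>x::'a. complex_of_real (gauss (s *\<^sub>R x)))"
proof -
  have "integrable lborel (\<lambda>x::'a. gauss (s *\<^sub>R x))"
    using lborel_integral_scale(2)[of "gauss :: 'a \<Rightarrow> real" s 0] gauss_integral(1)[where 'a='a] assms by simp
  then show ?thesis by (simp only: complex_of_real_integrable_eq)
qed

lemma integrable_damped:
  assumes "s > 0"
  shows "integrable lborel (\<lambda>x. inv_fourier C x * gauss (s *\<^sub>R x))"
proof (rule Bochner_Integration.integrable_bound)
  show "integrable lborel (\<lambda>x::'a. (\<integral>\<gamma>. cmod (C \<gamma>) \<partial>lborel) * complex_of_real (gauss (s *\<^sub>R x)))"
    using integrable_gauss_damped[OF assms] by (rule integrable_mult_right)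
  have "inv_fourier C \<in> borel_measurable borel" by measurable
  then show "(\<lambda>x. inv_fourier C x * complex_of_real (gauss (s *\<^sub>R x))) \<in> borel_measurable lborel" by measurable
  show "AE x in lborel. norm (inv_fourier C x * complex_of_real (gauss (s *\<^sub>R x))) \<le> 
    norm ((\<integral>\<gamma>. cmod (C \<gamma>) \<partial>lborel) * complex_of_real (gauss (s *\<^sub>R x)))"
    by (intro AE_I2) (auto simp: norm_mult intro!: mult_right_mono gauss_bounds norm_inv_fourier_le compactly_supported_integrable order_trans[OF _ abs_ge_self])
qed

text \<open>By the multiplication formula the damping factor becomes its own transform, a Gaussian
  of width \<open>s\<close> centred at \<open>\<gamma>\<close>. The damping makes Fourier inversion
  absolutely convergent.\<close>

lemma fourier_damped:
  assumes "s > 0"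
  shows "(\<integral>x. inv_fourier C x * gauss (s *\<^sub>R x) * wave x (- \<gamma>) \<partial>lborel) = mollify s C \<gamma>"
proof -
  have inner: "(\<integral>x. gauss (s *\<^sub>R x) * wave x (- \<gamma>) * wave x \<gamma>' \<partial>lborel) = gauss ((\<gamma>' - \<gamma>) /\<^sub>R s) / s ^ DIM('a)" for \<gamma>'
  proof -
    have "(\<integral>x. gauss (s *\<^sub>R x) * wave x (- \<gamma>) * wave x \<gamma>' \<partial>lborel) = (\<integral>x. gauss (0 + s *\<^sub>R x) * wave (0 + s *\<^sub>R x) ((\<gamma>' - \<gamma>) /\<^sub>R s) \<partial>lborel)"
      using assms by (intro Bochner_Integration.integral_cong) (auto simp: wave_scale wave_add_right[symmetric] mult.assoc)
    also have "\<dots> = gauss ((\<gamma>' - \<gamma>) /\<^sub>R s) / s ^ DIM('a)"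
      using lborel_integral_scale(1)[of "\<lambda>x. gauss x * wave x ((\<gamma>' - \<gamma>) /\<^sub>R s)" s 0] assms
      by (simp add: gauss_fourier scaleR_conv_of_real field_simps)
    finally show ?thesis .
  qed
  have "(\<integral>x. inv_fourier C x * gauss (s *\<^sub>R x) * wave x (- \<gamma>) \<partial>lborel)
      = (\<integral>x. inv_fourier C x * (gauss (s *\<^sub>R x) * wave x (- \<gamma>)) \<partial>lborel)"
    by (simp only: mult.assoc)
  also have "\<dots> = (\<integral>\<gamma>'. C \<gamma>' * (\<integral>x. gauss (s *\<^sub>R x) * wave x (- \<gamma>) * wave x \<gamma>' \<partial>lborel) \<partial>lborel)"
    by (intro integral_inv_fourier_mult sigma_finite_lborel integrable_mult_wave integrable_gauss_damped compactly_supported_integrable assms) auto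
  also have "\<dots> = (\<integral>\<gamma>'. C \<gamma>' * (gauss ((\<gamma>' - \<gamma>) /\<^sub>R s) / s ^ DIM('a)) \<partial>lborel)"
    by (simp only: inner)
  also have "\<dots> = s ^ DIM('a) *\<^sub>R (\<integral>v. C (\<gamma> + s *\<^sub>R v) * (gauss (((\<gamma> + s *\<^sub>R v) - \<gamma>) /\<^sub>R s) / s ^ DIM('a)) \<partial>lborel)"
    by (intro lborel_integral_scale(1) assms) measurable
  also have "\<dots> = mollify s C \<gamma>"
    using assms by (simp add: mollify_def scaleR_conv_of_real)
  finally show ?thesis .
qed

text \<open>A damped Parseval identity: both sides converge absolutely although neither transform is
  yet known to be square integrable.\<close>

lemma integral_mollify:
  assumes "s > 0" and G: "integrable lborel G"
  shows "(\<integral>\<gamma>. G \<gamma> * cnj (mollify s C \<gamma>) \<partial>lborel) = (\<integral>x. inv_fourier G x * (cnj (inv_fourier C x) * gauss (s *\<^sub>R x)) \<partial>lborel)"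
proof -
  have int: "integrable lborel (\<lambda>x. cnj (inv_fourier C x) * gauss (s *\<^sub>R x))"
    using integrable_damped[OF assms(1)] integrable_cnj[of lborel "\<lambda>x. inv_fourier C x * gauss (s *\<^sub>R x)"] by simp
  have "cnj (mollify s C \<gamma>) = (\<integral>x. cnj (inv_fourier C x) * gauss (s *\<^sub>R x) * wave x \<gamma> \<partial>lborel)" for \<gamma>
    unfolding fourier_damped[OF assms(1), symmetric]
    by (subst Bochner_Integration.integral_cnj[symmetric]) (simp add: cnj_wave)
  then show ?thesis
    using integral_inv_fourier_mult[OF sigma_finite_lborel _ int G] by simp
qed

declare compactly_supported_measurable [measurable del] mollify_measurable [measurable del]

end

section \<open>One half of Plancherel's theorem\<close>

lemma cmod_diff_squared: "(cmod (z - w))\<^sup>2 = (cmod z)\<^sup>2 + (cmod w)\<^sup>2 - 2 * Re (z * cnj w)"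
  unfolding cmod_power2 by (simp add: power2_eq_square algebra_simps)

text \<open>For continuous \<open>C\<close> with transform \<open>c\<close>, Gaussian damping carries
  \<open>2 Re (f * cnj c) \<le> |f|^2 + |c|^2\<close> over to \<open>F\<close> and \<open>C\<close>; there it reads
  \<open>|F|^2 - |F - C|^2 \<le> |f|^2\<close> after integration, and \<open>C\<close> may approach \<open>F\<close>.\<close>

lemma norm_le_norm_inv_fourier:
  fixes F :: "'a::euclidean_space \<Rightarrow> complex"
  assumes F: "F \<in> L2_on S" and "bounded S"
    and f: "integrable lborel (\<lambda>x. (cmod (inv_fourier F x))\<^sup>2)"
  shows "(\<integral>\<gamma>. (cmod (F \<gamma>))\<^sup>2 \<partial>lborel) \<le> (\<integral>x. (cmod (inv_fourier F x))\<^sup>2 \<partial>lborel)"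
proof (rule field_le_epsilon)
  fix e :: real assume e: "e > 0"
  obtain \<rho> where \<rho>: "S \<subseteq> cball 0 \<rho>" using \<open>bounded S\<close> bounded_subset_ballD[of S 0] ball_subset_cball by blast
  obtain C B where C: "continuous_on UNIV C" "\<And>x. norm x > \<rho> + 1 \<Longrightarrow> C x = 0" "\<And>x. cmod (C x) \<le> B"
    "(\<integral>x. (cmod (F x - C x))\<^sup>2 \<partial>lborel) < e"
    using L2_approx[OF F \<rho> e] by blast
  note c = C(1-3)
  have Fi: "integrable lborel F" using F \<open>bounded S\<close> by (rule L2_on_integrable)
  have [measurable]: "F \<in> borel_measurable borel" using F by (rule L2_onD)
  have Cm: "C \<in> borel_measurable borel" by (rule borel_measurable_continuous_onI[OF C(1)])
  note [measurable] = Cm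
  have fm [measurable]: "inv_fourier F \<in> borel_measurable borel" "inv_fourier C \<in> borel_measurable borel" by measurable
  let ?f = "inv_fourier F" and ?c = "inv_fourier C"
  let ?nf = "\<integral>x. (cmod (?f x))\<^sup>2 \<partial>lborel"
  have key: "2 * Re (\<integral>\<gamma>. F \<gamma> * cnj (mollify s C \<gamma>) \<partial>lborel) \<le> ?nf + Re (\<integral>\<gamma>. C \<gamma> * cnj (mollify s C \<gamma>) \<partial>lborel)"
    if s: "s > 0" for s
  proof -
    have cg: "integrable lborel (\<lambda>x. ?c x * gauss (s *\<^sub>R x))" by (rule integrable_damped[OF c s])
    have bdd: "integrable lborel (\<lambda>x. g x * (cnj (?c x) * gauss (s *\<^sub>R x)))"
      if "\<And>x. cmod (g x) \<le> K" "g \<in> borel_measurable borel" for g K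
    proof (rule Bochner_Integration.integrable_bound[OF integrable_mult_right[OF cg, of "complex_of_real K"]])
      have "0 \<le> K" using that(1)[of 0] norm_ge_zero order_trans by blast
      then show "AE x in lborel. norm (g x * (cnj (?c x) * gauss (s *\<^sub>R x))) \<le> norm (complex_of_real K * (?c x * gauss (s *\<^sub>R x)))"
        using that(1) by (intro AE_I2) (auto simp: norm_mult intro!: mult_right_mono)
      have [measurable]: "g \<in> borel_measurable borel" by fact
      show "(\<lambda>x. g x * (cnj (?c x) * gauss (s *\<^sub>R x))) \<in> borel_measurable lborel" by measurable
    qed
    have i1: "integrable lborel (\<lambda>x. ?f x * (cnj (?c x) * gauss (s *\<^sub>R x)))"
      by (rule bdd[OF norm_inv_fourier_le[OF Fi]]) measurable
    have i2: "integrable lborel (\<lambda>x. ?c x * (cnj (?c x) * gauss (s *\<^sub>R x)))"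
      by (rule bdd[OF norm_inv_fourier_le[OF compactly_supported_integrable(1)[OF c]]]) measurable
    have "2 * Re (\<integral>\<gamma>. F \<gamma> * cnj (mollify s C \<gamma>) \<partial>lborel) = (\<integral>x. 2 * Re (?f x * (cnj (?c x) * gauss (s *\<^sub>R x))) \<partial>lborel)"
      by (simp only: integral_mollify[OF c s Fi] integral_mult_right_zero integral_Re[OF i1])
    also have "\<dots> \<le> (\<integral>x. (cmod (?f x))\<^sup>2 + Re (?c x * (cnj (?c x) * gauss (s *\<^sub>R x))) \<partial>lborel)"
    proof (rule integral_mono)
      show "integrable lborel (\<lambda>x. 2 * Re (?f x * (cnj (?c x) * gauss (s *\<^sub>R x))))"
        by (intro integrable_mult_right integrable_Re i1)
      show "integrable lborel (\<lambda>x. (cmod (?f x))\<^sup>2 + Re (?c x * (cnj (?c x) * gauss (s *\<^sub>R x))))"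
        by (intro Bochner_Integration.integrable_add f integrable_Re i2)
      fix x :: 'a
      let ?w = "gauss (s *\<^sub>R x)"
      have "2 * Re (?f x * cnj (?c x)) \<le> (cmod (?f x))\<^sup>2 + (cmod (?c x))\<^sup>2"
        using zero_le_power2[of "cmod (?f x - ?c x)"] unfolding cmod_diff_squared by linarith
      then have "2 * Re (?f x * cnj (?c x)) * ?w \<le> ((cmod (?f x))\<^sup>2 + (cmod (?c x))\<^sup>2) * ?w"
        using gauss_bounds(3) by (rule mult_right_mono)
      \<comment> \<open>The weight is dropped only from \<open>|f|^2\<close>, which is integrable by
        assumption. On \<open>|c|^2\<close> it stays, since only the damped integral is known to
        converge and to equal a pairing with the mollified \<open>C\<close>.\<close>
      also have "\<dots> \<le> (cmod (?f x))\<^sup>2 + (cmod (?c x))\<^sup>2 * ?w"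
        using mult_left_mono[OF gauss_bounds(2)[of "s *\<^sub>R x"], of "(cmod (?f x))\<^sup>2"] by (simp add: algebra_simps)
      finally have le: "2 * Re (?f x * cnj (?c x)) * ?w \<le> (cmod (?f x))\<^sup>2 + (cmod (?c x))\<^sup>2 * ?w" .
      have e1: "Re (?f x * (cnj (?c x) * ?w)) = Re (?f x * cnj (?c x)) * ?w"
        by (simp add: algebra_simps)
      have e2: "Re (?c x * (cnj (?c x) * ?w)) = (cmod (?c x))\<^sup>2 * ?w"
        unfolding cmod_power2 by (simp add: algebra_simps power2_eq_square)
      show "2 * Re (?f x * (cnj (?c x) * ?w)) \<le> (cmod (?f x))\<^sup>2 + Re (?c x * (cnj (?c x) * ?w))"
        using le unfolding e1 e2 by (simp only: mult.assoc)
    qed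
    also have "\<dots> = ?nf + (\<integral>x. Re (?c x * (cnj (?c x) * gauss (s *\<^sub>R x))) \<partial>lborel)"
      by (intro Bochner_Integration.integral_add f integrable_Re i2)
    also have "\<dots> = ?nf + Re (\<integral>\<gamma>. C \<gamma> * cnj (mollify s C \<gamma>) \<partial>lborel)"
      using i2 by (simp only: integral_mollify[OF c s compactly_supported_integrable(1)[OF c]] integral_Re)
    finally show ?thesis .
  qed
  have lim: "2 * Re (\<integral>\<gamma>. F \<gamma> * cnj (C \<gamma>) \<partial>lborel) \<le> ?nf + Re (\<integral>\<gamma>. C \<gamma> * cnj (C \<gamma>) \<partial>lborel)"
  proof (rule LIMSEQ_le)
    show "(\<lambda>n. 2 * Re (\<integral>\<gamma>. F \<gamma> * cnj (mollify (1 / Suc n) C \<gamma>) \<partial>lborel)) \<longlonglongrightarrow> 2 * Re (\<integral>\<gamma>. F \<gamma> * cnj (C \<gamma>) \<partial>lborel)"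
      by (intro tendsto_intros integral_mollify_tendsto[OF c] Fi)
    show "(\<lambda>n. ?nf + Re (\<integral>\<gamma>. C \<gamma> * cnj (mollify (1 / Suc n) C \<gamma>) \<partial>lborel)) \<longlonglongrightarrow> ?nf + Re (\<integral>\<gamma>. C \<gamma> * cnj (C \<gamma>) \<partial>lborel)"
      by (intro tendsto_intros integral_mollify_tendsto[OF c] compactly_supported_integrable(1)[OF c])
    show "\<exists>N. \<forall>n\<ge>N. 2 * Re (\<integral>\<gamma>. F \<gamma> * cnj (mollify (1 / Suc n) C \<gamma>) \<partial>lborel) \<le> ?nf + Re (\<integral>\<gamma>. C \<gamma> * cnj (mollify (1 / Suc n) C \<gamma>) \<partial>lborel)"
      by (intro exI allI impI key) simp
  qed
  have FC: "integrable lborel (\<lambda>\<gamma>. F \<gamma> * cnj (C \<gamma>))"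
  proof (rule Bochner_Integration.integrable_bound[OF integrable_mult_right[OF Fi, of "complex_of_real B"]])
    have "0 \<le> B" using C(3)[of 0] norm_ge_zero order_trans by blast
    then show "AE x in lborel. norm (F x * cnj (C x)) \<le> norm (complex_of_real B * F x)"
      using C(3) by (intro AE_I2) (auto simp: norm_mult mult.commute intro!: mult_right_mono)
  qed measurable
  have C2: "integrable lborel (\<lambda>\<gamma>. (cmod (C \<gamma>))\<^sup>2)" by (rule compactly_supported_integrable(2)[OF c])
  have CC: "Re (\<integral>\<gamma>. C \<gamma> * cnj (C \<gamma>) \<partial>lborel) = (\<integral>\<gamma>. (cmod (C \<gamma>))\<^sup>2 \<partial>lborel)"
    by (simp add: complex_norm_square[symmetric] flip: of_real_power)
  \<comment> \<open>After integration the first term is below \<open>e\<close>, and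
    \<open>lim\<close> together with \<open>CC\<close> bounds the remaining two by
    \<open>?nf\<close>.\<close>
  have pt: "(cmod (F \<gamma>))\<^sup>2 = (cmod (F \<gamma> - C \<gamma>))\<^sup>2 + 2 * Re (F \<gamma> * cnj (C \<gamma>)) - (cmod (C \<gamma>))\<^sup>2" for \<gamma>
    unfolding cmod_diff_squared[of "F \<gamma>"] by linarith
  have FC2: "integrable lborel (\<lambda>\<gamma>. (cmod (F \<gamma> - C \<gamma>))\<^sup>2)"
  proof -
    have "(\<lambda>\<gamma>. (cmod (F \<gamma> - C \<gamma>))\<^sup>2) = (\<lambda>\<gamma>. (cmod (F \<gamma>))\<^sup>2 - 2 * Re (F \<gamma> * cnj (C \<gamma>)) + (cmod (C \<gamma>))\<^sup>2)"
      unfolding pt by auto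
    moreover have "integrable lborel \<dots>"
      by (intro Bochner_Integration.integrable_add Bochner_Integration.integrable_diff integrable_mult_right integrable_Re FC C2 L2_onD(2)[OF F])
    ultimately show ?thesis by simp
  qed
  have "(\<integral>\<gamma>. (cmod (F \<gamma>))\<^sup>2 \<partial>lborel) = (\<integral>\<gamma>. (cmod (F \<gamma> - C \<gamma>))\<^sup>2 + 2 * Re (F \<gamma> * cnj (C \<gamma>)) - (cmod (C \<gamma>))\<^sup>2 \<partial>lborel)"
    by (intro Bochner_Integration.integral_cong refl pt)
  also have "\<dots> = (\<integral>\<gamma>. (cmod (F \<gamma> - C \<gamma>))\<^sup>2 \<partial>lborel) + (\<integral>\<gamma>. 2 * Re (F \<gamma> * cnj (C \<gamma>)) \<partial>lborel) - (\<integral>\<gamma>. (cmod (C \<gamma>))\<^sup>2 \<partial>lborel)"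
  proof -
    have FC': "integrable lborel (\<lambda>\<gamma>. 2 * Re (F \<gamma> * cnj (C \<gamma>)))" by (intro integrable_mult_right integrable_Re FC)
    show ?thesis
      by (simp only: Bochner_Integration.integral_diff[OF Bochner_Integration.integrable_add[OF FC2 FC'] C2]
          Bochner_Integration.integral_add[OF FC2 FC'])
  qed
  also have "\<dots> = (\<integral>\<gamma>. (cmod (F \<gamma> - C \<gamma>))\<^sup>2 \<partial>lborel) + 2 * Re (\<integral>\<gamma>. F \<gamma> * cnj (C \<gamma>) \<partial>lborel) - (\<integral>\<gamma>. (cmod (C \<gamma>))\<^sup>2 \<partial>lborel)"
    using FC by (simp only: integral_mult_right_zero integral_Re)
  also have "\<dots> \<le> ?nf + e"
    using C(4) lim unfolding CC by linarith
  finally show "(\<integral>\<gamma>. (cmod (F \<gamma>))\<^sup>2 \<partial>lborel) \<le> ?nf + e" .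
qed

section \<open>Bernstein's inequality with polynomial growth\<close>

lemma inv_fourier_lipschitz:
  fixes H :: "'a::euclidean_space \<Rightarrow> complex"
  assumes H: "H \<in> L2_on (cball 0 r)" and "r \<ge> 0"
  shows "cmod (inv_fourier H x - inv_fourier H 0) \<le> 2 * pi * r * norm x * (\<integral>\<gamma>. cmod (H \<gamma>) \<partial>lborel)"
proof -
  have Hi: "integrable lborel H" using H bounded_cball by (rule L2_on_integrable)
  have Hw: "integrable lborel (\<lambda>\<gamma>. H \<gamma> * wave x \<gamma>)" using Hi by (intro integrable_mult_wave) auto
  have "inv_fourier H x - inv_fourier H 0 = (\<integral>\<gamma>. H \<gamma> * wave x \<gamma> - H \<gamma> \<partial>lborel)"
    unfolding inv_fourier_wave using Hi Hw by (simp add: Bochner_Integration.integral_diff)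
  also have "cmod \<dots> \<le> (\<integral>\<gamma>. cmod (H \<gamma> * wave x \<gamma> - H \<gamma>) \<partial>lborel)" by (rule integral_norm_bound)
  also have "\<dots> \<le> (\<integral>\<gamma>. 2 * pi * r * norm x * cmod (H \<gamma>) \<partial>lborel)"
  proof (rule integral_mono)
    show "integrable lborel (\<lambda>\<gamma>. cmod (H \<gamma> * wave x \<gamma> - H \<gamma>))"
      by (intro integrable_norm Bochner_Integration.integrable_diff Hw Hi)
    show "integrable lborel (\<lambda>\<gamma>. 2 * pi * r * norm x * cmod (H \<gamma>))"
      by (intro integrable_mult_right integrable_norm Hi)
    fix \<gamma>
    have "cmod (H \<gamma> * wave x \<gamma> - H \<gamma>) = cmod (H \<gamma>) * cmod (wave x \<gamma> - 1)"
      by (simp add: right_diff_distrib flip: norm_mult)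
    also have "\<dots> \<le> cmod (H \<gamma>) * (2 * pi * r * norm x)"
    proof (cases "norm \<gamma> \<le> r")
      case True
      have "cmod (wave x \<gamma> - 1) \<le> 2 * pi * norm x * norm \<gamma>" by (rule norm_wave_minus_one_le)
      also have "\<dots> \<le> 2 * pi * norm x * r" using True by (intro mult_left_mono) auto
      finally show ?thesis by (intro mult_left_mono) (auto simp: mult_ac)
    next
      case False
      then have "H \<gamma> = 0" using L2_onD(3)[OF H] by simp
      then show ?thesis by simp
    qed
    finally show "cmod (H \<gamma> * wave x \<gamma> - H \<gamma>) \<le> 2 * pi * r * norm x * cmod (H \<gamma>)" by (simp add: mult_ac)
  qed
  also have "\<dots> = 2 * pi * r * norm x * (\<integral>\<gamma>. cmod (H \<gamma>) \<partial>lborel)" by simp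
  finally show ?thesis .
qed

text \<open>Young's inequality \<open>t \<le> A/2 + t^2/(2 A)\<close> on the ball. The free
  parameter \<open>A\<close> avoids square roots and is chosen at the point of use to balance the
  two terms.\<close>

lemma L1_le_L2_on:
  fixes H :: "'a::euclidean_space \<Rightarrow> complex"
  assumes H: "H \<in> L2_on (cball 0 r)" and A: "A > 0"
  shows "(\<integral>\<gamma>. cmod (H \<gamma>) \<partial>lborel) \<le> (A * measure lborel (cball (0::'a) r) + (\<integral>\<gamma>. (cmod (H \<gamma>))\<^sup>2 \<partial>lborel) / A) / 2"
proof -
  have Hi: "integrable lborel H" using H bounded_cball by (rule L2_on_integrable)
  have i1: "integrable lborel (\<lambda>\<gamma>. A / 2 * indicator (cball (0::'a) r) \<gamma>)"
    using emeasure_lborel_cball_finite[of "0::'a" r]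
    by (intro integrable_mult_right integrable_real_indicator) auto
  have i2: "integrable lborel (\<lambda>\<gamma>. (1 / (2 * A)) * (cmod (H \<gamma>))\<^sup>2)"
    by (intro integrable_mult_right L2_onD(2)[OF H])
  have "(\<integral>\<gamma>. cmod (H \<gamma>) \<partial>lborel) \<le> (\<integral>\<gamma>. A / 2 * indicator (cball (0::'a) r) \<gamma> + (1 / (2 * A)) * (cmod (H \<gamma>))\<^sup>2 \<partial>lborel)"
  proof (rule integral_mono)
    show "integrable lborel (\<lambda>\<gamma>. cmod (H \<gamma>))" using Hi by simp
    show "integrable lborel (\<lambda>\<gamma>. A / 2 * indicator (cball (0::'a) r) \<gamma> + (1 / (2 * A)) * (cmod (H \<gamma>))\<^sup>2)"
      by (intro Bochner_Integration.integrable_add i1 i2)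
    fix \<gamma> :: 'a
    show "cmod (H \<gamma>) \<le> A / 2 * indicator (cball (0::'a) r) \<gamma> + (1 / (2 * A)) * (cmod (H \<gamma>))\<^sup>2"
    proof (cases "\<gamma> \<in> cball 0 r")
      case True
      have "0 \<le> (A - cmod (H \<gamma>))\<^sup>2 / (2 * A)" using A by simp
      also have "\<dots> = A / 2 + (1 / (2 * A)) * (cmod (H \<gamma>))\<^sup>2 - cmod (H \<gamma>)"
        using A by (simp add: power2_eq_square field_simps)
      finally show ?thesis using True by simp
    next
      case False
      then show ?thesis using L2_onD(3)[OF H False] by simp
    qed
  qed
  also have "\<dots> = A / 2 * measure lborel (cball (0::'a) r) + (1 / (2 * A)) * (\<integral>\<gamma>. (cmod (H \<gamma>))\<^sup>2 \<partial>lborel)"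
    using i1 i2 by (subst Bochner_Integration.integral_add) auto
  also have "\<dots> = (A * measure lborel (cball (0::'a) r) + (\<integral>\<gamma>. (cmod (H \<gamma>))\<^sup>2 \<partial>lborel) / A) / 2"
    by (simp add: add_divide_distrib)
  finally show ?thesis .
qed

text \<open>Split \<open>f = f \<theta> + f (1 - \<theta>)\<close>. A kernel of order
  \<open>2 d\<close> against growth of order \<open>d\<close> puts \<open>f \<theta>\<close> into
  \<open>L^2\<close>; then its spectral function is bounded in \<open>L^2\<close>, hence in
  \<open>L^1\<close> on a ball, so \<open>f \<theta>\<close> is Lipschitz. The other part is small
  near 0 because \<open>\<theta>\<close> is Lipschitz with \<open>\<theta> 0 = 1\<close>.\<close>

lemma bernstein_at_origin:
  fixes S :: "'a::euclidean_space set"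
  assumes S: "S \<subseteq> cball 0 R" and R: "R \<ge> 0"
  obtains L where "L > 0" "\<And>F M x. F \<in> L2_on S \<Longrightarrow> M > 0 \<Longrightarrow> (\<And>z. cmod (inv_fourier F z) \<le> M * (1 + norm z) ^ DIM('a)) \<Longrightarrow>
      cmod (inv_fourier F x - inv_fourier F 0) \<le> M * L * (1 + norm x) ^ DIM('a) * norm x"
proof -
  let ?D = "DIM('a)"
  have D2: "2 * ?D \<ge> 1" using DIM_positive[where 'a='a] by linarith
  obtain \<theta> :: "'a \<Rightarrow> complex" and C where C: "C > 0" and \<theta>: "\<theta> 0 = 1" "\<And>x. cmod (\<theta> x) \<le> 1"
    "\<And>x. cmod (\<theta> x - 1) \<le> C * norm x" "\<And>x. cmod (\<theta> x) * (1 + norm x) ^ (2 * ?D) \<le> C"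
    and mul: "\<And>s F S. s > 0 \<Longrightarrow> F \<in> L2_on S \<Longrightarrow> bounded S \<Longrightarrow>
       \<exists>H\<in>L2_on {u + v |u v. u \<in> S \<and> norm v \<le> s * 1}. \<forall>x. inv_fourier H x = inv_fourier F x * \<theta> (s *\<^sub>R x)"
    by (rule kernel_exists[of 1 "2 * ?D", OF zero_less_one D2], rule that)
  have bS: "bounded S" using S bounded_cball bounded_subset by blast
  define W where "W = (\<integral>x. 1 / (1 + 1 * norm (x::'a)) ^ (2 * ?D) \<partial>lborel)"
  note Wint = integrable_inverse_power_norm[where 'a='a, OF zero_less_one]
  have W0: "W \<ge> 0" unfolding W_def by (intro integral_nonneg_AE AE_I2) simp
  define V where "V = measure lborel (cball (0::'a) (R + 1))"
  have V0: "V \<ge> 0" by (simp add: V_def)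
  \<comment> \<open>The first summand is the Lipschitz constant of \<open>f \<theta>\<close>, the
    second that of \<open>\<theta>\<close>; the factor \<open>M\<close> is split off.\<close>
  define L where "L = 2 * pi * (R + 1) * (C * (V + W)) + C"
  show ?thesis
  proof (rule that[of L])
    show "L > 0" using C W0 V0 R by (simp add: L_def add_nonneg_pos)
    fix F :: "'a \<Rightarrow> complex" and M :: real and x :: 'a
    assume F: "F \<in> L2_on S" and M: "M > 0" and gr: "\<And>z. cmod (inv_fourier F z) \<le> M * (1 + norm z) ^ ?D"
    let ?f = "inv_fourier F"
    obtain H where H: "H \<in> L2_on {u + v |u v. u \<in> S \<and> norm v \<le> 1 * 1}" "\<And>x. inv_fourier H x = ?f x * \<theta> x"
      using mul[OF zero_less_one F bS] by auto
    have "{u + v |u v. u \<in> S \<and> norm v \<le> 1 * 1} \<subseteq> cball 0 (R + 1)"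
      using S by (fastforce intro: norm_triangle_le add_mono)
    from L2_on_mono[OF H(1) this] have H': "H \<in> L2_on (cball 0 (R + 1))" .
    have [measurable]: "H \<in> borel_measurable borel" using H' by (rule L2_onD)
    have qm [measurable]: "inv_fourier H \<in> borel_measurable borel" by measurable
    have qb: "(cmod (inv_fourier H z))\<^sup>2 \<le> (M * C)\<^sup>2 * (1 / (1 + 1 * norm z) ^ (2 * ?D))" for z
    proof -
      let ?n = "(1 + norm z) ^ ?D"
      have n: "?n > 0" by (simp add: add_pos_nonneg)
      have th: "cmod (\<theta> z) \<le> C / (?n * ?n)"
        using \<theta>(4)[of z] n by (simp add: pos_le_divide_eq mult_2 power_add)
      have "cmod (inv_fourier H z) \<le> (M * ?n) * (C / (?n * ?n))"
        unfolding H(2) norm_mult using M n by (intro mult_mono gr th) auto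
      also have "\<dots> = M * C / ?n" using n by simp
      finally have "(cmod (inv_fourier H z))\<^sup>2 \<le> (M * C / ?n)\<^sup>2" by (intro power_mono) auto
      also have "\<dots> = (M * C)\<^sup>2 * (1 / (1 + 1 * norm z) ^ (2 * ?D))"
        by (simp add: power_divide power_mult[symmetric] mult.commute)
      finally show ?thesis .
    qed
    have q2: "integrable lborel (\<lambda>z. (cmod (inv_fourier H z))\<^sup>2)"
      by (rule Bochner_Integration.integrable_bound[OF integrable_mult_right[OF Wint, of "(M * C)\<^sup>2"]])
         (use qb in \<open>auto intro!: AE_I2 order_trans[OF _ abs_ge_self]\<close>)
    have "(\<integral>\<gamma>. (cmod (H \<gamma>))\<^sup>2 \<partial>lborel) \<le> (\<integral>z. (cmod (inv_fourier H z))\<^sup>2 \<partial>lborel)"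
      by (rule norm_le_norm_inv_fourier[OF H' bounded_cball q2])
    also have "\<dots> \<le> (\<integral>z. (M * C)\<^sup>2 * (1 / (1 + 1 * norm (z::'a)) ^ (2 * ?D)) \<partial>lborel)"
      by (intro integral_mono q2 integrable_mult_right Wint qb)
    also have "\<dots> = (M * C)\<^sup>2 * W" unfolding W_def by (rule integral_mult_right_zero)
    finally have H2: "(\<integral>\<gamma>. (cmod (H \<gamma>))\<^sup>2 \<partial>lborel) / (M * C) \<le> M * C * W"
      using M C by (simp add: divide_le_eq power2_eq_square mult_ac)
    \<comment> \<open>The choice \<open>A = M * C\<close> balances the terms, as the square integral
      is at most \<open>(M * C)^2 * W\<close>; the result is linear in \<open>M\<close>.\<close>
    have "(\<integral>\<gamma>. cmod (H \<gamma>) \<partial>lborel) \<le> (M * C * V + (\<integral>\<gamma>. (cmod (H \<gamma>))\<^sup>2 \<partial>lborel) / (M * C)) / 2"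
      using L1_le_L2_on[OF H', of "M * C"] M C by (simp add: V_def)
    also have "\<dots> \<le> M * (C * (V + W))"
    proof -
      have "0 \<le> M * C * V" "0 \<le> M * C * W" using M C V0 W0 by auto
      then show ?thesis using H2 by (simp add: algebra_simps)
    qed
    finally have H1: "(\<integral>\<gamma>. cmod (H \<gamma>) \<partial>lborel) \<le> M * (C * (V + W))" .
    have "cmod (inv_fourier H x - inv_fourier H 0) \<le> 2 * pi * (R + 1) * norm x * (\<integral>\<gamma>. cmod (H \<gamma>) \<partial>lborel)"
      by (rule inv_fourier_lipschitz[OF H']) (use R in simp)
    also have "\<dots> \<le> 2 * pi * (R + 1) * norm x * (M * (C * (V + W)))"
      using R by (intro mult_left_mono H1) auto
    also have "\<dots> \<le> 2 * pi * (R + 1) * norm x * (M * (C * (V + W))) * (1 + norm x) ^ ?D"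
    proof -
      have "1 \<le> (1 + norm x) ^ ?D" by (rule one_le_power) simp
      moreover have "0 \<le> 2 * pi * (R + 1) * norm x * (M * (C * (V + W)))" using R M C V0 W0 by simp
      ultimately show ?thesis by (metis mult_left_mono mult.right_neutral)
    qed
    finally have 1: "cmod (inv_fourier H x - inv_fourier H 0) \<le> 2 * pi * (R + 1) * norm x * (M * (C * (V + W))) * (1 + norm x) ^ ?D" .
    have "cmod (?f x * (1 - \<theta> x)) \<le> (M * (1 + norm x) ^ ?D) * (C * norm x)"
      unfolding norm_mult using M \<theta>(3)[of x] by (intro mult_mono gr) (auto simp: norm_minus_commute)
    moreover have "?f x - ?f 0 = (inv_fourier H x - inv_fourier H 0) + ?f x * (1 - \<theta> x)"
      by (simp add: H(2) \<theta>(1) algebra_simps)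
    ultimately have "cmod (?f x - ?f 0) \<le> 2 * pi * (R + 1) * norm x * (M * (C * (V + W))) * (1 + norm x) ^ ?D + (M * (1 + norm x) ^ ?D) * (C * norm x)"
      using order_trans[OF norm_triangle_ineq[of "inv_fourier H x - inv_fourier H 0" "?f x * (1 - \<theta> x)"] add_mono[OF 1]]
      by (simp only:)
    also have "\<dots> = M * L * (1 + norm x) ^ ?D * norm x"
      by (simp add: L_def algebra_simps)
    finally show "cmod (?f x - ?f 0) \<le> M * L * (1 + norm x) ^ ?D * norm x" .
  qed
qed

text \<open>Modulating \<open>F\<close> by \<open>wave x\<close> moves \<open>x\<close> to the
  origin. Since \<open>1 + norm (x + z) \<le> (1 + norm x) * (1 + norm z)\<close>, the growth
  constant only acquires the factor \<open>(1 + norm x)^d\<close>.\<close>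

lemma bernstein:
  fixes S :: "'a::euclidean_space set"
  assumes "bounded S"
  obtains L where "L > 0" "\<And>F M x y. F \<in> L2_on S \<Longrightarrow> M > 0 \<Longrightarrow> (\<And>z. cmod (inv_fourier F z) \<le> M * (1 + norm z) ^ DIM('a)) \<Longrightarrow>
      cmod (inv_fourier F (x + y) - inv_fourier F x) \<le> M * L * (1 + norm x) ^ DIM('a) * (1 + norm y) ^ DIM('a) * norm y"
proof -
  obtain a where a: "S \<subseteq> cball 0 a" using assms bounded_subset_ballD[of S 0] ball_subset_cball by blast
  then have S: "S \<subseteq> cball 0 (max a 0)" by auto
  obtain L where L: "L > 0" "\<And>F M x. F \<in> L2_on S \<Longrightarrow> M > 0 \<Longrightarrow> (\<And>z. cmod (inv_fourier F z) \<le> M * (1 + norm z) ^ DIM('a)) \<Longrightarrow>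
      cmod (inv_fourier F x - inv_fourier F 0) \<le> M * L * (1 + norm x) ^ DIM('a) * norm x"
    using bernstein_at_origin[OF S] by (metis max.cobounded2)
  show ?thesis
  proof (rule that[OF L(1)])
    fix F :: "'a \<Rightarrow> complex" and M :: real and x y :: 'a
    assume F: "F \<in> L2_on S" and M: "M > 0" and gr: "\<And>z. cmod (inv_fourier F z) \<le> M * (1 + norm z) ^ DIM('a)"
    have "cmod (inv_fourier (\<lambda>\<gamma>. F \<gamma> * wave x \<gamma>) y - inv_fourier (\<lambda>\<gamma>. F \<gamma> * wave x \<gamma>) 0)
        \<le> (M * (1 + norm x) ^ DIM('a)) * L * (1 + norm y) ^ DIM('a) * norm y"
    proof (rule L(2)[OF L2_on_modulate[OF F]])
      show "M * (1 + norm x) ^ DIM('a) > 0" using M by (simp add: add_pos_nonneg)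
      fix z
      have "cmod (inv_fourier (\<lambda>\<gamma>. F \<gamma> * wave x \<gamma>) z) \<le> M * (1 + norm (x + z)) ^ DIM('a)"
        unfolding inv_fourier_modulate by (rule gr)
      also have "\<dots> \<le> M * ((1 + norm x) * (1 + norm z)) ^ DIM('a)"
      proof (intro mult_left_mono power_mono)
        have "0 \<le> norm x * norm z" by simp
        then show "1 + norm (x + z) \<le> (1 + norm x) * (1 + norm z)"
          using norm_triangle_ineq[of x z] unfolding ring_distribs by linarith
      qed (use M in auto)
      finally show "cmod (inv_fourier (\<lambda>\<gamma>. F \<gamma> * wave x \<gamma>) z) \<le> M * (1 + norm x) ^ DIM('a) * (1 + norm z) ^ DIM('a)"
        by (simp add: power_mult_distrib mult_ac)
    qed
    then show "cmod (inv_fourier F (x + y) - inv_fourier F x) \<le> M * L * (1 + norm x) ^ DIM('a) * (1 + norm y) ^ DIM('a) * norm y"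
      by (simp add: inv_fourier_modulate mult_ac)
  qed
qed

section \<open>From balayage to sampling inequalities\<close>

text \<open>The multiplication formula turns the integral of \<open>f\<close> into a pairing of
  \<open>F\<close> with the transform of the measure at \<open>- \<gamma>\<close>; the symmetry of
  \<open>\<Lambda>\<close> brings this point back to where the transforms agree.\<close>

lemma fourier_meas_eq_imp_integral_eq:
  fixes F :: "'a::euclidean_space \<Rightarrow> complex"
  assumes F: "F \<in> L2_on \<Lambda>" and \<Lambda>: "bounded \<Lambda>" "\<forall>\<gamma>\<in>\<Lambda>. - \<gamma> \<in> \<Lambda>"
    and M: "cmeasure_in M h X" and N: "cmeasure_in N g Y"
    and eq: "\<forall>\<gamma>\<in>\<Lambda>. fourier_meas M h \<gamma> = fourier_meas N g \<gamma>"
  shows "(\<integral>x. inv_fourier F x * h x \<partial>M) = (\<integral>x. inv_fourier F x * g x \<partial>N)"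
proof -
  have Fi: "integrable lborel F" using F \<Lambda>(1) by (rule L2_on_integrable)
  have gen: "(\<integral>x. inv_fourier F x * h x \<partial>M) = (\<integral>\<gamma>. F \<gamma> * fourier_meas M h (- \<gamma>) \<partial>lborel)"
    if "cmeasure_in M h X" for M :: "'a measure" and h X
  proof -
    interpret finite_measure M using that by (simp add: cmeasure_in_def)
    have "sigma_finite_measure M" by unfold_locales
    then show ?thesis
      using that Fi by (subst integral_inv_fourier_mult) (auto simp: cmeasure_in_def fourier_meas_wave)
  qed
  have "F \<gamma> * fourier_meas M h (- \<gamma>) = F \<gamma> * fourier_meas N g (- \<gamma>)" for \<gamma>
    using eq \<Lambda>(2) L2_onD(3)[OF F, of \<gamma>] by (cases "\<gamma> \<in> \<Lambda>") auto
  then show ?thesis unfolding gen[OF M] gen[OF N] by (simp only:)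
qed

lemma norm_integral_le_on_support:
  fixes u g :: "'a::euclidean_space \<Rightarrow> complex"
  assumes N: "cmeasure_in N g E" and "closed E" and u: "u \<in> borel_measurable borel"
    and le: "\<And>x. x \<in> E \<Longrightarrow> cmod (u x) \<le> c" and "c \<ge> 0"
  shows "cmod (\<integral>x. u x * g x \<partial>N) \<le> c * (\<integral>x. cmod (g x) \<partial>N)"
proof -
  have sN: "sets N = sets borel" and gi: "integrable N g" and null: "emeasure N (UNIV - E) = 0"
    using N by (auto simp: cmeasure_in_def)
  have "cmod (\<integral>x. u x * g x \<partial>N) \<le> (\<integral>x. cmod (u x * g x) \<partial>N)" by (rule integral_norm_bound)
  also have "\<dots> \<le> (\<integral>x. c * cmod (g x) \<partial>N)"
  proof (rule integral_mono_AE')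
    show "integrable N (\<lambda>x. c * cmod (g x))" using gi by simp
    have "UNIV - E \<in> null_sets N" using null \<open>closed E\<close> by (auto simp: null_sets_def sN)
    then have "AE x in N. x \<notin> UNIV - E" by (rule AE_not_in)
    then show "AE x in N. cmod (u x * g x) \<le> c * cmod (g x)"
      by eventually_elim (auto simp: norm_mult intro!: mult_right_mono le)
  qed (use \<open>c \<ge> 0\<close> in auto)
  also have "\<dots> = c * (\<integral>x. cmod (g x) \<partial>N)" by simp
  finally show ?thesis .
qed

text \<open>A series of point masses, built as the image under \<open>y\<close> of a weighted
  counting measure, so that repeated points \<open>y i\<close> do no harm.\<close>

lemma discrete_measure_exists:
  fixes y :: "nat \<Rightarrow> 'a::euclidean_space" and w :: "nat \<Rightarrow> real"
  assumes w: "\<And>i. 0 \<le> w i" "summable w"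
  obtains M where "cmeasure_in M (\<lambda>_. 1) UNIV"
    "\<And>(u :: 'a \<Rightarrow> complex) B. u \<in> borel_measurable borel \<Longrightarrow> (\<And>x. cmod (u x) \<le> B) \<Longrightarrow> (\<integral>x. u x \<partial>M) = (\<Sum>i. w i * u (y i))"
proof -
  define N0 where "N0 = density (count_space UNIV) (\<lambda>i. ennreal (w i))"
  define M where "M = distr N0 borel y"
  have [measurable]: "y \<in> N0 \<rightarrow>\<^sub>M borel" by (simp add: N0_def measurable_def)
  have "emeasure N0 (space N0) = (\<Sum>i. ennreal (w i))"
    by (simp add: N0_def emeasure_density nn_integral_count_space_nat)
  also have "\<dots> < \<infinity>" using w by (simp add: suminf_ennreal2)
  finally have "emeasure N0 (space N0) \<noteq> \<infinity>" by simp
  then have "finite_measure N0" by (rule finite_measureI)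
  then have fM: "finite_measure M" unfolding M_def by (rule finite_measure.finite_measure_distr) measurable
  interpret finite_measure M by fact
  have "integrable M (\<lambda>_. 1 :: complex)" by simp
  moreover have "sets M = sets borel" by (simp add: M_def)
  ultimately have cm: "cmeasure_in M (\<lambda>_. 1) UNIV" using fM by (simp add: cmeasure_in_def)
  have int: "(\<integral>x. u x \<partial>M) = (\<Sum>i. w i * u (y i))"
    if u: "u \<in> borel_measurable borel" and B: "\<And>x. cmod (u x) \<le> B" for u :: "'a \<Rightarrow> complex" and B
  proof -
    note [measurable] = u
    have "summable (\<lambda>i. norm (w i *\<^sub>R u (y i)))"
    proof (rule summable_comparison_test)
      show "summable (\<lambda>i. w i * B)" using w(2) by (rule summable_mult2)
      show "\<exists>N. \<forall>n\<ge>N. norm (norm (w n *\<^sub>R u (y n))) \<le> w n * B"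
        using w(1) B by (auto intro!: mult_left_mono)
    qed
    then have "integrable (count_space UNIV) (\<lambda>i. w i *\<^sub>R u (y i))"
      by (simp only: integrable_count_space_nat_iff)
    then have "(\<integral>i. w i *\<^sub>R u (y i) \<partial>count_space UNIV) = (\<Sum>i. w i *\<^sub>R u (y i))"
      by (rule integral_count_space_nat)
    moreover have "(\<integral>x. u x \<partial>M) = (\<integral>i. u (y i) \<partial>N0)"
      unfolding M_def by (rule integral_distr) auto
    moreover have "\<dots> = (\<integral>i. w i *\<^sub>R u (y i) \<partial>count_space UNIV)"
      unfolding N0_def by (rule integral_density) (auto simp: w)
    ultimately show ?thesis by (simp add: scaleR_conv_of_real)
  qed
  show ?thesis by (rule that[OF cm int])
qed

text \<open>Uniform boundedness by a gliding hump: each weight is switched on or off so that the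
  contributions chosen so far do not cancel the new one.\<close>

lemma balayage_imp_sampling:
  fixes E \<Lambda> :: "'a::euclidean_space set"
  assumes "closed E" and \<Lambda>: "bounded \<Lambda>" "\<forall>\<gamma>\<in>\<Lambda>. - \<gamma> \<in> \<Lambda>" and bal: "balayage E \<Lambda>"
  shows "\<exists>K>0. \<forall>F\<in>L2_on \<Lambda>. \<forall>M\<ge>0. (\<forall>x\<in>E. cmod (inv_fourier F x) \<le> M) \<longrightarrow> (\<forall>y. cmod (inv_fourier F y) \<le> K * M)"
proof (rule ccontr)
  assume neg: "\<not> ?thesis"
  \<comment> \<open>Failure of the constant \<open>8 ^ k\<close> gives a function that is tiny on
    \<open>E\<close> relative to its supremum. It is divided by that supremum, and \<open>y\<close>
    is a point where the supremum is nearly attained.\<close>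
  have "\<exists>F y. F \<in> L2_on \<Lambda> \<and> (\<forall>x. cmod (inv_fourier F x) \<le> 1) \<and> (\<forall>x\<in>E. cmod (inv_fourier F x) \<le> (1/8) ^ k)
     \<and> cmod (inv_fourier F y) \<ge> 9/10" for k :: nat
  proof -
    have "\<not> (\<forall>F\<in>L2_on \<Lambda>. \<forall>M\<ge>0. (\<forall>x\<in>E. cmod (inv_fourier F x) \<le> M) \<longrightarrow> (\<forall>y. cmod (inv_fourier F y) \<le> 8 ^ k * M))"
      using neg by (metis zero_less_numeral zero_less_power)
    then obtain F M y where F: "F \<in> L2_on \<Lambda>" and M: "M \<ge> 0" "\<And>x. x \<in> E \<Longrightarrow> cmod (inv_fourier F x) \<le> M"
      and y: "cmod (inv_fourier F y) > 8 ^ k * M"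
      by (auto simp: not_le)
    define S where "S = (SUP x. cmod (inv_fourier F x))"
    have bdd: "bdd_above (range (\<lambda>x. cmod (inv_fourier F x)))"
      using norm_inv_fourier_le[OF L2_on_integrable[OF F \<Lambda>(1)]] by (auto intro!: bdd_aboveI)
    have leS: "cmod (inv_fourier F x) \<le> S" for x unfolding S_def using bdd by (intro cSUP_upper) auto
    have S: "S > 0" using leS[of y] y M(1) by (smt (verit) mult_nonneg_nonneg zero_le_power)
    have "9/10 * S < S" using S by simp
    then obtain y' where y': "9/10 * S < cmod (inv_fourier F y')"
      using less_cSUP_iff[OF UNIV_not_empty bdd, of "9/10 * S"] unfolding S_def[symmetric] by blast
    have "8 ^ k * M < S" using y leS[of y] by linarith
    then have MS: "M \<le> (1/8) ^ k * S" by (simp add: power_divide field_simps)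
    show ?thesis
    proof (intro exI conjI allI ballI)
      show "(\<lambda>\<gamma>. complex_of_real (1 / S) * F \<gamma>) \<in> L2_on \<Lambda>" by (rule L2_on_scale[OF F])
      have n: "cmod (inv_fourier (\<lambda>\<gamma>. complex_of_real (1 / S) * F \<gamma>) x) = cmod (inv_fourier F x) / S" for x
        unfolding inv_fourier_scale using S by (simp add: norm_mult norm_divide)
      show "cmod (inv_fourier (\<lambda>\<gamma>. complex_of_real (1 / S) * F \<gamma>) x) \<le> 1" for x
        unfolding n using S leS by simp
      show "cmod (inv_fourier (\<lambda>\<gamma>. complex_of_real (1 / S) * F \<gamma>) x) \<le> (1/8) ^ k" if "x \<in> E" for x
        unfolding n using S MS M(2)[OF that] by (simp add: pos_divide_le_eq)
      show "cmod (inv_fourier (\<lambda>\<gamma>. complex_of_real (1 / S) * F \<gamma>) y') \<ge> 9/10"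
        unfolding n using S y' by (simp add: pos_le_divide_eq)
    qed
  qed
  then obtain F y where F: "\<And>k. F k \<in> L2_on \<Lambda>" and f1: "\<And>k x. cmod (inv_fourier (F k) x) \<le> 1"
    and fE: "\<And>k x. x \<in> E \<Longrightarrow> cmod (inv_fourier (F k) x) \<le> (1/8) ^ k"
    and fy: "\<And>k. cmod (inv_fourier (F k) (y k)) \<ge> 9/10"
    by metis
  define f where "f k = inv_fourier (F k)" for k :: nat
  \<comment> \<open>\<open>r\<close> is the switch of the \<open>k\<close>-th mass, tested against
    \<open>f k\<close>. The earlier masses contribute a fixed number \<open>a\<close> and the new
    one \<open>0\<close> or \<open>b\<close> with \<open>|b| \<ge> 9/10 * (1/4)^k\<close>; as
    \<open>b\<close> is the difference of \<open>a + b\<close> and \<open>a\<close>, one of them has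
    modulus at least half of this bound.\<close>
  define P where "P \<sigma> k r \<longleftrightarrow> (r = 0 \<or> r = 1) \<and>
      9/20 * (1/4) ^ k \<le> cmod ((\<Sum>i<k. \<sigma> i * (1/4) ^ i * f k (y i)) + r * (1/4) ^ k * f k (y k))"
    for \<sigma> :: "nat \<Rightarrow> real" and k :: nat and r :: real
  have "\<exists>\<sigma>. \<forall>k. P \<sigma> k (\<sigma> k)"
  proof (rule dependent_wellorder_choice)
    show "P g k r = P h k r" if "\<And>i. i < k \<Longrightarrow> g i = h i" for g h k r
      using that by (simp add: P_def)
    fix k \<sigma>
    define a where "a = (\<Sum>i<k. complex_of_real (\<sigma> i) * (1/4) ^ i * f k (y i))"
    define b where "b = complex_of_real ((1/4) ^ k) * f k (y k)"
    have b: "cmod b \<ge> 9/10 * (1/4) ^ k"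
      unfolding b_def norm_mult using mult_left_mono[OF fy[of k], of "(1/4) ^ k"] by (simp add: f_def mult.commute norm_power norm_divide)
    have "9/20 * (1/4) ^ k \<le> cmod a \<or> 9/20 * (1/4) ^ k \<le> cmod (a + b)"
    proof (rule ccontr)
      assume "\<not> ?thesis"
      then show False using b norm_triangle_ineq4[of "a + b" a] by simp
    qed
    then have "P \<sigma> k 0 \<or> P \<sigma> k 1" unfolding P_def a_def b_def by simp
    then show "\<exists>r. P \<sigma> k r" by auto
  qed
  then obtain \<sigma> where \<sigma>: "\<And>k. P \<sigma> k (\<sigma> k)" by blast
  define w where "w i = \<sigma> i * (1/4) ^ i" for i
  have w: "0 \<le> w i" "w i \<le> (1/4) ^ i" for i using \<sigma>[of i] by (auto simp: w_def P_def)
  have geo: "summable (\<lambda>i. (1/4) ^ i :: real)" by (rule summable_geometric) simp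
  have "summable w" by (rule summable_comparison_test'[OF geo, of 0]) (use w in auto)
  from discrete_measure_exists[OF w(1) this, of y] obtain M where M: "cmeasure_in M (\<lambda>_. 1) UNIV"
    and int: "\<And>(u :: 'a \<Rightarrow> complex) B. u \<in> borel_measurable borel \<Longrightarrow> (\<And>x. cmod (u x) \<le> B) \<Longrightarrow> (\<integral>x. u x \<partial>M) = (\<Sum>i. w i * u (y i))"
    by metis
  obtain N g where N: "cmeasure_in N g E" "\<forall>\<gamma>\<in>\<Lambda>. fourier_meas M (\<lambda>_. 1) \<gamma> = fourier_meas N g \<gamma>"
    using bal M unfolding balayage_def by blast
  define I where "I = (\<integral>x. cmod (g x) \<partial>N)"
  have bound: "1/10 * (1/4) ^ k \<le> (1/8) ^ k * I" for k
  proof -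
    have fm: "f k \<in> borel_measurable borel"
      unfolding f_def using L2_onD(1)[OF F[of k]] by (intro inv_fourier_measurable) simp
    define t where "t i = w i * f k (y i)" for i
    have tle: "cmod (t i) \<le> (1/4) ^ i" for i
    proof -
      have "cmod (t i) = w i * cmod (f k (y i))" using w(1)[of i] by (simp add: t_def norm_mult)
      also have "\<dots> \<le> (1/4) ^ i * 1" using w f1 by (intro mult_mono) (auto simp: f_def)
      finally show ?thesis by simp
    qed
    have sumt: "summable t" by (rule summable_comparison_test'[OF geo, of 0]) (use tle in auto)
    have "(\<Sum>i. t i) = (\<integral>x. f k x * 1 \<partial>M)"
      using int[OF fm, of 1] f1 by (simp add: t_def f_def)
    also have "\<dots> = (\<integral>x. f k x * g x \<partial>N)"
      unfolding f_def by (rule fourier_meas_eq_imp_integral_eq[OF F \<Lambda> M N])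
    also have "cmod \<dots> \<le> (1/8) ^ k * I"
      unfolding I_def using fE by (intro norm_integral_le_on_support[OF N(1) \<open>closed E\<close> fm]) (auto simp: f_def)
    finally have upper: "cmod (\<Sum>i. t i) \<le> (1/8) ^ k * I" .
    have head: "9/20 * (1/4) ^ k \<le> cmod (\<Sum>i<Suc k. t i)"
      using \<sigma>[of k] by (simp add: P_def t_def w_def)
    have geo': "summable (\<lambda>i. (1/4) ^ (i + Suc k) :: real)" using geo by (rule summable_ignore_initial_segment)
    \<comment> \<open>Whatever the later switches are, they remove at most a third of
      \<open>(1/4)^k\<close>, and \<open>9/20 - 1/3 \<ge> 1/10\<close>.\<close>
    have "cmod (\<Sum>i. t (i + Suc k)) \<le> (\<Sum>i. (1/4) ^ (i + Suc k))"
      by (rule norm_suminf_le[OF tle geo'])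
    also have "\<dots> = (1/4) ^ k / 3"
      using suminf_mult2[OF geo, of "(1/4) ^ Suc k"] by (simp add: power_add suminf_geometric)
    finally have tail: "cmod (\<Sum>i. t (i + Suc k)) \<le> (1/4) ^ k / 3" .
    have "(\<Sum>i. t i) = (\<Sum>i. t (i + Suc k)) + (\<Sum>i<Suc k. t i)"
      by (rule suminf_split_initial_segment[OF sumt])
    then have "cmod (\<Sum>i<Suc k. t i) \<le> cmod (\<Sum>i. t i) + cmod (\<Sum>i. t (i + Suc k))"
      using norm_triangle_ineq4[of "\<Sum>i. t i" "\<Sum>i. t (i + Suc k)"] by simp
    then have "9/20 * (1/4) ^ k \<le> (1/8) ^ k * I + (1/4) ^ k / 3" using upper head tail by linarith
    moreover have "(1/4) ^ k > (0::real)" by simp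
    ultimately show ?thesis by linarith
  qed
  \<comment> \<open>The swept measure sees \<open>f k\<close> only on \<open>E\<close>, at size
    \<open>(1/8)^k\<close>, against the lower bound of order \<open>(1/4)^k\<close>. The ratio
    exceeds any fixed total mass \<open>I\<close>.\<close>
  have "2 ^ k \<le> 10 * I" for k :: nat
  proof -
    have "8 ^ k * (1/10 * (1/4) ^ k) \<le> 8 ^ k * ((1/8) ^ k * I)" by (intro mult_left_mono bound) simp
    moreover have "(8::real) ^ k * (1/4) ^ k = 2 ^ k" by (simp flip: power_mult_distrib)
    moreover have "(8::real) ^ k * (1/8) ^ k = 1" by (simp flip: power_mult_distrib)
    ultimately show ?thesis by (simp add: mult.assoc[symmetric] mult.commute[of _ "1/10"]) 
  qed
  moreover obtain k :: nat where "10 * I < 2 ^ k" using real_arch_pow[of 2 "10 * I"] by auto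
  ultimately show False by (meson not_le)
qed

text \<open>The open intervals between consecutive radii are disjoint, so \<open>t\<close> lies in
  at most one of them. Only that term needs the crude bound \<open>c\<close>; all others obey
  \<open>d\<close>.\<close>

lemma sum_norm_le_single_peak:
  fixes p :: "nat \<Rightarrow> complex" and \<rho> :: "nat \<Rightarrow> real"
  assumes "mono \<rho>" and peak: "\<And>k. k < N \<Longrightarrow> cmod (p k) \<le> c"
    and small: "\<And>k. k < N \<Longrightarrow> t \<le> \<rho> k \<or> \<rho> (Suc k) \<le> t \<Longrightarrow> cmod (p k) \<le> d"
    and "c \<ge> 0" "d \<ge> 0"
  shows "cmod (\<Sum>k<N. p k) \<le> c + real N * d"
proof -
  define J where "J = {k. k < N \<and> \<rho> k < t \<and> t < \<rho> (Suc k)}"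
  have fJ: "finite J" by (simp add: J_def)
  have "j = k" if "j \<in> J" "k \<in> J" for j k
  proof (rule ccontr)
    assume "j \<noteq> k"
    then have "Suc j \<le> k \<or> Suc k \<le> j" by linarith
    then have "\<rho> (Suc j) \<le> \<rho> k \<or> \<rho> (Suc k) \<le> \<rho> j" using \<open>mono \<rho>\<close> by (auto dest: monoD)
    with that show False by (auto simp: J_def)
  qed
  then have "card J \<le> Suc 0" using fJ by (simp add: card_le_Suc0_iff_eq)
  have "cmod (\<Sum>k<N. p k) \<le> (\<Sum>k<N. cmod (p k))" by (rule norm_sum)
  also have "\<dots> \<le> (\<Sum>k<N. (if k \<in> J then c else 0) + d)"
  proof (rule sum_mono)
    fix k assume "k \<in> {..<N}"
    then show "cmod (p k) \<le> (if k \<in> J then c else 0) + d"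
      using peak[of k] small[of k] \<open>d \<ge> 0\<close> by (auto simp: J_def not_less)
  qed
  also have "\<dots> = real (card J) * c + real N * d"
  proof -
    have "{..<N} \<inter> J = J" by (auto simp: J_def)
    then show ?thesis by (simp add: sum.distrib sum.If_cases)
  qed
  also have "\<dots> \<le> c + real N * d"
    using mult_right_mono[of "real (card J)" 1 c] \<open>card J \<le> Suc 0\<close> \<open>c \<ge> 0\<close> by simp
  finally show ?thesis .
qed

text \<open>The dilation \<open>f ((1 - s) x)\<close> makes room in the spectrum for the damping factor \<open>\<theta> (s x)\<close>.
  For a single \<open>s\<close> the damped function need not be small on \<open>E\<close> where \<open>norm x\<close> is comparable
  to \<open>1/s\<close>; averaging over widely separated values of \<open>s\<close> removes this obstacle, since each
  point is critical for at most one of them.\<close>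

lemma local_sampling:
  fixes \<Lambda> :: "'a::euclidean_space set"
  assumes \<Lambda>: "bounded \<Lambda>" "convex \<Lambda>" "cball 0 \<rho>0 \<subseteq> \<Lambda>" and "\<rho>0 > 0" and K: "K > 0"
  shows "\<exists>\<epsilon>>0. \<exists>\<eta>>0. \<exists>R>0. \<forall>E. \<forall>F\<in>L2_on \<Lambda>.
      (\<forall>G\<in>L2_on \<Lambda>. \<forall>M\<ge>0. (\<forall>x\<in>E. cmod (inv_fourier G x) \<le> M) \<longrightarrow> cmod (inv_fourier G 0) \<le> K * M) \<longrightarrow>
      inv_fourier F 0 \<noteq> 0 \<longrightarrow>
      (\<forall>z. cmod (inv_fourier F z) \<le> 2 * cmod (inv_fourier F 0) * (1 + \<epsilon> * norm z) ^ DIM('a)) \<longrightarrow>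
      (\<exists>x\<in>E. norm x \<le> R \<and> \<eta> * cmod (inv_fourier F 0) < cmod (inv_fourier F x))"
proof -
  let ?D = "DIM('a)"
  have D: "?D \<ge> 1" using DIM_positive[where 'a='a] by linarith
  then have D2: "2 * ?D \<ge> 1" by linarith
  obtain L where L: "L > 0" and bern: "\<And>F M x y. F \<in> L2_on \<Lambda> \<Longrightarrow> M > 0 \<Longrightarrow> (\<And>z. cmod (inv_fourier F z) \<le> M * (1 + norm z) ^ ?D) \<Longrightarrow>
      cmod (inv_fourier F (x + y) - inv_fourier F x) \<le> M * L * (1 + norm x) ^ ?D * (1 + norm y) ^ ?D * norm y"
    by (rule bernstein[OF \<Lambda>(1)], rule that, assumption) blast
  obtain \<theta> :: "'a \<Rightarrow> complex" and C where C: "C > 0" and \<theta>: "\<theta> 0 = 1" "\<And>x. cmod (\<theta> x) \<le> 1"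
    "\<And>x. cmod (\<theta> x - 1) \<le> C * norm x" "\<And>x. cmod (\<theta> x) * (1 + norm x) ^ (2 * ?D) \<le> C"
    and mul: "\<And>s F S. s > 0 \<Longrightarrow> F \<in> L2_on S \<Longrightarrow> bounded S \<Longrightarrow>
       \<exists>H\<in>L2_on {u + v |u v. u \<in> S \<and> norm v \<le> s * \<rho>0}. \<forall>x. inv_fourier H x = inv_fourier F x * \<theta> (s *\<^sub>R x)"
    by (rule kernel_exists[of \<rho>0 "2 * ?D", OF \<open>\<rho>0 > 0\<close> D2], rule that)
  \<comment> \<open>With this \<open>\<delta>\<close> the errors of the \<open>N\<close> scales
    amount, after the factor \<open>K\<close>, to \<open>N / 4\<close>. The one uncontrolled scale
    adds \<open>2 * C * K\<close>, below \<open>N / 4\<close> by the choice of \<open>N\<close>, so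
    the total cannot reach the value \<open>N\<close> at the origin (in units of
    \<open>|f 0|\<close>).\<close>
  define \<delta> where "\<delta> = 1 / (4 * K)"
  have \<delta>: "\<delta> > 0" using K by (simp add: \<delta>_def)
  obtain N :: nat where N: "8 * C * K < real N" using reals_Archimedean2 by blast
  then have N0: "N > 0" using C K by (metis mult_pos_pos not_less_iff_gr_or_eq of_nat_0 gr0I zero_less_numeral)
  \<comment> \<open>A scale so small that replacing \<open>x\<close> by \<open>(1 - s) x\<close> in
    the ball of radius \<open>\<rho>\<close> costs at most \<open>\<delta>/2 * |f 0|\<close> by
    Bernstein's inequality. The cap \<open>1/2\<close> keeps \<open>1 - s\<close> positive.\<close>
  define \<sigma> where "\<sigma> \<rho> = min (1/2) (\<delta> / (4 * L * (1 + \<rho>) ^ (2 * ?D + 1)))" for \<rho> :: real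
  have \<sigma>: "\<sigma> \<rho> > 0" "\<sigma> \<rho> \<le> 1/2" "2 * L * (1 + \<rho>) ^ (2 * ?D + 1) * \<sigma> \<rho> \<le> \<delta> / 2" if "\<rho> \<ge> 0" for \<rho>
  proof -
    have p: "(1 + \<rho>) ^ (2 * ?D + 1) > 0" using that by simp
    show "\<sigma> \<rho> > 0" "\<sigma> \<rho> \<le> 1/2" using p \<delta> L by (auto simp: \<sigma>_def)
    have "2 * L * (1 + \<rho>) ^ (2 * ?D + 1) * \<sigma> \<rho> \<le> 2 * L * (1 + \<rho>) ^ (2 * ?D + 1) * (\<delta> / (4 * L * (1 + \<rho>) ^ (2 * ?D + 1)))"
      using p L unfolding \<sigma>_def by (intro mult_left_mono) auto
    also have "\<dots> = \<delta> / 2"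
    proof -
      have "2 * L * A * (\<delta> / (4 * L * A)) = \<delta> / 2" if "A > 0" for A using that L by (simp add: field_simps)
      from this[OF p] show ?thesis .
    qed
    finally show "2 * L * (1 + \<rho>) ^ (2 * ?D + 1) * \<sigma> \<rho> \<le> \<delta> / 2" .
  qed
  have \<sigma>_anti: "\<sigma> b \<le> \<sigma> a" if "0 \<le> a" "a \<le> b" for a b
    unfolding \<sigma>_def using that L \<delta> by (intro min.mono divide_left_mono mult_left_mono power_mono mult_pos_pos zero_less_power) auto
  \<comment> \<open>The next radius is where the damping at scale \<open>\<sigma> r\<close> has
    taken over: \<open>2 * C / (s * norm x) \<le> \<delta>\<close> beyond it.\<close>
  define \<rho> where "\<rho> = rec_nat (1::real) (\<lambda>_ r. r + 2 * C / (\<delta> * \<sigma> r))"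
  have \<rho>_0: "\<rho> 0 = 1" and \<rho>_Suc: "\<rho> (Suc k) = \<rho> k + 2 * C / (\<delta> * \<sigma> (\<rho> k))" for k by (simp_all add: \<rho>_def)
  have \<rho>1: "\<rho> k \<ge> 1" for k
  proof (induction k)
    case (Suc k)
    then have "2 * C / (\<delta> * \<sigma> (\<rho> k)) > 0" using \<sigma>(1)[of "\<rho> k"] C \<delta> by simp
    with Suc show ?case by (simp add: \<rho>_Suc)
  qed (simp add: \<rho>_0)
  then have \<rho>0: "\<rho> k \<ge> 0" for k by (meson order_trans zero_le_one)
  have "mono \<rho>"
  proof (unfold mono_iff_le_Suc, rule allI)
    fix k show "\<rho> k \<le> \<rho> (Suc k)" using \<sigma>(1)[OF \<rho>0[of k]] C \<delta> by (simp add: \<rho>_Suc)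
  qed
  define s where "s k = \<sigma> (\<rho> k)" for k
  have s: "s k > 0" "s k \<le> 1/2" for k using \<sigma> \<rho>0 by (auto simp: s_def)
  \<comment> \<open>No larger than any of the scales in use, so the growth
    \<open>(1 + \<epsilon> |x|)^d\<close> is absorbed by the decay in \<open>s k * norm x\<close>
    for every \<open>k < N\<close>.\<close>
  define \<epsilon> where "\<epsilon> = \<sigma> (\<rho> N)"
  have \<epsilon>: "\<epsilon> > 0" "\<epsilon> \<le> 1/2" using \<sigma> \<rho>0 by (auto simp: \<epsilon>_def)
  have \<epsilon>s: "\<epsilon> \<le> s k" if "k < N" for k
    unfolding \<epsilon>_def s_def using that \<rho>0 by (intro \<sigma>_anti monoD[OF \<open>mono \<rho>\<close>]) auto
  show ?thesis
  proof (rule exI[of _ \<epsilon>], rule conjI[OF \<epsilon>(1)], rule exI[of _ "\<delta>/2"], rule conjI, use \<delta> in simp,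
      rule exI[of _ "\<rho> N"], rule conjI, use \<rho>1[of N] in simp, intro allI ballI impI)
    fix E and F :: "'a \<Rightarrow> complex"
    let ?f = "inv_fourier F"
    let ?m = "cmod (?f 0)"
    assume F: "F \<in> L2_on \<Lambda>"
      and samp: "\<forall>G\<in>L2_on \<Lambda>. \<forall>M\<ge>0. (\<forall>x\<in>E. cmod (inv_fourier G x) \<le> M) \<longrightarrow> cmod (inv_fourier G 0) \<le> K * M"
      and f0: "?f 0 \<noteq> 0"
      and growth: "\<forall>z. cmod (?f z) \<le> 2 * ?m * (1 + \<epsilon> * norm z) ^ ?D"
    have m: "?m > 0" using f0 by simp
    show "\<exists>x\<in>E. norm x \<le> \<rho> N \<and> \<delta> / 2 * ?m < cmod (?f x)"
    proof (rule ccontr)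
      assume "\<not> ?thesis"
      then have small: "cmod (?f x) \<le> \<delta> / 2 * ?m" if "x \<in> E" "norm x \<le> \<rho> N" for x
        using that by (meson not_le)
      have growth1: "cmod (?f z) \<le> (2 * ?m) * (1 + norm z) ^ ?D" for z
      proof -
        have "\<epsilon> * norm z \<le> norm z" using \<epsilon> by (simp add: mult_left_le_one_le)
        then have "2 * ?m * (1 + \<epsilon> * norm z) ^ ?D \<le> (2 * ?m) * (1 + norm z) ^ ?D"
          using \<epsilon> by (intro mult_left_mono power_mono) auto
        then show ?thesis using growth order_trans by blast
      qed
      have "\<exists>H\<in>L2_on \<Lambda>. \<forall>x. inv_fourier H x = ?f ((1 - s k) *\<^sub>R x) * \<theta> (s k *\<^sub>R x)" for k
      proof -
        let ?r = "1 - s k"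
        have r: "?r > 0" using s(2)[of k] by linarith
        have meas: "F \<in> borel_measurable borel" using F by (rule L2_onD)
        have "bounded ((*\<^sub>R) ?r ` \<Lambda>)" using \<Lambda>(1) by (rule bounded_scaling)
        from mul[OF s(1)[of k] L2_on_dilate[OF F r] this] obtain H
          where H: "H \<in> L2_on {u + v |u v. u \<in> (*\<^sub>R) ?r ` \<Lambda> \<and> norm v \<le> s k * \<rho>0}"
            "\<And>x. inv_fourier H x = inv_fourier (\<lambda>\<gamma>. F (\<gamma> /\<^sub>R ?r) / ?r ^ ?D) x * \<theta> (s k *\<^sub>R x)"
          by blast
        \<comment> \<open>Here the contraction pays: \<open>(1 - s) u + v\<close> is a convex
          combination of \<open>u\<close> and \<open>v / s\<close>, and the latter lies in the ball
          contained in \<open>\<Lambda>\<close>.\<close>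
        have "{u + v |u v. u \<in> (*\<^sub>R) ?r ` \<Lambda> \<and> norm v \<le> s k * \<rho>0} \<subseteq> \<Lambda>"
        proof safe
          fix u v :: 'a assume u: "u \<in> \<Lambda>" and v: "norm v \<le> s k * \<rho>0"
          have "v /\<^sub>R s k \<in> cball 0 \<rho>0" using v s(1)[of k] by (simp add: divide_simps mult.commute)
          then have "v /\<^sub>R s k \<in> \<Lambda>" using \<Lambda>(3) by blast
          then have "?r *\<^sub>R u + s k *\<^sub>R (v /\<^sub>R s k) \<in> \<Lambda>"
            using s[of k] r by (intro convexD[OF \<Lambda>(2) u]) auto
          then show "?r *\<^sub>R u + v \<in> \<Lambda>" using s(1)[of k] by simp
        qed
        from L2_on_mono[OF H(1) this] show ?thesis
          using H(2)[unfolded inv_fourier_dilate[OF meas r]] by blast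
      qed
      then obtain H where H: "\<And>k. H k \<in> L2_on \<Lambda>"
        and p: "\<And>k x. inv_fourier (H k) x = ?f ((1 - s k) *\<^sub>R x) * \<theta> (s k *\<^sub>R x)"
        by metis
      define G where "G \<gamma> = (\<Sum>k<N. H k \<gamma>)" for \<gamma>
      have G: "G \<in> L2_on \<Lambda>" unfolding G_def by (rule L2_on_sum[OF H])
      have Gf: "inv_fourier G x = (\<Sum>k<N. inv_fourier (H k) x)" for x
        unfolding G_def by (rule inv_fourier_sum) (rule L2_on_integrable[OF H \<Lambda>(1)])
      \<comment> \<open>Growth of order \<open>d\<close> against kernel decay of order
        \<open>2 d\<close> leaves order \<open>d\<close>. From this, \<open>peak\<close> takes the
        bound at all points and \<open>outside\<close> the one beyond the next radius.\<close>
      have decay: "cmod (inv_fourier (H k) x) \<le> 2 * C * ?m / (1 + s k * norm x) ^ ?D" if "k < N" for k x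
      proof -
        let ?n = "1 + s k * norm x"
        have n: "?n > 0" using s(1)[of k] by (simp add: add_pos_nonneg)
        have "cmod (?f ((1 - s k) *\<^sub>R x)) \<le> 2 * ?m * (1 + \<epsilon> * norm ((1 - s k) *\<^sub>R x)) ^ ?D"
          using growth by blast
        also have "\<dots> \<le> 2 * ?m * ?n ^ ?D"
        proof (intro mult_left_mono power_mono)
          have "\<epsilon> * norm ((1 - s k) *\<^sub>R x) \<le> s k * norm x"
            using \<epsilon>s[OF that] \<epsilon>(1) s[of k] by (intro mult_mono) (auto simp: mult_left_le_one_le)
          then show "1 + \<epsilon> * norm ((1 - s k) *\<^sub>R x) \<le> ?n" by simp
        qed (use \<epsilon>(1) in auto)
        finally have a: "cmod (?f ((1 - s k) *\<^sub>R x)) \<le> 2 * ?m * ?n ^ ?D" .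
        have b: "cmod (\<theta> (s k *\<^sub>R x)) \<le> C / (?n ^ ?D * ?n ^ ?D)"
          using \<theta>(4)[of "s k *\<^sub>R x"] n s(1)[of k] by (simp add: pos_le_divide_eq mult_2 power_add)
        have "cmod (inv_fourier (H k) x) \<le> (2 * ?m * ?n ^ ?D) * (C / (?n ^ ?D * ?n ^ ?D))"
          unfolding p norm_mult using n by (intro mult_mono a b) auto
        also have "\<dots> = 2 * C * ?m / ?n ^ ?D" using n by simp
        finally show ?thesis .
      qed
      have peak: "cmod (inv_fourier (H k) x) \<le> 2 * C * ?m" if "k < N" for k x
      proof -
        have "1 \<le> (1 + s k * norm x) ^ ?D" using s(1)[of k] by (intro one_le_power) simp
        then have "2 * C * ?m / (1 + s k * norm x) ^ ?D \<le> 2 * C * ?m / 1"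
          using C by (intro divide_left_mono) auto
        then show ?thesis using decay[OF that, of x] by simp
      qed
      have outside: "cmod (inv_fourier (H k) x) \<le> \<delta> * ?m" if "k < N" "\<rho> (Suc k) \<le> norm x" for k x
      proof -
        have "2 * C / (\<delta> * s k) \<le> norm x" using that(2) \<rho>1[of k] by (simp add: \<rho>_Suc s_def)
        then have le: "2 * C \<le> \<delta> * (s k * norm x)" using \<delta> s(1)[of k] by (simp add: pos_divide_le_eq mult_ac)
        have "1 + s k * norm x \<le> (1 + s k * norm x) ^ ?D"
          using s(1)[of k] D by (intro self_le_power) auto
        then have "2 * C * ?m / (1 + s k * norm x) ^ ?D \<le> 2 * C * ?m / (1 + s k * norm x)"
          using C s(1)[of k] by (intro divide_left_mono mult_pos_pos) (auto simp: add_pos_nonneg)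
        also have "\<dots> \<le> \<delta> * ?m"
        proof -
          have "\<delta> * (s k * norm x) \<le> \<delta> * (1 + s k * norm x)" using \<delta> by simp
          with le have "2 * C \<le> \<delta> * (1 + s k * norm x)" by linarith
          then have "2 * C * ?m \<le> \<delta> * (1 + s k * norm x) * ?m" using m by (intro mult_right_mono) auto
          then show ?thesis using s(1)[of k] by (simp add: pos_divide_le_eq add_pos_nonneg mult_ac)
        qed
        finally show ?thesis using decay[OF that(1), of x] by linarith
      qed
      \<comment> \<open>For sample points within \<open>\<rho> k\<close> the contraction moves
        \<open>x\<close> so little that smallness of \<open>f\<close> at \<open>x\<close> passes to
        \<open>(1 - s k) x\<close>; this is the only use of \<open>small\<close>.\<close>
      have inside: "cmod (inv_fourier (H k) x) \<le> \<delta> * ?m" if "k < N" "x \<in> E" "norm x \<le> \<rho> k" for k x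
      proof -
        have "\<rho> k \<le> \<rho> N" using that(1) by (intro monoD[OF \<open>mono \<rho>\<close>]) simp
        then have fx: "cmod (?f x) \<le> \<delta> / 2 * ?m" using small[OF that(2)] that(3) by simp
        have "cmod (?f (x + (- s k) *\<^sub>R x) - ?f x) \<le> (2 * ?m) * L * (1 + norm x) ^ ?D * (1 + norm ((- s k) *\<^sub>R x)) ^ ?D * norm ((- s k) *\<^sub>R x)"
          using m by (intro bern[OF F _ growth1]) simp
        also have "\<dots> \<le> (2 * ?m) * L * (1 + \<rho> k) ^ ?D * (1 + \<rho> k) ^ ?D * (s k * (1 + \<rho> k))"
        proof -
          have n1: "norm ((- s k) *\<^sub>R x) \<le> s k * (1 + \<rho> k)" using s(1)[of k] that(3) by simp
          have "s k * norm x \<le> 1 * norm x" using s[of k] by (intro mult_right_mono) auto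
          then have n2: "norm ((- s k) *\<^sub>R x) \<le> \<rho> k" using s(1)[of k] that(3) by simp
          show ?thesis
            using n1 n2 that(3) L m s(1)[of k] \<rho>0[of k] by (intro mult_mono power_mono mult_nonneg_nonneg) auto
        qed
        also have "\<dots> = ?m * (2 * L * (1 + \<rho> k) ^ (2 * ?D + 1) * \<sigma> (\<rho> k))"
        proof -
          have "(1 + \<rho> k) ^ (2 * ?D + 1) = (1 + \<rho> k) ^ ?D * (1 + \<rho> k) ^ ?D * (1 + \<rho> k)"
            unfolding mult_2 power_add power_one_right ..
          then show ?thesis by (simp only: s_def mult_ac)
        qed
        also have "\<dots> \<le> ?m * (\<delta> / 2)" by (intro mult_left_mono \<sigma>(3)[OF \<rho>0]) simp
        finally have "cmod (?f ((1 - s k) *\<^sub>R x) - ?f x) \<le> ?m * (\<delta> / 2)" by (simp add: scaleR_left_diff_distrib)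
        then have "cmod (?f ((1 - s k) *\<^sub>R x)) \<le> \<delta> * ?m"
          using fx norm_triangle_ineq2[of "?f ((1 - s k) *\<^sub>R x)" "?f x"] by (simp add: mult.commute)
        moreover have "cmod (inv_fourier (H k) x) \<le> cmod (?f ((1 - s k) *\<^sub>R x)) * 1"
          unfolding p norm_mult by (intro mult_left_mono \<theta>(2)) auto
        ultimately show ?thesis by simp
      qed
      have GE: "cmod (inv_fourier G x) \<le> 2 * C * ?m + real N * (\<delta> * ?m)" if "x \<in> E" for x
        unfolding Gf
        by (rule sum_norm_le_single_peak[OF \<open>mono \<rho>\<close> peak, where t = "norm x"])
           (use inside[OF _ that] outside m C \<delta> in auto)
      \<comment> \<open>All \<open>N\<close> summands equal \<open>f 0\<close> at the origin and add
        up without cancellation, whereas on \<open>E\<close> at most one of them is large at each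
        point.\<close>
      have "cmod (inv_fourier G 0) \<le> K * (2 * C * ?m + real N * (\<delta> * ?m))"
        using samp[rule_format, OF G _ GE] m C \<delta> by simp
      moreover have "cmod (inv_fourier G 0) = real N * ?m"
        unfolding Gf by (simp add: p \<theta>(1) norm_mult)
      moreover have "K * (2 * C * ?m + real N * (\<delta> * ?m)) = (2 * C * K + real N / 4) * ?m"
        using K by (simp add: \<delta>_def field_simps)
      ultimately have "real N \<le> 2 * C * K + real N / 4" using m by simp
      then show False using N N0 by simp
    qed
  qed
qed

section \<open>Frame bounds\<close>

lemma separated_imp_closed: "separated E \<Longrightarrow> closed (E :: 'a::euclidean_space set)"
  unfolding separated_def by (metis discrete_imp_closed dist_commute not_less)

text \<open>An infinite bounded piece would have a limit point and hence two distinct points closer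
  than \<open>\<delta>\<close>, so every bounded piece is finite.\<close>

lemma separated_imp_countable:
  fixes E :: "'a::euclidean_space set"
  assumes "separated E"
  shows "countable E"
proof -
  obtain \<delta> where \<delta>: "\<delta> > 0" "\<And>x y. x \<in> E \<Longrightarrow> y \<in> E \<Longrightarrow> x \<noteq> y \<Longrightarrow> \<delta> \<le> dist x y"
    using assms by (auto simp: separated_def)
  have "finite (E \<inter> cball 0 (real n))" for n :: nat
  proof (rule ccontr)
    assume "infinite (E \<inter> cball 0 (real n))"
    then obtain l where l: "l islimpt (E \<inter> cball 0 (real n))"
      using compact_eq_Bolzano_Weierstrass[of "cball (0::'a) (real n)"] compact_cball by blast
    from islimptE[OF l, of "ball l (\<delta>/2)"] \<delta>(1) obtain x where x: "x \<in> E" "x \<noteq> l" "dist l x < \<delta>/2" by auto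
    from islimptE[OF l, of "ball l (dist l x)"] x obtain y where y: "y \<in> E" "dist l y < dist l x" by auto
    then have "x \<noteq> y" by auto
    moreover have "dist x y < \<delta>" using x y dist_triangle2[of x y l] by (simp add: dist_commute)
    ultimately show False using \<delta>(2) x y by force
  qed
  moreover have "E = (\<Union>n::nat. E \<inter> cball 0 (real n))" by (auto simp: real_arch_simple)
  ultimately show ?thesis by (metis countable_UN countable_finite countableI_type)
qed

section \<open>From local sampling to the lower frame bound\<close>

lemma inverse_power_norm_integral:
  fixes x :: "'a::euclidean_space"
  assumes \<epsilon>: "\<epsilon> > 0"
  shows "(\<integral>\<^sup>+t. ennreal (1 / (1 + \<epsilon> * norm (x - t)) ^ (2 * DIM('a))) \<partial>lborel)
    = ennreal (\<integral>t. 1 / (1 + \<epsilon> * norm (t::'a)) ^ (2 * DIM('a)) \<partial>lborel)"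
proof -
  let ?w = "\<lambda>t::'a. 1 / (1 + \<epsilon> * norm t) ^ (2 * DIM('a))"
  have eq: "?w (x - t) = ?w (- x + 1 *\<^sub>R t)" for t by (simp add: norm_minus_commute)
  have "integrable lborel (\<lambda>t. ?w (- x + 1 *\<^sub>R t))"
    using lborel_integral_scale(2)[of ?w 1 "- x"] integrable_inverse_power_norm[where 'a='a, OF \<epsilon>] by simp
  then have "(\<integral>\<^sup>+t. ennreal (?w (- x + 1 *\<^sub>R t)) \<partial>lborel) = ennreal (\<integral>t. ?w (- x + 1 *\<^sub>R t) \<partial>lborel)"
    by (rule nn_integral_eq_integral) (use \<epsilon> in simp)
  also have "(\<integral>t. ?w (- x + 1 *\<^sub>R t) \<partial>lborel) = (\<integral>t. ?w t \<partial>lborel)"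
    using lborel_integral_scale(1)[of ?w 1 "- x"] by simp
  finally show ?thesis unfolding eq .
qed

text \<open>The weight is centred at \<open>t\<close>, so \<open>M \<ge> |f t|\<close>. At a
  near-maximum \<open>a\<close> of the weighted function, submultiplicativity of the weight yields
  the growth condition of \<open>local_sampling\<close> for \<open>f\<close> recentred at
  \<open>a\<close>, and a good sample point lies within \<open>R\<close> of \<open>a\<close>. The
  exact maximum need not be attained, whence the factor 2.\<close>

lemma pointwise_sampling:
  fixes \<Lambda> :: "'a::euclidean_space set"
  assumes \<Lambda>: "bounded \<Lambda>" "convex \<Lambda>" "cball 0 \<rho>0 \<subseteq> \<Lambda>" and "\<rho>0 > 0" and K: "K > 0"
    and samp: "\<forall>F\<in>L2_on \<Lambda>. \<forall>M\<ge>0. (\<forall>x\<in>E. cmod (inv_fourier F x) \<le> M) \<longrightarrow> (\<forall>y. cmod (inv_fourier F y) \<le> K * M)"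
  obtains \<epsilon> C where "\<epsilon> > 0" "C > 0" "\<And>F t. F \<in> L2_on \<Lambda> \<Longrightarrow> inv_fourier F t \<noteq> 0 \<Longrightarrow>
     \<exists>x\<in>E. cmod (inv_fourier F t) \<le> C * cmod (inv_fourier F x) / (1 + \<epsilon> * norm (x - t)) ^ DIM('a)"
proof -
  let ?D = "DIM('a)"
  obtain \<epsilon> \<eta> R where \<epsilon>: "\<epsilon> > 0" and \<eta>: "\<eta> > 0" and R: "R > 0" and loc: "\<forall>E. \<forall>F\<in>L2_on \<Lambda>.
      (\<forall>G\<in>L2_on \<Lambda>. \<forall>M\<ge>0. (\<forall>x\<in>E. cmod (inv_fourier G x) \<le> M) \<longrightarrow> cmod (inv_fourier G 0) \<le> K * M) \<longrightarrow>
      inv_fourier F 0 \<noteq> 0 \<longrightarrow>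
      (\<forall>z. cmod (inv_fourier F z) \<le> 2 * cmod (inv_fourier F 0) * (1 + \<epsilon> * norm z) ^ ?D) \<longrightarrow>
      (\<exists>x\<in>E. norm x \<le> R \<and> \<eta> * cmod (inv_fourier F 0) < cmod (inv_fourier F x))"
    using local_sampling[OF \<Lambda> \<open>\<rho>0 > 0\<close> K] by (elim exE conjE) (rule that; assumption)
  define C where "C = 2 / \<eta> * (1 + \<epsilon> * R) ^ ?D"
  show ?thesis
  proof (rule that[OF \<epsilon>])
    show "C > 0" using \<epsilon> \<eta> R by (simp add: C_def add_pos_pos)
    fix F :: "'a \<Rightarrow> complex" and t
    assume F: "F \<in> L2_on \<Lambda>" and ft: "inv_fourier F t \<noteq> 0"
    let ?f = "inv_fourier F"
    let ?w = "\<lambda>x::'a. (1 + \<epsilon> * norm x) ^ ?D"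
    have w1: "?w x \<ge> 1" for x using \<epsilon> by (intro one_le_power) simp
    have w0: "?w x > 0" for x using w1[of x] by linarith
    have wadd: "?w (x + y) \<le> ?w x * ?w y" for x y
    proof -
      have "\<epsilon> * norm (x + y) \<le> \<epsilon> * (norm x + norm y)" using \<epsilon> norm_triangle_ineq by (intro mult_left_mono) auto
      moreover have "0 \<le> (\<epsilon> * norm x) * (\<epsilon> * norm y)" using \<epsilon> by simp
      ultimately have "1 + \<epsilon> * norm (x + y) \<le> (1 + \<epsilon> * norm x) * (1 + \<epsilon> * norm y)"
        unfolding ring_distribs by linarith
      then show ?thesis unfolding power_mult_distrib[symmetric] using \<epsilon> by (intro power_mono) auto
    qed
    define g where "g x = cmod (?f x) / ?w (x - t)" for x
    have "g x \<le> (\<integral>\<gamma>. cmod (F \<gamma>) \<partial>lborel)" for x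
    proof -
      have "g x \<le> cmod (?f x) / 1" unfolding g_def using w1 by (intro divide_left_mono) (auto simp: w0)
      then show ?thesis using norm_inv_fourier_le[OF L2_on_integrable[OF F \<Lambda>(1)], of x] by simp
    qed
    then have bdd: "bdd_above (range g)" by (auto intro!: bdd_aboveI)
    define M where "M = (SUP x. g x)"
    have gM: "g x \<le> M" for x unfolding M_def using bdd by (intro cSUP_upper) auto
    have "g t = cmod (?f t)" by (simp add: g_def)
    then have M: "M > 0" using gM[of t] ft by (metis less_le_trans zero_less_norm_iff)
    then have "M / 2 < M" by simp
    then obtain a where a: "M / 2 < g a"
      using less_cSUP_iff[OF UNIV_not_empty bdd, of "M / 2"] unfolding M_def[symmetric] by blast
    let ?F = "\<lambda>\<gamma>. F \<gamma> * wave a \<gamma>"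
    have fM: "cmod (?f x) \<le> M * ?w (x - t)" for x
      using gM[of x] w0[of "x - t"] by (simp add: g_def pos_divide_le_eq)
    have fa: "M * ?w (a - t) < 2 * cmod (?f a)"
      using a w0[of "a - t"] by (simp add: g_def pos_less_divide_eq)
    \<comment> \<open>The sample set is translated along with the function. The sampling inequality
      for \<open>E\<close> passes to \<open>E - a\<close> by modulation with the same
      \<open>K\<close>, and the constants of \<open>local_sampling\<close> were fixed before the
      set.\<close>
    have "\<exists>x\<in>(\<lambda>x. x - a) ` E. norm x \<le> R \<and> \<eta> * cmod (inv_fourier ?F 0) < cmod (inv_fourier ?F x)"
    proof (rule loc[rule_format])
      show "?F \<in> L2_on \<Lambda>" by (rule L2_on_modulate[OF F])
      show "cmod (inv_fourier G 0) \<le> K * M"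
        if G: "G \<in> L2_on \<Lambda>" and "M \<ge> 0" and le: "\<And>x. x \<in> (\<lambda>x. x - a) ` E \<Longrightarrow> cmod (inv_fourier G x) \<le> M" for G and M :: real
      proof -
        have "\<forall>x\<in>E. cmod (inv_fourier (\<lambda>\<gamma>. G \<gamma> * wave (- a) \<gamma>) x) \<le> M"
          unfolding inv_fourier_modulate by (intro ballI le) auto
        then have "cmod (inv_fourier (\<lambda>\<gamma>. G \<gamma> * wave (- a) \<gamma>) a) \<le> K * M"
          using samp L2_on_modulate[OF G] \<open>M \<ge> 0\<close> by blast
        then show "cmod (inv_fourier G 0) \<le> K * M" by (simp add: inv_fourier_modulate)
      qed
      show "inv_fourier ?F 0 \<noteq> 0"
      proof -
        have "0 < 2 * cmod (?f a)" using fa mult_pos_pos[OF M w0[of "a - t"]] by linarith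
        then show ?thesis by (simp add: inv_fourier_modulate)
      qed
      show "cmod (inv_fourier ?F z) \<le> 2 * cmod (inv_fourier ?F 0) * ?w z" for z
      proof -
        have "cmod (?f (a + z)) \<le> M * ?w ((a - t) + z)" using fM[of "a + z"] by (simp add: algebra_simps)
        also have "\<dots> \<le> M * (?w (a - t) * ?w z)" using M by (intro mult_left_mono wadd) auto
        also have "\<dots> \<le> (2 * cmod (?f a)) * ?w z"
          using mult_right_mono[OF less_imp_le[OF fa], of "?w z"] w0[of z] by (simp only: mult.assoc less_imp_le)
        finally show "cmod (inv_fourier ?F z) \<le> 2 * cmod (inv_fourier ?F 0) * ?w z"
          by (simp add: inv_fourier_modulate)
      qed
    qed
    then obtain x where x: "x \<in> E" "norm (x - a) \<le> R" "\<eta> * cmod (?f a) < cmod (?f x)"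
      by (auto simp: inv_fourier_modulate)
    have "cmod (?f t) * ?w (x - t) \<le> M * (?w (a - t) * ?w (x - a))"
    proof (rule mult_mono)
      show "cmod (?f t) \<le> M" using gM[of t] \<open>g t = cmod (?f t)\<close> by simp
      show "?w (x - t) \<le> ?w (a - t) * ?w (x - a)" using wadd[of "a - t" "x - a"] by simp
    qed (use M w0[of "x - t"] in auto)
    also have "\<dots> \<le> (2 * cmod (?f a)) * (1 + \<epsilon> * R) ^ ?D"
    proof -
      have "?w (x - a) \<le> (1 + \<epsilon> * R) ^ ?D" using x(2) \<epsilon> by (intro power_mono add_left_mono mult_left_mono) auto
      then have "(M * ?w (a - t)) * ?w (x - a) \<le> (2 * cmod (?f a)) * (1 + \<epsilon> * R) ^ ?D"
        by (rule mult_mono[OF less_imp_le[OF fa]]) (use \<epsilon> in auto)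
      then show ?thesis by (simp only: mult.assoc)
    qed
    also have "\<dots> \<le> (2 * (cmod (?f x) / \<eta>)) * (1 + \<epsilon> * R) ^ ?D"
      using x(3) \<eta> \<epsilon> R by (intro mult_right_mono mult_left_mono) (auto simp: pos_le_divide_eq mult.commute)
    also have "\<dots> = C * cmod (?f x)" by (simp add: C_def)
    finally have "cmod (?f t) \<le> C * cmod (?f x) / ?w (x - t)" using w0[of "x - t"] by (simp add: pos_le_divide_eq)
    then show "\<exists>x\<in>E. cmod (?f t) \<le> C * cmod (?f x) / ?w (x - t)" using x(1) by blast
  qed
qed

text \<open>The sample point in \<open>pt\<close> varies with \<open>t\<close>, so its term is
  bounded by the sum over all of \<open>E\<close>, and Tonelli's theorem integrates term by term.
  Nonnegative integrals are used because integrability is part of the conclusion.\<close>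

lemma integral_le_sum_of_pointwise:
  fixes f :: "'a::euclidean_space \<Rightarrow> complex"
  assumes [measurable]: "f \<in> borel_measurable borel" and E: "countable E" and \<epsilon>: "\<epsilon> > 0" and C: "C > 0"
    and sum: "(\<lambda>x. (cmod (f x))\<^sup>2) summable_on E"
    and pt: "\<And>t. f t \<noteq> 0 \<Longrightarrow> \<exists>x\<in>E. cmod (f t) \<le> C * cmod (f x) / (1 + \<epsilon> * norm (x - t)) ^ DIM('a)"
  shows "integrable lborel (\<lambda>x. (cmod (f x))\<^sup>2)"
    and "(\<integral>t. (cmod (f t))\<^sup>2 \<partial>lborel) \<le> C\<^sup>2 * (\<integral>t. 1 / (1 + \<epsilon> * norm (t::'a)) ^ (2 * DIM('a)) \<partial>lborel) * (\<Sum>\<^sub>\<infinity>x\<in>E. (cmod (f x))\<^sup>2)"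
proof -
  define W where "W = (\<integral>t. 1 / (1 + \<epsilon> * norm (t::'a)) ^ (2 * DIM('a)) \<partial>lborel)"
  have W: "W \<ge> 0" unfolding W_def by (intro integral_nonneg_AE AE_I2) (use \<epsilon> in simp)
  let ?S = "\<Sum>\<^sub>\<infinity>x\<in>E. (cmod (f x))\<^sup>2"
  have S: "?S \<ge> 0" by (rule infsum_nonneg) simp
  \<comment> \<open>\<open>E\<close> may be finite, so it is enumerated over the index set
    \<open>I\<close>, and the coefficients are 0 elsewhere.\<close>
  define I where "I = to_nat_on E ` E"
  define e where "e = from_nat_into E"
  have eE: "e n \<in> E" if "n \<in> I" for n using that E by (auto simp: I_def e_def)
  have inj: "inj_on e I" using E by (auto simp: I_def e_def inj_on_def)
  define c where "c n = (if n \<in> I then ennreal (C\<^sup>2 * (cmod (f (e n)))\<^sup>2) else 0)" for n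
  define w where "w u = ennreal (1 / (1 + \<epsilon> * norm u) ^ (2 * DIM('a)))" for u :: 'a
  have [measurable]: "w \<in> borel_measurable borel" unfolding w_def by measurable
  have le: "ennreal ((cmod (f t))\<^sup>2) \<le> (\<Sum>n. c n * w (e n - t))" for t
  proof (cases "f t = 0")
    case False
    from pt[OF this] obtain x where x: "x \<in> E" "cmod (f t) \<le> C * cmod (f x) / (1 + \<epsilon> * norm (x - t)) ^ DIM('a)" by blast
    define n where "n = to_nat_on E x"
    have n: "n \<in> I" "e n = x" using x(1) E by (auto simp: n_def I_def e_def)
    have "(cmod (f t))\<^sup>2 \<le> (C * cmod (f x) / (1 + \<epsilon> * norm (x - t)) ^ DIM('a))\<^sup>2"
      using x(2) by (intro power_mono) auto
    also have "\<dots> = C\<^sup>2 * (cmod (f x))\<^sup>2 * (1 / (1 + \<epsilon> * norm (x - t)) ^ (2 * DIM('a)))"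
      by (simp add: power_divide power_mult_distrib power_mult[symmetric] mult.commute)
    finally have "ennreal ((cmod (f t))\<^sup>2) \<le> c n * w (e n - t)"
      using n by (simp add: c_def w_def ennreal_mult'[symmetric] ennreal_leI)
    also have "\<dots> = (\<Sum>n\<in>{n}. c n * w (e n - t))" by simp
    also have "\<dots> \<le> (\<Sum>n. c n * w (e n - t))" by (rule sum_le_suminf) auto
    finally show ?thesis .
  qed simp
  have "(\<integral>\<^sup>+t. ennreal ((cmod (f t))\<^sup>2) \<partial>lborel) \<le> (\<integral>\<^sup>+t. (\<Sum>n. c n * w (e n - t)) \<partial>lborel)"
    by (intro nn_integral_mono le)
  also have "\<dots> = (\<Sum>n. \<integral>\<^sup>+t. c n * w (e n - t) \<partial>lborel)"
    by (rule nn_integral_suminf) measurable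
  also have "\<dots> = (\<Sum>n. c n * ennreal W)"
    by (simp add: nn_integral_cmult w_def W_def inverse_power_norm_integral[OF \<epsilon>])
  also have "\<dots> = (\<Sum>n. c n) * ennreal W" by simp
  also have "(\<Sum>n. c n) \<le> ennreal (C\<^sup>2 * ?S)"
  proof (rule suminf_le_const)
    fix m
    have "(\<Sum>n<m. c n) = (\<Sum>n\<in>{..<m} \<inter> I. ennreal (C\<^sup>2 * (cmod (f (e n)))\<^sup>2))"
      unfolding c_def by (simp add: sum.If_cases)
    also have "\<dots> = ennreal (\<Sum>n\<in>{..<m} \<inter> I. C\<^sup>2 * (cmod (f (e n)))\<^sup>2)" by (rule sum_ennreal) simp
    also have "\<dots> \<le> ennreal (C\<^sup>2 * ?S)"
    proof (rule ennreal_leI)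
      have "(\<Sum>n\<in>{..<m} \<inter> I. (cmod (f (e n)))\<^sup>2) = (\<Sum>x\<in>e ` ({..<m} \<inter> I). (cmod (f x))\<^sup>2)"
        using inj by (subst sum.reindex) (auto intro: inj_on_subset)
      also have "\<dots> \<le> ?S" using eE by (intro finite_sum_le_infsum sum) auto
      finally show "(\<Sum>n\<in>{..<m} \<inter> I. C\<^sup>2 * (cmod (f (e n)))\<^sup>2) \<le> C\<^sup>2 * ?S"
        by (simp add: sum_distrib_left[symmetric] mult_left_mono)
    qed
    finally show "(\<Sum>n<m. c n) \<le> ennreal (C\<^sup>2 * ?S)" .
  qed simp
  finally have bound: "(\<integral>\<^sup>+t. ennreal ((cmod (f t))\<^sup>2) \<partial>lborel) \<le> ennreal (C\<^sup>2 * ?S * W)"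
    using W S by (simp add: ennreal_mult mult_right_mono)
  then show int: "integrable lborel (\<lambda>x. (cmod (f x))\<^sup>2)"
    by (intro integrableI_bounded) (auto simp: less_top[symmetric] top_unique intro: le_less_trans)
  then have "ennreal (\<integral>t. (cmod (f t))\<^sup>2 \<partial>lborel) \<le> ennreal (C\<^sup>2 * ?S * W)"
    using bound by (subst nn_integral_eq_integral[symmetric]) auto
  then show "(\<integral>t. (cmod (f t))\<^sup>2 \<partial>lborel) \<le> C\<^sup>2 * (\<integral>t. 1 / (1 + \<epsilon> * norm (t::'a)) ^ (2 * DIM('a)) \<partial>lborel) * ?S"
    unfolding W_def[symmetric] using W S by (simp add: mult_ac)
qed

lemma balayage_imp_lower_frame_bound:
  fixes E \<Lambda> :: "'a::euclidean_space set"
  assumes E: "separated E" and \<Lambda>: "bounded \<Lambda>" "convex \<Lambda>" "\<forall>\<gamma>\<in>\<Lambda>. - \<gamma> \<in> \<Lambda>"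
    and ball: "cball 0 \<rho>0 \<subseteq> \<Lambda>" "\<rho>0 > 0" and bal: "balayage E \<Lambda>"
  shows "\<exists>A>0. \<forall>F\<in>L2_on \<Lambda>. (\<lambda>x. (cmod (inv_fourier F x))\<^sup>2) summable_on E \<longrightarrow>
     A * (\<integral>\<gamma>. (cmod (F \<gamma>))\<^sup>2 \<partial>lborel) \<le> (\<Sum>\<^sub>\<infinity>x\<in>E. (cmod (inv_fourier F x))\<^sup>2)"
proof -
  obtain K where K: "K > 0" "\<forall>F\<in>L2_on \<Lambda>. \<forall>M\<ge>0. (\<forall>x\<in>E. cmod (inv_fourier F x) \<le> M) \<longrightarrow> (\<forall>y. cmod (inv_fourier F y) \<le> K * M)"
    using balayage_imp_sampling[OF separated_imp_closed[OF E] \<Lambda>(1,3) bal] by blast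
  obtain \<epsilon> C where \<epsilon>: "\<epsilon> > 0" and C: "C > 0" and pt: "\<And>F t. F \<in> L2_on \<Lambda> \<Longrightarrow> inv_fourier F t \<noteq> 0 \<Longrightarrow>
     \<exists>x\<in>E. cmod (inv_fourier F t) \<le> C * cmod (inv_fourier F x) / (1 + \<epsilon> * norm (x - t)) ^ DIM('a)"
    using pointwise_sampling[OF \<Lambda>(1,2) ball K] by blast
  \<comment> \<open>Adding 1 makes \<open>B\<close> positive without a strict lower bound for the
    integral.\<close>
  define B where "B = C\<^sup>2 * (\<integral>t. 1 / (1 + \<epsilon> * norm (t::'a)) ^ (2 * DIM('a)) \<partial>lborel) + 1"
  have "(\<integral>t. 1 / (1 + \<epsilon> * norm (t::'a)) ^ (2 * DIM('a)) \<partial>lborel) \<ge> 0"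
    by (intro integral_nonneg_AE AE_I2) (use \<epsilon> in simp)
  then have B: "B > 0" by (simp add: B_def add_nonneg_pos)
  show ?thesis
  proof (intro exI[of _ "1 / B"] conjI ballI impI)
    fix F assume F: "F \<in> L2_on \<Lambda>" and sum: "(\<lambda>x. (cmod (inv_fourier F x))\<^sup>2) summable_on E"
    have fm: "inv_fourier F \<in> borel_measurable borel"
      using L2_onD(1)[OF F] by (intro inv_fourier_measurable) simp
    note I = integral_le_sum_of_pointwise[OF fm separated_imp_countable[OF E] \<epsilon> C sum pt[OF F]]
    have S: "(\<Sum>\<^sub>\<infinity>x\<in>E. (cmod (inv_fourier F x))\<^sup>2) \<ge> 0" by (rule infsum_nonneg) simp
    have "(\<integral>\<gamma>. (cmod (F \<gamma>))\<^sup>2 \<partial>lborel) \<le> (\<integral>x. (cmod (inv_fourier F x))\<^sup>2 \<partial>lborel)"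
      by (rule norm_le_norm_inv_fourier[OF F \<Lambda>(1) I(1)])
    also have "\<dots> \<le> (B - 1) * (\<Sum>\<^sub>\<infinity>x\<in>E. (cmod (inv_fourier F x))\<^sup>2)"
      using I(2) by (simp add: B_def)
    also have "\<dots> \<le> B * (\<Sum>\<^sub>\<infinity>x\<in>E. (cmod (inv_fourier F x))\<^sup>2)"
      using S by (intro mult_right_mono) auto
    finally show "1 / B * (\<integral>\<gamma>. (cmod (F \<gamma>))\<^sup>2 \<partial>lborel) \<le> (\<Sum>\<^sub>\<infinity>x\<in>E. (cmod (inv_fourier F x))\<^sup>2)"
      using B by (simp add: pos_divide_le_eq mult.commute)
  qed (use B in simp)
qed

section \<open>The upper frame bound for separated sets\<close>

lemma gauss_sum_separated_le:
  fixes x :: "'a::euclidean_space" and d :: real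
  assumes d: "d > 0" and sep: "\<And>x y. x \<in> T \<Longrightarrow> y \<in> T \<Longrightarrow> x \<noteq> y \<Longrightarrow> 2 * d < dist x y" and T: "finite T"
  shows "(\<Sum>y\<in>T. gauss (x - y)) \<le> exp (pi * d\<^sup>2) * 2 ^ DIM('a) / measure lborel (cball (0::'a) d)"
proof -
  let ?V = "measure lborel (cball (0::'a) d)"
  have V: "?V > 0" by (rule content_cball_pos[OF d])
  have Veq: "measure lborel (cball y d) = ?V" for y :: 'a
    using d by (simp add: content_cball)
  \<comment> \<open>On the ball of radius \<open>d\<close> about \<open>y\<close>,
    \<open>gauss (x - y)\<close> is at most \<open>exp (pi * d^2)\<close> times this wider Gaussian,
    since \<open>|z - x|^2 \<le> 4 (|x - y|^2 + d^2)\<close>. The balls are disjoint, so the sum is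
    bounded by the integral of \<open>u\<close>; halving the argument produces
    \<open>2 ^ DIM('a)\<close>.\<close>
  define u where "u z = gauss ((1/2) *\<^sub>R (z - x))" for z
  have gi: "integrable lborel (\<lambda>z::'a. gauss ((1/2) *\<^sub>R z))" "(\<integral>z. gauss ((1/2) *\<^sub>R (z::'a)) \<partial>lborel) = 2 ^ DIM('a)"
    using lborel_integral_scale[of "gauss :: 'a \<Rightarrow> real" "1/2" 0] gauss_integral[where 'a='a]
    by (simp_all add: field_simps power_divide)
  have ui: "integrable lborel u" "(\<integral>z. u z \<partial>lborel) = 2 ^ DIM('a)"
    using lborel_integral_scale[of "\<lambda>z::'a. gauss ((1/2) *\<^sub>R z)" 1 "- x"] gi
    by (simp_all add: u_def[abs_def])
  have um [measurable]: "u \<in> borel_measurable borel" using ui(1) by auto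
  have u0: "u z \<ge> 0" for z by (simp add: u_def gauss_bounds)
  have iint: "integrable lborel (\<lambda>z. indicator (cball y d) z * (exp (pi * d\<^sup>2) * u z))" for y
    by (rule Bochner_Integration.integrable_bound[OF integrable_mult_right[OF ui(1), of "exp (pi * d\<^sup>2)"]])
       (auto simp: indicator_def)
  have single: "?V * gauss (x - y) \<le> (\<integral>z. indicator (cball y d) z * (exp (pi * d\<^sup>2) * u z) \<partial>lborel)" for y
  proof -
    have "?V * gauss (x - y) = (\<integral>z. indicator (cball y d) z * gauss (x - y) \<partial>lborel)"
      by (simp add: Veq[of y])
    also have "\<dots> \<le> (\<integral>z. indicator (cball y d) z * (exp (pi * d\<^sup>2) * u z) \<partial>lborel)"
    proof (rule integral_mono[OF _ iint])
      show "integrable lborel (\<lambda>z. indicator (cball y d) z * gauss (x - y))"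
        using emeasure_lborel_cball_finite[of y d]
        by (intro integrable_mult_left integrable_real_indicator) auto
      fix z
      have "gauss (x - y) \<le> exp (pi * d\<^sup>2) * u z" if "z \<in> cball y d"
      proof -
        have "norm (z - x) \<le> norm (x - y) + d"
          using that norm_triangle_ineq[of "z - y" "y - x"] by (simp add: dist_norm norm_minus_commute)
        then have "(norm (z - x))\<^sup>2 \<le> (norm (x - y) + d)\<^sup>2" by (intro power_mono) auto
        also have "\<dots> \<le> 2 * (norm (x - y))\<^sup>2 + 2 * d\<^sup>2"
          using zero_le_power2[of "norm (x - y) - d"] by (simp add: power2_eq_square algebra_simps)
        also have "\<dots> \<le> 4 * ((norm (x - y))\<^sup>2 + d\<^sup>2)" by simp
        finally have "(norm ((1/2) *\<^sub>R (z - x)))\<^sup>2 \<le> (norm (x - y))\<^sup>2 + d\<^sup>2"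
          by (simp add: power_divide)
        then have "pi * (norm ((1/2) *\<^sub>R (z - x)))\<^sup>2 \<le> pi * ((norm (x - y))\<^sup>2 + d\<^sup>2)"
          by (intro mult_left_mono) auto
        then show ?thesis unfolding u_def gauss_def by (simp only: exp_add[symmetric] exp_le_cancel_iff) (simp add: algebra_simps)
      qed
      then show "indicator (cball y d) z * gauss (x - y) \<le> indicator (cball y d) z * (exp (pi * d\<^sup>2) * u z)"
        by (auto simp: indicator_def)
    qed
    finally show ?thesis .
  qed
  have "?V * (\<Sum>y\<in>T. gauss (x - y)) \<le> (\<Sum>y\<in>T. \<integral>z. indicator (cball y d) z * (exp (pi * d\<^sup>2) * u z) \<partial>lborel)"
    unfolding sum_distrib_left by (intro sum_mono single)
  also have "\<dots> = (\<integral>z. (\<Sum>y\<in>T. indicator (cball y d) z * (exp (pi * d\<^sup>2) * u z)) \<partial>lborel)"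
    by (intro Bochner_Integration.integral_sum[symmetric] iint)
  also have "\<dots> \<le> (\<integral>z. exp (pi * d\<^sup>2) * u z \<partial>lborel)"
  proof (rule integral_mono)
    show "integrable lborel (\<lambda>z. \<Sum>y\<in>T. indicator (cball y d) z * (exp (pi * d\<^sup>2) * u z))"
      by (intro Bochner_Integration.integrable_sum iint)
    show "integrable lborel (\<lambda>z. exp (pi * d\<^sup>2) * u z)" by (intro integrable_mult_right ui)
    fix z
    have "a = b" if "a \<in> {y \<in> T. z \<in> cball y d}" "b \<in> {y \<in> T. z \<in> cball y d}" for a b
      using that sep[of a b] dist_triangle2[of a b z] by (fastforce simp: dist_commute)
    then have "card {y \<in> T. z \<in> cball y d} \<le> Suc 0"
      using T by (subst card_le_Suc0_iff_eq) auto
    moreover have "(\<Sum>y\<in>T. indicator (cball y d) z) = real (card {y \<in> T. z \<in> cball y d})"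
      using T by (simp add: indicator_def sum.If_cases Int_def)
    ultimately have "(\<Sum>y\<in>T. indicator (cball y d) z) \<le> (1::real)" by simp
    from mult_right_mono[OF this, of "exp (pi * d\<^sup>2) * u z"]
    show "(\<Sum>y\<in>T. indicator (cball y d) z * (exp (pi * d\<^sup>2) * u z)) \<le> exp (pi * d\<^sup>2) * u z"
      using u0[of z] by (simp add: sum_distrib_right)
  qed
  also have "\<dots> = exp (pi * d\<^sup>2) * 2 ^ DIM('a)" by (simp add: ui(2))
  finally show ?thesis using V by (simp add: pos_le_divide_eq mult.commute)
qed

text \<open>A multiple of the Gaussian majorizes the indicator function of the spectrum, and its transform is
  summable over a separated set, so Schur's test bounds the exponential sum.\<close>

lemma integral_gauss_exponential_sum_le:
  fixes c :: "'a::euclidean_space \<Rightarrow> complex"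
  assumes T: "finite T" and B: "\<And>x. x \<in> T \<Longrightarrow> (\<Sum>y\<in>T. gauss (x - y)) \<le> B"
  shows "integrable lborel (\<lambda>\<gamma>. gauss \<gamma> * (cmod (\<Sum>x\<in>T. c x * wave x \<gamma>))\<^sup>2)"
    and "(\<integral>\<gamma>. gauss \<gamma> * (cmod (\<Sum>x\<in>T. c x * wave x \<gamma>))\<^sup>2 \<partial>lborel) \<le> B * (\<Sum>x\<in>T. (cmod (c x))\<^sup>2)"
proof -
  let ?P = "\<lambda>\<gamma>. \<Sum>x\<in>T. c x * wave x \<gamma>"
  let ?g = "\<lambda>\<gamma>::'a. complex_of_real (gauss \<gamma>)"
  have eq: "complex_of_real (gauss \<gamma> * (cmod (?P \<gamma>))\<^sup>2) = (\<Sum>x\<in>T. \<Sum>y\<in>T. c x * cnj (c y) * (?g \<gamma> * wave \<gamma> (x - y)))" for \<gamma>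
  proof -
    have "complex_of_real ((cmod (?P \<gamma>))\<^sup>2) = ?P \<gamma> * cnj (?P \<gamma>)" by (rule complex_norm_square)
    also have "\<dots> = (\<Sum>x\<in>T. \<Sum>y\<in>T. (c x * wave x \<gamma>) * (cnj (c y) * cnj (wave y \<gamma>)))"
      by (simp add: sum_product)
    also have "\<dots> = (\<Sum>x\<in>T. \<Sum>y\<in>T. c x * cnj (c y) * wave \<gamma> (x - y))"
    proof (intro sum.cong refl)
      fix x y
      have "wave \<gamma> (x - y) = wave x \<gamma> * cnj (wave y \<gamma>)"
        using wave_add_right[of \<gamma> x "- y"] by (simp add: cnj_wave wave_commute[of \<gamma>] wave_minus_left)
      then show "(c x * wave x \<gamma>) * (cnj (c y) * cnj (wave y \<gamma>)) = c x * cnj (c y) * wave \<gamma> (x - y)" by simp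
    qed
    finally show ?thesis by (simp add: sum_distrib_left mult_ac)
  qed
  have int: "integrable lborel (\<lambda>\<gamma>. c x * cnj (c y) * (?g \<gamma> * wave \<gamma> (x - y)))" for x y
    by (intro integrable_mult_right gauss_fourier(2))
  have int2: "integrable lborel (\<lambda>\<gamma>. complex_of_real (gauss \<gamma> * (cmod (?P \<gamma>))\<^sup>2))"
    unfolding eq by (intro Bochner_Integration.integrable_sum int)
  then show "integrable lborel (\<lambda>\<gamma>. gauss \<gamma> * (cmod (?P \<gamma>))\<^sup>2)"
    by (simp only: complex_of_real_integrable_eq)
  have "complex_of_real (\<integral>\<gamma>. gauss \<gamma> * (cmod (?P \<gamma>))\<^sup>2 \<partial>lborel) = (\<integral>\<gamma>. complex_of_real (gauss \<gamma> * (cmod (?P \<gamma>))\<^sup>2) \<partial>lborel)"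
    by (rule integral_complex_of_real[symmetric])
  also have "\<dots> = (\<Sum>x\<in>T. \<Sum>y\<in>T. \<integral>\<gamma>. c x * cnj (c y) * (?g \<gamma> * wave \<gamma> (x - y)) \<partial>lborel)"
    unfolding eq by (simp only: Bochner_Integration.integral_sum Bochner_Integration.integrable_sum int)
  also have "\<dots> = (\<Sum>x\<in>T. \<Sum>y\<in>T. c x * cnj (c y) * gauss (x - y))"
    by (simp only: integral_mult_right_zero gauss_fourier(1))
  finally have sum_eq: "complex_of_real (\<integral>\<gamma>. gauss \<gamma> * (cmod (?P \<gamma>))\<^sup>2 \<partial>lborel) = (\<Sum>x\<in>T. \<Sum>y\<in>T. c x * cnj (c y) * gauss (x - y))" .
  have "(\<integral>\<gamma>. gauss \<gamma> * (cmod (?P \<gamma>))\<^sup>2 \<partial>lborel) \<le> cmod (complex_of_real (\<integral>\<gamma>. gauss \<gamma> * (cmod (?P \<gamma>))\<^sup>2 \<partial>lborel))"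
    by (simp only: norm_of_real abs_ge_self)
  also have "\<dots> \<le> (\<Sum>x\<in>T. \<Sum>y\<in>T. cmod (c x) * cmod (c y) * gauss (x - y))"
    \<comment> \<open>The Schur test for the symmetric kernel: the product of two coefficients is
      split by the arithmetic-geometric mean, and exchanging the summation variables reduces
      everything to row sums.\<close>
    unfolding sum_eq by (intro sum_norm_le) (auto simp: norm_mult gauss_bounds)
  also have "\<dots> \<le> (\<Sum>x\<in>T. \<Sum>y\<in>T. ((cmod (c x))\<^sup>2 * gauss (x - y) + (cmod (c y))\<^sup>2 * gauss (x - y)) / 2)"
  proof (intro sum_mono)
    fix x y
    have "2 * (cmod (c x) * cmod (c y)) \<le> (cmod (c x))\<^sup>2 + (cmod (c y))\<^sup>2"
      using zero_le_power2[of "cmod (c x) - cmod (c y)"] by (simp add: power2_eq_square algebra_simps)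
    from mult_right_mono[OF this gauss_bounds(3)[of "x - y"]]
    show "cmod (c x) * cmod (c y) * gauss (x - y) \<le> ((cmod (c x))\<^sup>2 * gauss (x - y) + (cmod (c y))\<^sup>2 * gauss (x - y)) / 2"
      by (simp add: algebra_simps)
  qed
  also have "\<dots> = ((\<Sum>x\<in>T. \<Sum>y\<in>T. (cmod (c x))\<^sup>2 * gauss (x - y)) + (\<Sum>x\<in>T. \<Sum>y\<in>T. (cmod (c y))\<^sup>2 * gauss (x - y))) / 2"
    by (simp only: sum_divide_distrib[symmetric] sum.distrib)
  also have "(\<Sum>x\<in>T. \<Sum>y\<in>T. (cmod (c y))\<^sup>2 * gauss (x - y)) = (\<Sum>x\<in>T. \<Sum>y\<in>T. (cmod (c x))\<^sup>2 * gauss (x - y))"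
  proof -
    have sym: "gauss (y - x) = gauss (x - y)" for x y :: 'a by (metis gauss_minus minus_diff_eq)
    show ?thesis by (subst sum.swap) (intro sum.cong refl arg_cong2[where f = "(*)"] sym)
  qed
  also have "((\<Sum>x\<in>T. \<Sum>y\<in>T. (cmod (c x))\<^sup>2 * gauss (x - y)) + (\<Sum>x\<in>T. \<Sum>y\<in>T. (cmod (c x))\<^sup>2 * gauss (x - y))) / 2
      = (\<Sum>x\<in>T. (cmod (c x))\<^sup>2 * (\<Sum>y\<in>T. gauss (x - y)))"
  proof -
    have "(a + a) / 2 = a" for a :: real by simp
    then show ?thesis by (simp only: sum_distrib_left)
  qed
  also have "\<dots> \<le> (\<Sum>x\<in>T. (cmod (c x))\<^sup>2 * B)"
    by (intro sum_mono mult_left_mono B) auto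
  also have "\<dots> = B * (\<Sum>x\<in>T. (cmod (c x))\<^sup>2)" by (simp add: sum_distrib_left mult.commute)
  finally show "(\<integral>\<gamma>. gauss \<gamma> * (cmod (?P \<gamma>))\<^sup>2 \<partial>lborel) \<le> B * (\<Sum>x\<in>T. (cmod (c x))\<^sup>2)" .
qed

text \<open>Duality: \<open>?S\<close> equals the pairing of \<open>F\<close> with the exponential
  sum \<open>?P\<close> whose coefficients are the conjugate samples. A weighted Young inequality
  bounds \<open>2 * ?S\<close> by the norm of \<open>F\<close> plus a term in \<open>?P\<close>;
  that term is at most \<open>?S\<close> and is absorbed on the left.\<close>

lemma finite_sum_samples_le:
  fixes F :: "'a::euclidean_space \<Rightarrow> complex"
  assumes F: "F \<in> L2_on S" and S: "S \<subseteq> cball 0 r"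
    and T: "finite T" and B: "B > 0" "\<And>x. x \<in> T \<Longrightarrow> (\<Sum>y\<in>T. gauss (x - y)) \<le> B"
  shows "(\<Sum>x\<in>T. (cmod (inv_fourier F x))\<^sup>2) \<le> exp (pi * r\<^sup>2) * B * (\<integral>\<gamma>. (cmod (F \<gamma>))\<^sup>2 \<partial>lborel)"
proof -
  have bS: "bounded S" using S bounded_cball bounded_subset by blast
  have Fi: "integrable lborel F" by (rule L2_on_integrable[OF F bS])
  let ?f = "inv_fourier F"
  let ?P = "\<lambda>\<gamma>. \<Sum>x\<in>T. cnj (?f x) * wave x \<gamma>"
  let ?S = "\<Sum>x\<in>T. (cmod (?f x))\<^sup>2"
  \<comment> \<open>\<open>1 / e\<close> is the minimum of the Gaussian on the ball of radius
    \<open>r\<close>, hence a lower bound on the spectrum.\<close>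
  define e where "e = exp (pi * r\<^sup>2)"
  have e: "e > 0" by (simp add: e_def)
  have FP: "integrable lborel (\<lambda>\<gamma>. cnj (?f x) * (F \<gamma> * wave x \<gamma>))" for x
    using Fi by (intro integrable_mult_right integrable_mult_wave) auto
  have FPeq: "F \<gamma> * ?P \<gamma> = (\<Sum>x\<in>T. cnj (?f x) * (F \<gamma> * wave x \<gamma>))" for \<gamma>
    by (simp add: sum_distrib_left mult_ac)
  have FPi: "integrable lborel (\<lambda>\<gamma>. F \<gamma> * ?P \<gamma>)" unfolding FPeq by (intro Bochner_Integration.integrable_sum FP)
  have "(\<integral>\<gamma>. F \<gamma> * ?P \<gamma> \<partial>lborel) = (\<Sum>x\<in>T. cnj (?f x) * ?f x)"
    unfolding FPeq by (simp only: Bochner_Integration.integral_sum FP integral_mult_right_zero inv_fourier_wave[symmetric])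
  also have "\<dots> = complex_of_real ?S"
    by (simp only: of_real_sum complex_norm_square mult.commute)
  finally have S_eq: "?S = Re (\<integral>\<gamma>. F \<gamma> * ?P \<gamma> \<partial>lborel)" by simp
  note G = integral_gauss_exponential_sum_le[OF T B(2), of "\<lambda>x. cnj (?f x)"]
  have "2 * ?S = (\<integral>\<gamma>. 2 * Re (F \<gamma> * ?P \<gamma>) \<partial>lborel)"
    unfolding S_eq by (simp only: integral_mult_right_zero integral_Re[OF FPi])
  also have "\<dots> \<le> (\<integral>\<gamma>. (e * B) * (cmod (F \<gamma>))\<^sup>2 + (1 / B) * (gauss \<gamma> * (cmod (?P \<gamma>))\<^sup>2) \<partial>lborel)"
  proof (rule integral_mono)
    show "integrable lborel (\<lambda>\<gamma>. 2 * Re (F \<gamma> * ?P \<gamma>))" by (intro integrable_mult_right integrable_Re FPi)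
    show "integrable lborel (\<lambda>\<gamma>. (e * B) * (cmod (F \<gamma>))\<^sup>2 + (1 / B) * (gauss \<gamma> * (cmod (?P \<gamma>))\<^sup>2))"
      by (intro Bochner_Integration.integrable_add integrable_mult_right L2_onD(2)[OF F] G(1)) auto
    fix \<gamma> :: 'a
    show "2 * Re (F \<gamma> * ?P \<gamma>) \<le> (e * B) * (cmod (F \<gamma>))\<^sup>2 + (1 / B) * (gauss \<gamma> * (cmod (?P \<gamma>))\<^sup>2)"
    proof (cases "\<gamma> \<in> S")
      case True
      then have "norm \<gamma> \<le> r" using S by auto
      then have "(norm \<gamma>)\<^sup>2 \<le> r\<^sup>2" by (intro power_mono) auto
      then have g: "1 / e \<le> gauss \<gamma>" unfolding gauss_def e_def by (simp add: exp_minus[symmetric] inverse_eq_divide[symmetric])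
      let ?a = "cmod (F \<gamma>)" and ?b = "cmod (?P \<gamma>)"
      have "2 * Re (F \<gamma> * ?P \<gamma>) \<le> 2 * (?a * ?b)" unfolding norm_mult[symmetric] using complex_Re_le_cmod[of "F \<gamma> * ?P \<gamma>"] by linarith
      also have "\<dots> \<le> (e * B) * ?a\<^sup>2 + ?b\<^sup>2 / (e * B)"
      proof -
        have "0 \<le> (e * B * ?a - ?b)\<^sup>2 / (e * B)" using e B(1) by simp
        also have "\<dots> = (e * B) * ?a\<^sup>2 + ?b\<^sup>2 / (e * B) - 2 * (?a * ?b)"
          using e B(1) by (simp add: power2_eq_square field_simps)
        finally show ?thesis by simp
      qed
      also have "?b\<^sup>2 / (e * B) = (1 / B) * ((1 / e) * ?b\<^sup>2)" by simp
      also have "\<dots> \<le> (1 / B) * (gauss \<gamma> * ?b\<^sup>2)" using g B(1) by (intro mult_left_mono mult_right_mono) auto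
      finally show ?thesis by simp
    next
      case False
      then show ?thesis using L2_onD(3)[OF F False] B(1) by (simp add: gauss_bounds)
    qed
  qed
  also have "\<dots> = (e * B) * (\<integral>\<gamma>. (cmod (F \<gamma>))\<^sup>2 \<partial>lborel) + (1 / B) * (\<integral>\<gamma>. gauss \<gamma> * (cmod (?P \<gamma>))\<^sup>2 \<partial>lborel)"
    by (subst Bochner_Integration.integral_add)
       (auto simp only: integral_mult_right_zero intro!: integrable_mult_right L2_onD(2)[OF F] G(1))
  also have "\<dots> \<le> (e * B) * (\<integral>\<gamma>. (cmod (F \<gamma>))\<^sup>2 \<partial>lborel) + ?S"
    using G(2) B(1) by (simp add: pos_divide_le_eq mult.commute)
  finally show ?thesis by (simp add: e_def)
qed

lemma separated_upper_frame_bound: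
  fixes E \<Lambda> :: "'a::euclidean_space set"
  assumes E: "separated E" and \<Lambda>: "bounded \<Lambda>"
  shows "\<exists>B>0. \<forall>F\<in>L2_on \<Lambda>. (\<lambda>x. (cmod (inv_fourier F x))\<^sup>2) summable_on E \<and>
     (\<Sum>\<^sub>\<infinity>x\<in>E. (cmod (inv_fourier F x))\<^sup>2) \<le> B * (\<integral>\<gamma>. (cmod (F \<gamma>))\<^sup>2 \<partial>lborel)"
proof -
  obtain r where r: "\<Lambda> \<subseteq> cball 0 r" using \<Lambda> bounded_subset_ballD[of \<Lambda> 0] ball_subset_cball by blast
  obtain \<delta> where \<delta>: "\<delta> > 0" "\<And>x y. x \<in> E \<Longrightarrow> y \<in> E \<Longrightarrow> x \<noteq> y \<Longrightarrow> \<delta> \<le> dist x y"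
    using E by (auto simp: separated_def)
  \<comment> \<open>A third instead of a half makes \<open>2 * d < \<delta>\<close> strict, so that
    the closed balls are disjoint.\<close>
  define d where "d = \<delta> / 3"
  have d: "d > 0" using \<delta> by (simp add: d_def)
  define B where "B = exp (pi * d\<^sup>2) * 2 ^ DIM('a) / measure lborel (cball (0::'a) d)"
  have B: "B > 0" unfolding B_def using content_cball_pos[OF d, of "0::'a"] by (intro divide_pos_pos mult_pos_pos) auto
  have fin: "(\<Sum>x\<in>T. (cmod (inv_fourier F x))\<^sup>2) \<le> exp (pi * r\<^sup>2) * B * (\<integral>\<gamma>. (cmod (F \<gamma>))\<^sup>2 \<partial>lborel)"
    if "F \<in> L2_on \<Lambda>" "finite T" "T \<subseteq> E" for F T
  proof (rule finite_sum_samples_le[OF that(1) r that(2) B])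
    have "2 * d < dist x y" if "x \<in> T" "y \<in> T" "x \<noteq> y" for x y
      using \<delta>(2)[of x y] that \<open>T \<subseteq> E\<close> \<delta>(1) by (auto simp: d_def subset_iff)
    then show "(\<Sum>y\<in>T. gauss (x - y)) \<le> B" for x
      unfolding B_def by (intro gauss_sum_separated_le[OF d _ that(2)])
  qed
  show ?thesis
  proof (intro exI[of _ "exp (pi * r\<^sup>2) * B"] conjI ballI)
    show "exp (pi * r\<^sup>2) * B > 0" using B by simp
    fix F assume F: "F \<in> L2_on \<Lambda>"
    show sum: "(\<lambda>x. (cmod (inv_fourier F x))\<^sup>2) summable_on E"
    proof (rule nonneg_bdd_above_summable_on)
      show "bdd_above (sum (\<lambda>x. (cmod (inv_fourier F x))\<^sup>2) ` {T. T \<subseteq> E \<and> finite T})"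
        using fin[OF F] by (intro bdd_aboveI) auto
    qed simp
    show "(\<Sum>\<^sub>\<infinity>x\<in>E. (cmod (inv_fourier F x))\<^sup>2) \<le> exp (pi * r\<^sup>2) * B * (\<integral>\<gamma>. (cmod (F \<gamma>))\<^sup>2 \<partial>lborel)"
      by (rule infsum_le_finite_sums[OF sum fin[OF F]])
  qed
qed

section \<open>Dilated sample sets and the final estimate\<close>

lemma separated_scaleR:
  fixes E :: "'a::euclidean_space set"
  assumes "separated E" "c > 0"
  shows "separated ((*\<^sub>R) c ` E)"
proof -
  obtain \<delta> where \<delta>: "\<delta> > 0" "\<And>x y. x \<in> E \<Longrightarrow> y \<in> E \<Longrightarrow> x \<noteq> y \<Longrightarrow> \<delta> \<le> dist x y"
    using assms by (auto simp: separated_def)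
  moreover have "dist (c *\<^sub>R x) (c *\<^sub>R y) = c * dist x y" for x y :: 'a
    using \<open>c > 0\<close> by (simp add: dist_norm flip: scaleR_right_diff_distrib)
  ultimately show ?thesis
    using \<open>c > 0\<close> unfolding separated_def by (intro exI[of _ "c * \<delta>"]) auto
qed

text \<open>Sampling \<open>f (c x)\<close> on \<open>E\<close> is sampling \<open>f\<close> on the
  dilate of \<open>E\<close>, which is again separated.\<close>

lemma separated_dilated_upper_frame_bound:
  fixes E \<Lambda> :: "'a::euclidean_space set"
  assumes E: "separated E" and "bounded \<Lambda>" and c: "c > 0"
  shows "\<exists>B>0. \<forall>F\<in>L2_on \<Lambda>. (\<lambda>x. (cmod (inv_fourier F (c *\<^sub>R x)))\<^sup>2) summable_on E \<and>
     (\<Sum>\<^sub>\<infinity>x\<in>E. (cmod (inv_fourier F (c *\<^sub>R x)))\<^sup>2) \<le> B * (\<integral>\<gamma>. (cmod (F \<gamma>))\<^sup>2 \<partial>lborel)"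
proof -
  have inj: "inj_on ((*\<^sub>R) c) E" using c by (simp add: inj_on_def)
  show ?thesis
    using separated_upper_frame_bound[OF separated_scaleR[OF E c] \<open>bounded \<Lambda>\<close>]
    unfolding summable_on_reindex[OF inj] infsum_reindex[OF inj] o_def .
qed

text \<open>0 is the midpoint of an interior point \<open>c\<close> and its reflection in
  \<open>\<Lambda>\<close>; proper convex combinations with an interior point are interior.\<close>

lemma zero_in_interior_symmetric_convex:
  fixes \<Lambda> :: "'a::euclidean_space set"
  assumes "convex \<Lambda>" "\<forall>\<gamma>\<in>\<Lambda>. - \<gamma> \<in> \<Lambda>" "interior \<Lambda> \<noteq> {}"
  shows "0 \<in> interior \<Lambda>"
proof -
  obtain c where c: "c \<in> interior \<Lambda>" using assms(3) by blast
  then have "- c \<in> \<Lambda>" using assms(2) interior_subset by blast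
  from mem_interior_convex_shrink[OF assms(1) c this, of "1/2"]
  have "- c - (1/2) *\<^sub>R (- c - c) \<in> interior \<Lambda>" by simp
  moreover have "- c - (1/2) *\<^sub>R (- c - c) = 0" by (simp add: algebra_simps flip: scaleR_2)
  ultimately show ?thesis by simp
qed

text \<open>A convex set without interior lies in a hyperplane and is therefore null.\<close>

lemma inv_fourier_zero_of_empty_interior:
  fixes \<Lambda> :: "'a::euclidean_space set"
  assumes F: "F \<in> L2_on \<Lambda>" and "convex \<Lambda>" "interior \<Lambda> = {}"
  shows "inv_fourier F = (\<lambda>_. 0)"
proof
  fix x
  obtain a b where ab: "a \<noteq> 0" "\<Lambda> \<subseteq> {x. a \<bullet> x = b}"
    using empty_interior_subset_hyperplane[OF assms(2,3)] by blast
  then have "negligible \<Lambda>" using negligible_hyperplane[of a b] negligible_subset by blast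
  then have "\<Lambda> \<in> null_sets lebesgue" by (simp add: negligible_iff_null_sets)
  then have "AE \<gamma> in lborel. \<gamma> \<notin> \<Lambda>" using AE_not_in AE_completion_iff by blast
  then have "AE \<gamma> in lborel. F \<gamma> * wave x \<gamma> = 0"
    by eventually_elim (simp add: L2_onD(3)[OF F])
  then show "inv_fourier F x = 0" unfolding inv_fourier_wave by (rule integral_eq_zero_AE)
qed

text \<open>Dilation by \<open>c \<ge> 1\<close> divides the square integral by
  \<open>c ^ DIM('a)\<close>, so each dilate is bounded by \<open>F\<close> itself. The 9 is three
  such terms times the 3 from \<open>|u + v + w|^2 \<le> 3 (|u|^2 + |v|^2 + |w|^2)\<close>.\<close>

lemma integral_three_dilates_le:
  fixes F :: "'a::euclidean_space \<Rightarrow> complex"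
  assumes F: "F \<in> L2_on \<Lambda>"
  shows "(\<integral>\<gamma>. indicator \<Lambda> \<gamma> * (cmod (F \<gamma> + F (2 *\<^sub>R \<gamma>) + F (3 *\<^sub>R \<gamma>)))\<^sup>2 \<partial>lborel) \<le> 9 * (\<integral>\<gamma>. (cmod (F \<gamma>))\<^sup>2 \<partial>lborel)"
proof -
  let ?I = "\<integral>\<gamma>. (cmod (F \<gamma>))\<^sup>2 \<partial>lborel"
  have [measurable]: "F \<in> borel_measurable borel" using F by (rule L2_onD)
  note Fi = L2_onD(2)[OF F]
  have I0: "?I \<ge> 0" by simp
  have dil: "integrable lborel (\<lambda>\<gamma>. (cmod (F (c *\<^sub>R \<gamma>)))\<^sup>2)" "(\<integral>\<gamma>. (cmod (F (c *\<^sub>R \<gamma>)))\<^sup>2 \<partial>lborel) \<le> ?I"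
    if "c \<ge> 1" for c :: real
  proof -
    have c: "c > 0" using that by simp
    note sc = lborel_integral_scale[of "\<lambda>\<gamma>. (cmod (F \<gamma>))\<^sup>2" c 0]
    show "integrable lborel (\<lambda>\<gamma>. (cmod (F (c *\<^sub>R \<gamma>)))\<^sup>2)" using sc(2) c Fi by simp
    have "1 * (\<integral>\<gamma>. (cmod (F (c *\<^sub>R \<gamma>)))\<^sup>2 \<partial>lborel) \<le> c ^ DIM('a) * (\<integral>\<gamma>. (cmod (F (c *\<^sub>R \<gamma>)))\<^sup>2 \<partial>lborel)"
      by (intro mult_right_mono one_le_power that) simp
    also have "\<dots> = ?I" using sc(1) c by simp
    finally show "(\<integral>\<gamma>. (cmod (F (c *\<^sub>R \<gamma>)))\<^sup>2 \<partial>lborel) \<le> ?I" by simp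
  qed
  have d2: "integrable lborel (\<lambda>\<gamma>. (cmod (F (2 *\<^sub>R \<gamma>)))\<^sup>2)" "(\<integral>\<gamma>. (cmod (F (2 *\<^sub>R \<gamma>)))\<^sup>2 \<partial>lborel) \<le> ?I"
    and d3: "integrable lborel (\<lambda>\<gamma>. (cmod (F (3 *\<^sub>R \<gamma>)))\<^sup>2)" "(\<integral>\<gamma>. (cmod (F (3 *\<^sub>R \<gamma>)))\<^sup>2 \<partial>lborel) \<le> ?I"
    using dil by auto
  have "(\<integral>\<gamma>. indicator \<Lambda> \<gamma> * (cmod (F \<gamma> + F (2 *\<^sub>R \<gamma>) + F (3 *\<^sub>R \<gamma>)))\<^sup>2 \<partial>lborel)
      \<le> (\<integral>\<gamma>. 3 * ((cmod (F \<gamma>))\<^sup>2 + (cmod (F (2 *\<^sub>R \<gamma>)))\<^sup>2 + (cmod (F (3 *\<^sub>R \<gamma>)))\<^sup>2) \<partial>lborel)"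
  proof (rule integral_mono')
    show "integrable lborel (\<lambda>\<gamma>. 3 * ((cmod (F \<gamma>))\<^sup>2 + (cmod (F (2 *\<^sub>R \<gamma>)))\<^sup>2 + (cmod (F (3 *\<^sub>R \<gamma>)))\<^sup>2))"
      by (intro integrable_mult_right Bochner_Integration.integrable_add Fi d2 d3)
    fix \<gamma> :: 'a
    have tri: "(cmod (u + v + w))\<^sup>2 \<le> 3 * ((cmod u)\<^sup>2 + (cmod v)\<^sup>2 + (cmod w)\<^sup>2)" for u v w
    proof -
      have "cmod (u + v + w) \<le> cmod u + cmod v + cmod w"
        using norm_triangle_ineq[of "u + v" w] norm_triangle_ineq[of u v] by linarith
      then have "(cmod (u + v + w))\<^sup>2 \<le> (cmod u + cmod v + cmod w)\<^sup>2" by (intro power_mono) auto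
      also have "\<dots> \<le> 3 * ((cmod u)\<^sup>2 + (cmod v)\<^sup>2 + (cmod w)\<^sup>2)"
        using zero_le_power2[of "cmod u - cmod v"] zero_le_power2[of "cmod v - cmod w"] zero_le_power2[of "cmod u - cmod w"]
        by (simp add: power2_eq_square algebra_simps)
      finally show ?thesis .
    qed
    show "indicator \<Lambda> \<gamma> * (cmod (F \<gamma> + F (2 *\<^sub>R \<gamma>) + F (3 *\<^sub>R \<gamma>)))\<^sup>2
        \<le> 3 * ((cmod (F \<gamma>))\<^sup>2 + (cmod (F (2 *\<^sub>R \<gamma>)))\<^sup>2 + (cmod (F (3 *\<^sub>R \<gamma>)))\<^sup>2)"
      using tri by (simp add: indicator_def)
  qed simp
  also have "\<dots> = 3 * (?I + (\<integral>\<gamma>. (cmod (F (2 *\<^sub>R \<gamma>)))\<^sup>2 \<partial>lborel) + (\<integral>\<gamma>. (cmod (F (3 *\<^sub>R \<gamma>)))\<^sup>2 \<partial>lborel))"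
    by (simp only: integral_mult_right_zero Bochner_Integration.integral_add Bochner_Integration.integrable_add Fi d2 d3)
  also have "\<dots> \<le> 9 * ?I" 
  proof -
    have "3 * (i + p + q) \<le> 9 * i" if "p \<le> i" "q \<le> i" for i p q :: real
      using add_mono[OF that] by simp
    from this[OF d2(2) d3(2)] show ?thesis .
  qed
  finally show ?thesis .
qed

theorem theorem4p2:
  fixes E \<Lambda> :: "'a::euclidean_space set"
  assumes "separated E"
    and "compact \<Lambda>" and "S_set \<Lambda>" and "strict_multiplicity \<Lambda>"
    and "convex \<Lambda>" and "\<forall>\<gamma>\<in>\<Lambda>. - \<gamma> \<in> \<Lambda>"
    and "balayage E \<Lambda>"
  shows "\<exists>A B. A > 0 \<and> B > 0 \<and>
    (\<forall>F \<in> L2_on \<Lambda>. inv_fourier F \<noteq> (\<lambda>_. 0) \<longrightarrow>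
      (let f = inv_fourier F;
           nF = sqrt (\<integral>\<gamma>. indicator \<Lambda> \<gamma> * (cmod (F \<gamma>))\<^sup>2 \<partial>lborel);
           S = (\<lambda>c::real. \<Sum>\<^sub>\<infinity>x\<in>E. (cmod (f (c *\<^sub>R x)))\<^sup>2);
           mid = sqrt (S 1) + 1/2 * sqrt (S (1/2)) + 1/3 * sqrt (S (1/3))
       in (\<forall>c\<in>{1, 1/2, 1/3}. (\<lambda>x. (cmod (f (c *\<^sub>R x)))\<^sup>2) summable_on E) \<and>
          sqrt A * (\<integral>\<gamma>. indicator \<Lambda> \<gamma> * (cmod (F \<gamma> + F (2 *\<^sub>R \<gamma>) + F (3 *\<^sub>R \<gamma>)))\<^sup>2 \<partial>lborel) / nF
            \<le> mid \<and>
          mid \<le> sqrt B * nF))"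
proof (cases "interior \<Lambda> = {}")
  case True
  then have "inv_fourier F = (\<lambda>_. 0)" if "F \<in> L2_on \<Lambda>" for F
    using that \<open>convex \<Lambda>\<close> by (intro inv_fourier_zero_of_empty_interior)
  \<comment> \<open>There is no nonzero \<open>f\<close> to be estimated, so any positive constants
    do.\<close>
  then show ?thesis by (intro exI[of _ 1]) auto
next
  case False
  have bdd: "bounded \<Lambda>" using \<open>compact \<Lambda>\<close> by (rule compact_imp_bounded)
  have "0 \<in> interior \<Lambda>" using assms(5,6) False by (rule zero_in_interior_symmetric_convex)
  then obtain \<rho> where \<rho>: "\<rho> > 0" "cball 0 \<rho> \<subseteq> \<Lambda>" by (auto simp: mem_interior_cball)
  obtain A where A: "A > 0" and lower: "\<And>F. F \<in> L2_on \<Lambda> \<Longrightarrow> (\<lambda>x. (cmod (inv_fourier F x))\<^sup>2) summable_on E \<Longrightarrow>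
     A * (\<integral>\<gamma>. (cmod (F \<gamma>))\<^sup>2 \<partial>lborel) \<le> (\<Sum>\<^sub>\<infinity>x\<in>E. (cmod (inv_fourier F x))\<^sup>2)"
    using balayage_imp_lower_frame_bound[OF assms(1) bdd assms(5,6) \<rho>(2,1) assms(7)] by blast
  have "\<exists>b. \<forall>c>0. b c > 0 \<and> (\<forall>F\<in>L2_on \<Lambda>. (\<lambda>x. (cmod (inv_fourier F (c *\<^sub>R x)))\<^sup>2) summable_on E \<and>
     (\<Sum>\<^sub>\<infinity>x\<in>E. (cmod (inv_fourier F (c *\<^sub>R x)))\<^sup>2) \<le> b c * (\<integral>\<gamma>. (cmod (F \<gamma>))\<^sup>2 \<partial>lborel))"
    using separated_dilated_upper_frame_bound[OF assms(1) bdd] by metis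
  then obtain b where b: "\<And>c. c > 0 \<Longrightarrow> b c > 0" and
    summ: "\<And>c F. c > 0 \<Longrightarrow> F \<in> L2_on \<Lambda> \<Longrightarrow> (\<lambda>x. (cmod (inv_fourier F (c *\<^sub>R x)))\<^sup>2) summable_on E" and
    upper: "\<And>c F. c > 0 \<Longrightarrow> F \<in> L2_on \<Lambda> \<Longrightarrow>
     (\<Sum>\<^sub>\<infinity>x\<in>E. (cmod (inv_fourier F (c *\<^sub>R x)))\<^sup>2) \<le> b c * (\<integral>\<gamma>. (cmod (F \<gamma>))\<^sup>2 \<partial>lborel)"
    by blast
  define B where "B = b 1 + b (1/2) + b (1/3)"
  have B: "B > 0" "b 1 \<le> B" "b (1/2) \<le> B" "b (1/3) \<le> B"
    using b[of 1] b[of "1/2"] b[of "1/3"] by (simp_all add: B_def)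
  show ?thesis
  \<comment> \<open>\<open>81 = 9^2\<close> compensates \<open>J \<le> 9 * I\<close>, as
    \<open>A\<close> enters through its square root. \<open>4 = 2^2\<close> covers
    \<open>1 + 1/2 + 1/3 \<le> 2\<close>.\<close>
  proof (rule exI[of _ "A / 81"], rule exI[of _ "4 * B"], intro conjI ballI impI)
    show "A / 81 > 0" "4 * B > 0" using A B by simp_all
    fix F assume F: "F \<in> L2_on \<Lambda>"
    define I where "I = (\<integral>\<gamma>. (cmod (F \<gamma>))\<^sup>2 \<partial>lborel)"
    define S where "S c = (\<Sum>\<^sub>\<infinity>x\<in>E. (cmod (inv_fourier F (c *\<^sub>R x)))\<^sup>2)" for c :: real
    have I: "I \<ge> 0" by (simp add: I_def)
    have "(\<lambda>\<gamma>. indicator \<Lambda> \<gamma> * (cmod (F \<gamma>))\<^sup>2) = (\<lambda>\<gamma>. (cmod (F \<gamma>))\<^sup>2)"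
    proof
      show "indicator \<Lambda> \<gamma> * (cmod (F \<gamma>))\<^sup>2 = (cmod (F \<gamma>))\<^sup>2" for \<gamma>
        using L2_onD(3)[OF F, of \<gamma>] by (cases "\<gamma> \<in> \<Lambda>") auto
    qed
    then have nF: "(\<integral>\<gamma>. indicator \<Lambda> \<gamma> * (cmod (F \<gamma>))\<^sup>2 \<partial>lborel) = I" by (simp add: I_def)
    have S0: "S c \<ge> 0" for c unfolding S_def by (rule infsum_nonneg) simp
    have SB: "sqrt (S c) \<le> sqrt B * sqrt I" if "c \<in> {1, 1/2, 1/3}" for c
    proof -
      have "S c \<le> b c * I" unfolding S_def I_def using that by (intro upper F) auto
      also have "\<dots> \<le> B * I" 
      proof (rule mult_right_mono[OF _ I])
        show "b c \<le> B" using that B(2-4) by blast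
      qed
      finally show ?thesis by (simp add: real_sqrt_mult[symmetric])
    qed
    have "A * I \<le> S 1" using lower[OF F] summ[OF zero_less_one F] by (simp add: S_def I_def)
    then have AS: "sqrt A * sqrt I \<le> sqrt (S 1)" by (simp add: real_sqrt_mult[symmetric])
    define J where "J = (\<integral>\<gamma>. indicator \<Lambda> \<gamma> * (cmod (F \<gamma> + F (2 *\<^sub>R \<gamma>) + F (3 *\<^sub>R \<gamma>)))\<^sup>2 \<partial>lborel)"
    have J: "J \<le> 9 * I" unfolding J_def I_def by (rule integral_three_dilates_le[OF F])
    have "sqrt (A / 81) * J / sqrt I \<le> sqrt (A / 81) * (9 * I) / sqrt I"
      using J I A by (intro divide_right_mono mult_left_mono) auto
    also have "\<dots> = sqrt A * sqrt I"
    proof -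
      have "sqrt (81::real) = 9" by (rule real_sqrt_unique) auto
      then have "sqrt (A / 81) * (9 * I) / sqrt I = sqrt A * (I / sqrt I)" by (simp add: real_sqrt_divide)
      \<comment> \<open>\<open>I / sqrt I = sqrt I\<close> for every \<open>I \<ge> 0\<close>; at 0
        it rests on division by zero being 0.\<close>
      then show ?thesis by (simp only: real_div_sqrt[OF I])
    qed
    also have "\<dots> \<le> sqrt (S 1) + 1/2 * sqrt (S (1/2)) + 1/3 * sqrt (S (1/3))"
      using AS S0 by (simp add: add_increasing2)
    finally have low: "sqrt (A / 81) * J / sqrt I \<le> sqrt (S 1) + 1/2 * sqrt (S (1/2)) + 1/3 * sqrt (S (1/3))" .
    have "sqrt (S 1) + 1/2 * sqrt (S (1/2)) + 1/3 * sqrt (S (1/3)) \<le> 2 * (sqrt B * sqrt I)"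
    proof -
      have "x + 1/2 * y + 1/3 * z \<le> 2 * m" if "x \<le> m" "y \<le> m" "z \<le> m" "0 \<le> m" for x y z m :: real
        using that by argo
      from this[OF SB[of 1] SB[of "1/2"] SB[of "1/3"]] B(1) I show ?thesis by simp
    qed
    also have "\<dots> = sqrt (4 * B) * sqrt I" by (simp add: real_sqrt_mult)
    finally have up: "sqrt (S 1) + 1/2 * sqrt (S (1/2)) + 1/3 * sqrt (S (1/3)) \<le> sqrt (4 * B) * sqrt I" .
    have "\<forall>c\<in>{1, 1/2, 1/3}. (\<lambda>x. (cmod (inv_fourier F (c *\<^sub>R x)))\<^sup>2) summable_on E"
      using summ[of 1, OF _ F] summ[of "1/2", OF _ F] summ[of "1/3", OF _ F] by simp
    then show "let f = inv_fourier F;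
           nF = sqrt (\<integral>\<gamma>. indicator \<Lambda> \<gamma> * (cmod (F \<gamma>))\<^sup>2 \<partial>lborel);
           S = (\<lambda>c::real. \<Sum>\<^sub>\<infinity>x\<in>E. (cmod (f (c *\<^sub>R x)))\<^sup>2);
           mid = sqrt (S 1) + 1/2 * sqrt (S (1/2)) + 1/3 * sqrt (S (1/3))
       in (\<forall>c\<in>{1, 1/2, 1/3}. (\<lambda>x. (cmod (f (c *\<^sub>R x)))\<^sup>2) summable_on E) \<and>
          sqrt (A / 81) * (\<integral>\<gamma>. indicator \<Lambda> \<gamma> * (cmod (F \<gamma> + F (2 *\<^sub>R \<gamma>) + F (3 *\<^sub>R \<gamma>)))\<^sup>2 \<partial>lborel) / nF
            \<le> mid \<and>
          mid \<le> sqrt (4 * B) * nF"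
      using low up unfolding Let_def nF J_def[symmetric] S_def[symmetric] by blast
  qed
qed

end
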